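(* Let $F$ be an infinite field of characteristic different from $2$. Let $(n_i)=(n_1,\ldots,n_k)$ be a vector of non-negative integers, let $l$ and $q$ be respectively the number of indices $i$ with $n_i=1$ and the number of indices $i$ with $n_i=2$, and put $n=\sum_i n_i$. Then $B^{(n_i)}(I_w)=0$ if and only if one of the following conditions holds: (i) $n$ is odd; (ii) $n$ is even and $n_i>2$ for some $i$; (iii) $n$ is even, $n_i\le 2$ for all $i$, $l=0$, and $q$ is odd. Otherwise, the (images of the) proper polynomials $f_S$, as $S$ ranges over the set $N^{(n_i)}$ of normal c-arrays of content $(n_i)$, form a linear basis of the vector space $B^{(n_i)}(I_w)$, whose dimension is $\binom{2s-1}{s}$, where $l=2s$.
   Context: $F\langle X\rangle$ is the free unital associative $F$-algebra on $X=\{x_1,x_2,\ldots\}$; commutators are $[u,v]=uv-vu$, left-normed. $E=E_0\oplus E_1$ is the (unital) Grassmann algebra generated by a vector space of countably infinite dimension over $F$, with even part $E_0$ and odd part $E_1$. Put $R=M_{1,1}(E)=\left\{\begin{pmatrix}a&b\\c&d\end{pmatrix}\mid a,d\in E_0,\ b,c\in E_1\right\}$ and let $W$ be the subspace of matrices of $R$ with supertrace $a-d$ equal to $0$. $I_w$ is the ideal of all $f(x_1,\ldots,x_n)\in F\langle X\rangle$ with $f(w_1,\ldots,w_n)=0$ for all $w_1,\ldots,w_n\in W$. $B$ is the (unital) subalgebra of $F\langle X\rangle$ generated by all commutators $[x_{i_1},\ldots,x_{i_l}]$ of length $l\ge2$ (proper polynomials); $B^{(n_i)}$ is the space of elements of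 $B$ homogeneous of degree $n_i$ in $x_i$ for $1\le i\le k$ and not involving other variables; $B^{(n_i)}(I_w)=B^{(n_i)}/(B^{(n_i)}\cap I_w)$. For a two-rowed array of positive integers $S=\begin{bmatrix}a_1&\ldots&a_m\\ b_1&\ldots&b_m\end{bmatrix}$ put $f_S=[x_{a_1},x_{b_1}]\cdots[x_{a_m},x_{b_m}]$. $S$ has content $(n_1,\ldots,n_k)$ if in the multiset $\{a_1,b_1,\ldots,a_m,b_m\}$ the integer $i$ occurs $n_i$ times for $1\le i\le k$, and $\sum n_i=2m$. $S$ is a c-array if $a_i>b_i$ for all $i$ and $(a_i,b_i)\le(a_{i+1},b_{i+1})$ in the lexicographic order for all $i$. A c-array of content $(n_i)$ is normal if $n_i\le2$ for all $i$ and there are no indices $r<s<t$ with $b_r\le b_s\le b_t$. $N^{(n_i)}$ is the set of normal c-arrays of content $(n_i)$. For $m=0$ there is just the empty array, with $f_S=1$. The convention $\binom{-1}{0}=1$ is used for $s=0$. *)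

theory Defs
  imports
    "HOL-Library.Poly_Mapping"
    "HOL-Library.Multiset"
    "HOL-Analysis.Finite_Cartesian_Product"
    "Jordan_Normal_Form.Missing_VectorSpace"
begin

section \<open>The free associative algebra\<close>

text \<open>
  Words, written additively because \<^theory>\<open>HOL-Library.Poly_Mapping\<close> turns
  finitely supported functions on an additive monoid into its monoid ring.
  Variables are numbered from 0: the letter \<open>i\<close> stands for $x_{i+1}$.
\<close>

datatype word = Word (letters: "nat list")

instantiation word :: monoid_add
begin
definition "0 = Word []"
definition "u + v = Word (letters u @ letters v)"
instance by standard (simp_all add: zero_word_def plus_word_def)
end

type_synonym 'a free_alg = "word \<Rightarrow>\<^sub>0 'a"

definition fa_scale :: "'a::field \<Rightarrow> 'a free_alg \<Rightarrow> 'a free_alg" where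
  "fa_scale c f = Poly_Mapping.single 0 c * f"

definition var :: "nat \<Rightarrow> 'a::field free_alg" where
  "var i = Poly_Mapping.single (Word [i]) 1"

definition commutator :: "'a::ring \<Rightarrow> 'a \<Rightarrow> 'a" where
  "commutator u v = u * v - v * u"

fun left_normed :: "'a::ring list \<Rightarrow> 'a" where
  "left_normed [] = 0"
| "left_normed (u # us) = foldl commutator u us"


section \<open>The Grassmann algebra\<close>

text \<open>
  \<open>gcoeff x A\<close> is the coefficient in \<open>x\<close> of the basis monomial
  $e_A = e_{i_1} \cdots e_{i_m}$, where $A = \{i_1 < \cdots < i_m\}$.
\<close>

typedef (overloaded) 'a grassmann =
  "{f :: nat set \<Rightarrow> 'a::zero. finite {A. f A \<noteq> 0} \<and> (\<forall>A. f A \<noteq> 0 \<longrightarrow> finite A)}"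
  morphisms gcoeff Abs_grassmann
  by (rule exI[of _ "\<lambda>_. 0"]) simp

setup_lifting type_definition_grassmann

lemma gcoeff_eqI: "(\<And>A. gcoeff x A = gcoeff y A) \<Longrightarrow> x = y"
  by (metis ext gcoeff_inject)

text \<open>For disjoint \<open>A\<close> and \<open>B\<close> one has $e_A e_B = \pm e_{A \cup B}$ with the sign
  \<open>gsign A B\<close> of the permutation sorting the concatenated index sequence.\<close>

definition inversions :: "nat set \<Rightarrow> nat set \<Rightarrow> (nat \<times> nat) set" where
  "inversions A B = {(a, b). a \<in> A \<and> b \<in> B \<and> b < a}"

definition gsign :: "nat set \<Rightarrow> nat set \<Rightarrow> 'a::comm_ring_1" where
  "gsign A B = (- 1) ^ card (inversions A B)"

lemma finite_inversions: "finite A \<Longrightarrow> finite B \<Longrightarrow> finite (inversions A B)"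
  by (rule finite_subset[of _ "A \<times> B"]) (auto simp: inversions_def)

lemma gsign_Un_left:
  assumes "finite A" "finite B" "finite C" "A \<inter> B = {}"
  shows "gsign (A \<union> B) C = gsign A C * gsign B C"
proof -
  have "inversions (A \<union> B) C = inversions A C \<union> inversions B C"
    "inversions A C \<inter> inversions B C = {}"
    using assms by (auto simp: inversions_def)
  then show ?thesis
    using assms by (simp add: gsign_def card_Un_disjoint finite_inversions power_add)
qed

lemma gsign_Un_right:
  assumes "finite A" "finite B" "finite C" "B \<inter> C = {}"
  shows "gsign A (B \<union> C) = gsign A B * gsign A C"
proof -
  have "inversions A (B \<union> C) = inversions A B \<union> inversions A C"
    "inversions A B \<inter> inversions A C = {}"
    using assms by (auto simp: inversions_def)
  then show ?thesis
    using assms by (simp add: gsign_def card_Un_disjoint finite_inversions power_add)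
qed

lemma gsign_empty [simp]: "gsign {} A = 1" "gsign A {} = 1"
  by (simp_all add: gsign_def inversions_def)

instantiation grassmann :: (comm_ring_1) ring_1
begin

lift_definition zero_grassmann :: "'a grassmann" is "\<lambda>_. 0" by simp

lift_definition one_grassmann :: "'a grassmann" is "\<lambda>A. if A = {} then 1 else 0"
  by simp

lift_definition plus_grassmann :: "'a grassmann \<Rightarrow> 'a grassmann \<Rightarrow> 'a grassmann"
  is "\<lambda>f g A. f A + g A"
proof safe
  fix f g :: "nat set \<Rightarrow> 'a"
  assume "finite {A. f A \<noteq> 0}" "finite {A. g A \<noteq> 0}"
  then show "finite {A. f A + g A \<noteq> 0}"
    by (intro finite_subset[of "{A. f A + g A \<noteq> 0}" "{A. f A \<noteq> 0} \<union> {A. g A \<noteq> 0}"])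
      (auto simp del: right_minus_eq)
next
  fix f g :: "nat set \<Rightarrow> 'a" and A
  assume "\<forall>A. f A \<noteq> 0 \<longrightarrow> finite A" "\<forall>A. g A \<noteq> 0 \<longrightarrow> finite A" "f A + g A \<noteq> 0"
  then show "finite A" by (cases "f A = 0") auto
qed

lift_definition uminus_grassmann :: "'a grassmann \<Rightarrow> 'a grassmann"
  is "\<lambda>f A. - f A" by simp

lift_definition minus_grassmann :: "'a grassmann \<Rightarrow> 'a grassmann \<Rightarrow> 'a grassmann"
  is "\<lambda>f g A. f A - g A"
proof safe
  fix f g :: "nat set \<Rightarrow> 'a"
  assume "finite {A. f A \<noteq> 0}" "finite {A. g A \<noteq> 0}"
  then show "finite {A. f A - g A \<noteq> 0}"
    by (intro finite_subset[of "{A. f A - g A \<noteq> 0}" "{A. f A \<noteq> 0} \<union> {A. g A \<noteq> 0}"])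
      (auto simp del: right_minus_eq)
next
  fix f g :: "nat set \<Rightarrow> 'a" and A
  assume "\<forall>A. f A \<noteq> 0 \<longrightarrow> finite A" "\<forall>A. g A \<noteq> 0 \<longrightarrow> finite A" "f A - g A \<noteq> 0"
  then show "finite A" by (cases "f A = 0") auto
qed

lift_definition times_grassmann :: "'a grassmann \<Rightarrow> 'a grassmann \<Rightarrow> 'a grassmann"
  is "\<lambda>f g C. \<Sum>A\<in>Pow C. gsign A (C - A) * f A * g (C - A)"
proof safe
  fix f g :: "nat set \<Rightarrow> 'a"
  assume fin: "finite {A. f A \<noteq> 0}" "finite {A. g A \<noteq> 0}"
  have "{C. (\<Sum>A\<in>Pow C. gsign A (C - A) * f A * g (C - A)) \<noteq> 0} \<subseteq>
        (\<lambda>(A, B). A \<union> B) ` ({A. f A \<noteq> 0} \<times> {A. g A \<noteq> 0})"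
  proof
    fix C assume "C \<in> {C. (\<Sum>A\<in>Pow C. gsign A (C - A) * f A * g (C - A)) \<noteq> 0}"
    then have "(\<Sum>A\<in>Pow C. gsign A (C - A) * f A * g (C - A)) \<noteq> 0" by simp
    then obtain A where "A \<in> Pow C" "gsign A (C - A) * f A * g (C - A) \<noteq> 0"
      by (rule sum.not_neutral_contains_not_neutral)
    then have "A \<subseteq> C" "f A \<noteq> 0" "g (C - A) \<noteq> 0" by auto
    then show "C \<in> (\<lambda>(A, B). A \<union> B) ` ({A. f A \<noteq> 0} \<times> {A. g A \<noteq> 0})"
      by (intro image_eqI[of _ _ "(A, C - A)"]) auto
  qed
  then show "finite {C. (\<Sum>A\<in>Pow C. gsign A (C - A) * f A * g (C - A)) \<noteq> 0}"
    by (rule finite_subset) (intro finite_imageI finite_cartesian_product fin)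
next
  fix f g :: "nat set \<Rightarrow> 'a" and C
  assume "(\<Sum>A\<in>Pow C. gsign A (C - A) * f A * g (C - A)) \<noteq> 0"
  then have "finite (Pow C)"
    by (meson sum.infinite)
  then show "finite C" by simp
qed

instance
proof
  fix x y z :: "'a grassmann"
  show "x * y * z = x * (y * z)"
  proof (rule gcoeff_eqI)
    fix C
    let ?f = "gcoeff x" and ?g = "gcoeff y" and ?h = "gcoeff z"
    show "gcoeff (x * y * z) C = gcoeff (x * (y * z)) C"
    proof (cases "finite C")
      case fin: True
      have "gcoeff (x * y * z) C =
        (\<Sum>D\<in>Pow C. \<Sum>A\<in>Pow D. gsign D (C - D) * (gsign A (D - A) * ?f A * ?g (D - A)) * ?h (C - D))"
        by (simp add: times_grassmann.rep_eq sum_distrib_left sum_distrib_right)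
      also have "\<dots> = (\<Sum>(D, A)\<in>Sigma (Pow C) Pow.
          gsign D (C - D) * (gsign A (D - A) * ?f A * ?g (D - A)) * ?h (C - D))"
        using fin by (intro sum.Sigma) (simp_all add: rev_finite_subset)
      also have "\<dots> = (\<Sum>(A, B)\<in>(SIGMA A:Pow C. Pow (C - A)).
          gsign A (C - A) * ?f A * (gsign B (C - A - B) * ?g B * ?h (C - A - B)))"
      proof (rule sum.reindex_bij_witness
          [of _ "\<lambda>(A, B). (A \<union> B, A)" "\<lambda>(D, A). (A, D - A)"], goal_cases)
        case (5 p)
        then obtain D A where p: "p = (D, A)" and sub: "A \<subseteq> D" "D \<subseteq> C" by auto
        have f: "finite A" "finite (D - A)" "finite (C - D)"
          using fin sub by (meson finite_subset finite_Diff order_trans)+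
        have "gsign D (C - D) = (gsign A (C - D) * gsign (D - A) (C - D) :: 'a)"
          using gsign_Un_left[of A "D - A" "C - D"] f sub by (simp add: Un_absorb1)
        moreover have "gsign A (C - A) = (gsign A (D - A) * gsign A (C - D) :: 'a)"
        proof -
          have "C - A = (D - A) \<union> (C - D)" using sub by auto
          then show ?thesis using gsign_Un_right[of A "D - A" "C - D"] f by auto
        qed
        moreover have "C - A - (D - A) = C - D" using sub by auto
        ultimately show ?case by (simp add: p mult_ac)
      qed auto
      also have "\<dots> = (\<Sum>A\<in>Pow C. \<Sum>B\<in>Pow (C - A).
          gsign A (C - A) * ?f A * (gsign B (C - A - B) * ?g B * ?h (C - A - B)))"
        using fin by (intro sum.Sigma[symmetric]) auto
      also have "\<dots> = gcoeff (x * (y * z)) C"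
        by (simp add: times_grassmann.rep_eq sum_distrib_left)
      finally show ?thesis .
    next
      case False
      then have "infinite (Pow C)" by simp
      then show ?thesis by (simp add: times_grassmann.rep_eq)
    qed
  qed
  show "1 * x = x"
  proof (rule gcoeff_eqI)
    fix C
    show "gcoeff (1 * x) C = gcoeff x C"
    proof (cases "finite C")
      case True
      have "gcoeff (1 * x) C = (\<Sum>A\<in>{{}}. gsign A (C - A) * gcoeff 1 A * gcoeff x (C - A))"
        unfolding times_grassmann.rep_eq using True
        by (intro sum.mono_neutral_right) (auto simp: one_grassmann.rep_eq)
      then show ?thesis by (simp add: one_grassmann.rep_eq)
    next
      case False
      then have "infinite (Pow C)" by simp
      then show ?thesis using gcoeff[of x] False by (auto simp: times_grassmann.rep_eq)
    qed
  qed
  show "x * 1 = x"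
  proof (rule gcoeff_eqI)
    fix C
    show "gcoeff (x * 1) C = gcoeff x C"
    proof (cases "finite C")
      case True
      have "gcoeff (x * 1) C = (\<Sum>A\<in>{C}. gsign A (C - A) * gcoeff x A * gcoeff 1 (C - A))"
        unfolding times_grassmann.rep_eq using True
        by (intro sum.mono_neutral_right) (auto simp: one_grassmann.rep_eq)
      then show ?thesis by (simp add: one_grassmann.rep_eq)
    next
      case False
      then have "infinite (Pow C)" by simp
      then show ?thesis using gcoeff[of x] False by (auto simp: times_grassmann.rep_eq)
    qed
  qed
  show "(x + y) * z = x * z + y * z" "x * (y + z) = x * y + x * z"
    by (rule gcoeff_eqI, simp add: times_grassmann.rep_eq plus_grassmann.rep_eq
        algebra_simps sum.distrib)+
  show "(0 :: 'a grassmann) \<noteq> 1"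
  proof
    assume "(0 :: 'a grassmann) = 1"
    then have "gcoeff (0 :: 'a grassmann) {} = gcoeff 1 {}" by simp
    then show False by (simp add: zero_grassmann.rep_eq one_grassmann.rep_eq)
  qed
qed (rule gcoeff_eqI, simp add: zero_grassmann.rep_eq plus_grassmann.rep_eq
      uminus_grassmann.rep_eq minus_grassmann.rep_eq algebra_simps)+

end

lift_definition gen :: "nat \<Rightarrow> 'a::comm_ring_1 grassmann"
  is "\<lambda>i A. if A = {i} then 1 else 0"
  by simp

lift_definition gconst :: "'a::comm_ring_1 \<Rightarrow> 'a grassmann"
  is "\<lambda>c A. if A = {} then c else 0"
  by simp

lemma gen_square: "gen i * gen i = (0 :: 'a::comm_ring_1 grassmann)"
  by (rule gcoeff_eqI)
    (auto simp: times_grassmann.rep_eq gen.rep_eq zero_grassmann.rep_eq intro!: sum.neutral)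

lemma gcoeff_gen_mult:
  assumes "i \<noteq> j"
  shows "gcoeff (gen i * gen j :: 'a::comm_ring_1 grassmann) C =
    (if C = {i, j} then gsign {i} {j} else 0)"
proof (cases "C = {i, j}")
  case True
  have "C - {i} = {j}" using True assms by auto
  moreover have "gcoeff (gen i * gen j :: 'a grassmann) C =
    (\<Sum>A\<in>{{i}}. gsign A (C - A) * gcoeff (gen i) A * gcoeff (gen j) (C - A))"
    unfolding times_grassmann.rep_eq using True
    by (intro sum.mono_neutral_right) (auto simp: gen.rep_eq)
  ultimately show ?thesis using True by (simp add: gen.rep_eq)
next
  case False
  have "gsign A (C - A) * gcoeff (gen i) A * gcoeff (gen j) (C - A) = (0 :: 'a)"
    if "A \<in> Pow C" for A
  proof (rule ccontr)
    assume "gsign A (C - A) * gcoeff (gen i) A * gcoeff (gen j) (C - A) \<noteq> (0 :: 'a)"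
    then have "A = {i}" "C - A = {j}"
      by (auto simp: gen.rep_eq split: if_splits)
    with that False show False by auto
  qed
  then show ?thesis
    using False by (simp add: times_grassmann.rep_eq)
qed

lemma gen_anticommute: "gen i * gen j = - (gen j * gen i :: 'a::comm_ring_1 grassmann)"
proof (cases "i = j")
  case True
  then show ?thesis by (simp add: gen_square)
next
  case False
  have *: "inversions {a} {b} = (if b < a then {(a, b)} else {})" for a b
    by (auto simp: inversions_def)
  show ?thesis
    by (rule gcoeff_eqI)
      (use False in \<open>auto simp: gcoeff_gen_mult uminus_grassmann.rep_eq insert_commute gsign_def *\<close>)
qed

definition even_part :: "'a::comm_ring_1 grassmann set" where
  "even_part = {x. \<forall>A. gcoeff x A \<noteq> 0 \<longrightarrow> even (card A)}"

definition odd_part :: "'a::comm_ring_1 grassmann set" where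
  "odd_part = {x. \<forall>A. gcoeff x A \<noteq> 0 \<longrightarrow> odd (card A)}"


section \<open>Weak identities of \<open>M\<^bsub>1,1\<^esub>(E)\<close>\<close>

definition M11 :: "('a::comm_ring_1 grassmann ^ 2 ^ 2) set" where
  "M11 = {M. M $ 1 $ 1 \<in> even_part \<and> M $ 2 $ 2 \<in> even_part \<and>
             M $ 1 $ 2 \<in> odd_part \<and> M $ 2 $ 1 \<in> odd_part}"

definition supertrace :: "'a::comm_ring_1 grassmann ^ 2 ^ 2 \<Rightarrow> 'a grassmann" where
  "supertrace M = M $ 1 $ 1 - M $ 2 $ 2"

definition W_space :: "('a::comm_ring_1 grassmann ^ 2 ^ 2) set" where
  "W_space = {M \<in> M11. supertrace M = 0}"

text \<open>The matrix product is \<open>**\<close>; the class multiplication of this type is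
  componentwise.\<close>

definition word_eval ::
    "(nat \<Rightarrow> 'a::field grassmann ^ 2 ^ 2) \<Rightarrow> word \<Rightarrow> 'a grassmann ^ 2 ^ 2" where
  "word_eval w u = foldr (\<lambda>i M. w i ** M) (letters u) (mat 1)"

definition fa_eval ::
    "(nat \<Rightarrow> 'a::field grassmann ^ 2 ^ 2) \<Rightarrow> 'a free_alg \<Rightarrow> 'a grassmann ^ 2 ^ 2" where
  "fa_eval w f = (\<Sum>u\<in>Poly_Mapping.keys f.
     mat (gconst (Poly_Mapping.lookup f u)) ** word_eval w u)"

definition I_w :: "'a::field free_alg set" where
  "I_w = {f. \<forall>w. (\<forall>i. w i \<in> W_space) \<longrightarrow> fa_eval w f = 0}"


section \<open>Proper polynomials\<close>

definition is_subalgebra :: "'a::field free_alg set \<Rightarrow> bool" where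
  "is_subalgebra A \<longleftrightarrow> 1 \<in> A \<and> (\<forall>f\<in>A. \<forall>g\<in>A. f + g \<in> A \<and> f * g \<in> A) \<and>
     (\<forall>c. \<forall>f\<in>A. fa_scale c f \<in> A)"

definition proper_polys :: "'a::field free_alg set" where
  "proper_polys = is_subalgebra hull {left_normed (map var is) | is. length is \<ge> 2}"

text \<open>A vector $(n_1, \ldots, n_k)$ is a list \<open>ns\<close>, so that \<open>ns ! i\<close> is $n_{i+1}$, the
  degree in the variable \<open>var i\<close>.\<close>

definition multihomogeneous :: "nat list \<Rightarrow> 'a::field free_alg \<Rightarrow> bool" where
  "multihomogeneous ns f \<longleftrightarrow> (\<forall>u\<in>Poly_Mapping.keys f. \<forall>i.
     count_list (letters u) i = (if i < length ns then ns ! i else 0))"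

definition proper_comp :: "nat list \<Rightarrow> 'a::field free_alg set" where
  "proper_comp ns = {f \<in> proper_polys. multihomogeneous ns f}"

text \<open>The field \<open>'a\<close>, and quotients of spaces of polynomials, as records of
  \<open>HOL-Algebra\<close>; a module record also carries a ring multiplication and
  unit, which modules do not use.\<close>

definition field_ring :: "'a::field ring" where
  "field_ring = \<lparr>carrier = UNIV, mult = (*), one = 1, zero = 0, add = (+)\<rparr>"

definition fa_coset :: "'a::field free_alg set \<Rightarrow> 'a free_alg \<Rightarrow> 'a free_alg set" where
  "fa_coset U f = {f + u | u. u \<in> U}"

definition fa_quotient ::
    "'a::field free_alg set \<Rightarrow> 'a free_alg set \<Rightarrow> ('a, 'a free_alg set) module" where
  "fa_quotient V U = \<lparr>carrier = fa_coset U ` V, mult = undefined, one = undefined, zero = U,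
     add = (\<lambda>X Y. {x + y | x y. x \<in> X \<and> y \<in> Y}),
     smult = (\<lambda>c X. {fa_scale c x + u | x u. x \<in> X \<and> u \<in> U})\<rparr>"

definition proper_quotient :: "nat list \<Rightarrow> ('a::field, 'a free_alg set) module" where
  "proper_quotient ns = fa_quotient (proper_comp ns) (proper_comp ns \<inter> I_w)"


section \<open>Normal c-arrays\<close>

text \<open>A two-rowed array is the list of its columns $(a_i, b_i)$.\<close>

type_synonym array = "(nat \<times> nat) list"

definition array_poly :: "array \<Rightarrow> 'a::field free_alg" where
  "array_poly S = prod_list (map (\<lambda>(a, b). commutator (var a) (var b)) S)"

definition has_content :: "array \<Rightarrow> nat list \<Rightarrow> bool" where
  "has_content S ns \<longleftrightarrow>
     (\<forall>i<length ns. count (mset (map fst S) + mset (map snd S)) i = ns ! i) \<and>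
     sum_list ns = 2 * length S"

definition lex_le :: "nat \<times> nat \<Rightarrow> nat \<times> nat \<Rightarrow> bool" where
  "lex_le p p' \<longleftrightarrow> fst p < fst p' \<or> fst p = fst p' \<and> snd p \<le> snd p'"

definition c_array :: "array \<Rightarrow> bool" where
  "c_array S \<longleftrightarrow> (\<forall>(a, b)\<in>set S. a > b) \<and>
     (\<forall>i. Suc i < length S \<longrightarrow> lex_le (S ! i) (S ! Suc i))"

definition normal_c_arrays :: "nat list \<Rightarrow> array set" where
  "normal_c_arrays ns = {S. c_array S \<and> has_content S ns \<and> (\<forall>i<length ns. ns ! i \<le> 2) \<and>
     \<not> (\<exists>r s t. r < s \<and> s < t \<and> t < length S \<and>
           snd (S ! r) \<le> snd (S ! s) \<and> snd (S ! s) \<le> snd (S ! t))}"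



section \<open>The quotients are vector spaces\<close>

definition fa_subspace :: "'a::field free_alg set \<Rightarrow> bool" where
  "fa_subspace U \<longleftrightarrow> 0 \<in> U \<and> (\<forall>f\<in>U. \<forall>g\<in>U. f + g \<in> U) \<and> (\<forall>c. \<forall>f\<in>U. fa_scale c f \<in> U)"

lemma fa_scale_simps:
  "fa_scale c (f + g) = fa_scale c f + fa_scale c g"
  "fa_scale (c + d) f = fa_scale c f + fa_scale d f"
  "fa_scale (c * d) f = fa_scale c (fa_scale d f)"
  "fa_scale 1 f = f" "fa_scale 0 f = 0" "fa_scale c 0 = 0"
  "fa_scale (- 1) f = - f"
proof -
  show one: "fa_scale 1 f = f"
    by (simp add: fa_scale_def)
  show add: "fa_scale (c + d) f = fa_scale c f + fa_scale d f"
    and zero: "fa_scale 0 f = 0" for c d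
    by (simp_all add: fa_scale_def distrib_right single_add)
  then show "fa_scale (- 1) f = - f"
    using add[of "-1" 1] one by (simp add: eq_neg_iff_add_eq_0)
qed (simp_all add: fa_scale_def distrib_left mult_single mult.assoc[symmetric])

lemma fa_coset_iff: "x \<in> fa_coset U f \<longleftrightarrow> x - f \<in> U"
proof
  assume "x - f \<in> U"
  moreover have "x = f + (x - f)" by simp
  ultimately show "x \<in> fa_coset U f" unfolding fa_coset_def by blast
next
  assume "x \<in> fa_coset U f"
  then obtain u where "x = f + u" "u \<in> U" unfolding fa_coset_def by blast
  then show "x - f \<in> U" by simp
qed

lemma fa_subspace_minus:
  assumes "fa_subspace U" "u \<in> U" "v \<in> U"
  shows "u - v \<in> U"
  using assms by (metis diff_conv_add_uminus fa_scale_simps(7) fa_subspace_def)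

lemma fa_quotient_ops:
  assumes "fa_subspace U"
  shows "add (fa_quotient V U) (fa_coset U f) (fa_coset U g) = fa_coset U (f + g)"
    and "smult (fa_quotient V U) c (fa_coset U f) = fa_coset U (fa_scale c f)"
    and "zero (fa_quotient V U) = fa_coset U 0"
proof -
  have 0: "0 \<in> U" and add: "\<And>u v. u \<in> U \<Longrightarrow> v \<in> U \<Longrightarrow> u + v \<in> U"
    and sc: "\<And>c u. u \<in> U \<Longrightarrow> fa_scale c u \<in> U"
    using assms by (simp_all add: fa_subspace_def)
  have "add (fa_quotient V U) (fa_coset U f) (fa_coset U g) =
      {x + y | x y. x - f \<in> U \<and> y - g \<in> U}" (is "_ = ?L")
    by (simp add: fa_quotient_def fa_coset_iff)
  also have "?L = fa_coset U (f + g)"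
  proof (intro equalityI subsetI)
    fix z assume "z \<in> ?L"
    then obtain x y where "z = x + y" "x - f \<in> U" "y - g \<in> U" by blast
    with add[of "x - f" "y - g"] show "z \<in> fa_coset U (f + g)"
      by (simp add: fa_coset_iff algebra_simps)
  next
    fix z assume "z \<in> fa_coset U (f + g)"
    then have "z = (z - g) + g" "(z - g) - f \<in> U" "g - g \<in> U"
      using 0 by (simp_all add: fa_coset_iff algebra_simps)
    then show "z \<in> ?L" by blast
  qed
  finally show "add (fa_quotient V U) (fa_coset U f) (fa_coset U g) = fa_coset U (f + g)" .
  have "smult (fa_quotient V U) c (fa_coset U f) =
      {fa_scale c x + u | x u. x - f \<in> U \<and> u \<in> U}" (is "_ = ?M")
    by (simp add: fa_quotient_def fa_coset_iff)
  also have "?M = fa_coset U (fa_scale c f)"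
  proof (intro equalityI subsetI)
    fix z assume "z \<in> ?M"
    then obtain x u where z: "z = fa_scale c x + u" and "x - f \<in> U" "u \<in> U" by blast
    then have "fa_scale c (x - f) + u \<in> U" using add sc by simp
    moreover have "fa_scale c (x - f) = fa_scale c x - fa_scale c f"
      by (simp add: fa_scale_def right_diff_distrib)
    ultimately show "z \<in> fa_coset U (fa_scale c f)"
      by (simp add: fa_coset_iff z algebra_simps)
  next
    fix z assume "z \<in> fa_coset U (fa_scale c f)"
    then have "z = fa_scale c f + (z - fa_scale c f)" "f - f \<in> U" "z - fa_scale c f \<in> U"
      using 0 by (simp_all add: fa_coset_iff)
    then show "z \<in> ?M" by blast
  qed
  finally show "smult (fa_quotient V U) c (fa_coset U f) = fa_coset U (fa_scale c f)" .
  show "zero (fa_quotient V U) = fa_coset U 0"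
    by (auto simp: fa_quotient_def fa_coset_iff)
qed

lemma field_field_ring: "field (field_ring :: 'a::field ring)"
proof -
  let ?K = "field_ring :: 'a ring"
  have ab: "abelian_group ?K"
  proof (rule abelian_groupI)
    fix x :: 'a
    show "\<exists>y\<in>carrier ?K. y \<oplus>\<^bsub>?K\<^esub> x = \<zero>\<^bsub>?K\<^esub>"
      by (rule bexI[of _ "- x"]) (simp_all add: field_ring_def)
  qed (simp_all add: field_ring_def add.assoc add.commute)
  have mon: "comm_monoid ?K"
    by (rule comm_monoidI) (simp_all add: field_ring_def mult.assoc mult.commute)
  have cr: "cring ?K"
    by (rule cringI[OF ab mon]) (simp add: field_ring_def distrib_right)
  show ?thesis
  proof (rule cring.cring_fieldI2[OF cr])
    show "\<zero>\<^bsub>?K\<^esub> \<noteq> \<one>\<^bsub>?K\<^esub>"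
      by (simp add: field_ring_def)
    fix a :: 'a
    assume "a \<in> carrier ?K" "a \<noteq> \<zero>\<^bsub>?K\<^esub>"
    then show "\<exists>b\<in>carrier ?K. a \<otimes>\<^bsub>?K\<^esub> b = \<one>\<^bsub>?K\<^esub>"
      by (intro bexI[of _ "inverse a"]) (simp_all add: field_ring_def)
  qed
qed

lemma vectorspace_fa_quotient:
  assumes U: "fa_subspace U" and V: "fa_subspace V"
  shows "vectorspace field_ring (fa_quotient V U)"
proof -
  let ?Q = "fa_quotient V U"
  interpret F: field "field_ring :: 'a ring" by (rule field_field_ring)
  note ops = fa_quotient_ops[OF U, of V]
  have V': "0 \<in> V" "\<And>f g. f \<in> V \<Longrightarrow> g \<in> V \<Longrightarrow> f + g \<in> V"
    "\<And>c f. f \<in> V \<Longrightarrow> fa_scale c f \<in> V"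
    using V by (simp_all add: fa_subspace_def)
  have carrI: "fa_coset U f \<in> carrier ?Q" if "f \<in> V" for f
    using that by (simp add: fa_quotient_def)
  have carrE: "\<exists>f\<in>V. X = fa_coset U f" if "X \<in> carrier ?Q" for X
    using that by (auto simp: fa_quotient_def)
  have "module field_ring ?Q"
  proof (rule moduleI)
    show "cring (field_ring :: 'a ring)" by (rule F.is_cring)
    show "abelian_group ?Q"
    proof (rule abelian_groupI)
      fix X assume "X \<in> carrier ?Q"
      then obtain f where f: "X = fa_coset U f" "f \<in> V" using carrE by blast
      show "\<exists>Y\<in>carrier ?Q. Y \<oplus>\<^bsub>?Q\<^esub> X = \<zero>\<^bsub>?Q\<^esub>"
        by (rule bexI[OF _ carrI[OF V'(3)[OF f(2), of "-1"]]]) (simp add: f ops fa_scale_simps)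
      show "\<zero>\<^bsub>?Q\<^esub> \<oplus>\<^bsub>?Q\<^esub> X = X" by (simp add: f ops)
      fix Y assume "Y \<in> carrier ?Q"
      then obtain g where g: "Y = fa_coset U g" "g \<in> V" using carrE by blast
      show "X \<oplus>\<^bsub>?Q\<^esub> Y \<in> carrier ?Q" using f g by (simp add: ops carrI V')
      show "X \<oplus>\<^bsub>?Q\<^esub> Y = Y \<oplus>\<^bsub>?Q\<^esub> X" by (simp add: f g ops add.commute)
      fix Z assume "Z \<in> carrier ?Q"
      then obtain h where h: "Z = fa_coset U h" using carrE by blast
      show "X \<oplus>\<^bsub>?Q\<^esub> Y \<oplus>\<^bsub>?Q\<^esub> Z = X \<oplus>\<^bsub>?Q\<^esub> (Y \<oplus>\<^bsub>?Q\<^esub> Z)"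
        by (simp add: f g h ops add.assoc)
    next
      show "\<zero>\<^bsub>?Q\<^esub> \<in> carrier ?Q" by (simp add: ops carrI V')
    qed
  next
    fix a X assume "X \<in> carrier ?Q"
    then obtain f where f: "X = fa_coset U f" "f \<in> V" using carrE by blast
    show "a \<odot>\<^bsub>?Q\<^esub> X \<in> carrier ?Q" using f by (simp add: ops carrI V')
    show "\<one>\<^bsub>field_ring\<^esub> \<odot>\<^bsub>?Q\<^esub> X = X" by (simp add: f ops fa_scale_simps field_ring_def)
    fix b
    show "(a \<oplus>\<^bsub>field_ring\<^esub> b) \<odot>\<^bsub>?Q\<^esub> X = a \<odot>\<^bsub>?Q\<^esub> X \<oplus>\<^bsub>?Q\<^esub> b \<odot>\<^bsub>?Q\<^esub> X"
      by (simp add: f ops fa_scale_simps field_ring_def)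
    show "(a \<otimes>\<^bsub>field_ring\<^esub> b) \<odot>\<^bsub>?Q\<^esub> X = a \<odot>\<^bsub>?Q\<^esub> (b \<odot>\<^bsub>?Q\<^esub> X)"
      by (simp add: f ops fa_scale_simps field_ring_def)
    fix Y assume "Y \<in> carrier ?Q"
    then obtain g where g: "Y = fa_coset U g" using carrE by blast
    show "a \<odot>\<^bsub>?Q\<^esub> (X \<oplus>\<^bsub>?Q\<^esub> Y) = a \<odot>\<^bsub>?Q\<^esub> X \<oplus>\<^bsub>?Q\<^esub> a \<odot>\<^bsub>?Q\<^esub> Y"
      by (simp add: f g ops fa_scale_simps)
  qed
  then show ?thesis
    by (simp add: vectorspace_def F.field_axioms)
qed

lemma gconst_add: "gconst (a + b) = gconst a + gconst b"
  by (rule gcoeff_eqI) (simp add: gconst.rep_eq plus_grassmann.rep_eq)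

lemma gconst_0: "gconst 0 = 0"
  by (rule gcoeff_eqI) (simp add: gconst.rep_eq zero_grassmann.rep_eq)

lemma gconst_mult: "gconst (a * b) = gconst a * gconst b"
proof (rule gcoeff_eqI)
  fix C
  have "gsign A (C - A) * gcoeff (gconst a) A * gcoeff (gconst b) (C - A) =
      (if A = {} then (if C = {} then a * b else 0) else 0)" for A
    by (cases "A = {}") (simp_all add: gconst.rep_eq)
  then show "gcoeff (gconst (a * b)) C = gcoeff (gconst a * gconst b) C"
    by (cases "C = {}") (simp_all add: times_grassmann.rep_eq gconst.rep_eq[of "a * b"])
qed

lemma mat_add: "mat (a + b) = mat a + (mat b :: 'a::semiring_1 ^ 'n ^ 'n)"
  by (simp add: mat_def vec_eq_iff)

lemma mat_0: "mat 0 = (0 :: 'a::semiring_1 ^ 'n ^ 'n)"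
  by (simp add: mat_def vec_eq_iff)

lemma mat_rdistrib: "(A + B) ** (C :: 'a::semiring_1 ^ 'n ^ 'm) = A ** C + B ** C"
  by (simp add: vec_eq_iff matrix_matrix_mult_def distrib_right sum.distrib)

lemma mat_sum_right: "A ** (\<Sum>i\<in>I. f i) = (\<Sum>i\<in>I. A ** (f i :: 'a::semiring_1 ^ 'n ^ 'm))"
proof -
  have "A ** (0 :: 'a ^ 'n ^ 'm) = 0" and "A ** (B + C) = A ** B + A ** C" for B C :: "'a ^ 'n ^ 'm"
    by (simp_all add: vec_eq_iff matrix_matrix_mult_def distrib_left sum.distrib)
  then show ?thesis by (induction I rule: infinite_finite_induct) simp_all
qed

lemma mat_mult: "mat (a * b) = mat a ** (mat b :: 'a::semiring_1 ^ 'n ^ 'n)"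
proof -
  have "(if i = k then a else 0) * (if k = j then b else 0) =
      (if i = k then (if i = j then a * b else 0) else 0)" for i j k :: 'n
    by simp
  then show ?thesis by (simp add: mat_def vec_eq_iff matrix_matrix_mult_def)
qed

lemma fa_eval_superset:
  assumes "finite K" "Poly_Mapping.keys f \<subseteq> K"
  shows "fa_eval w f = (\<Sum>u\<in>K. mat (gconst (Poly_Mapping.lookup f u)) ** word_eval w u)"
  unfolding fa_eval_def using assms
  by (intro sum.mono_neutral_left) (auto simp: in_keys_iff gconst_0 mat_0)

lemma fa_eval_add: "fa_eval w (f + g) = fa_eval w f + fa_eval w g"
proof -
  let ?K = "Poly_Mapping.keys f \<union> Poly_Mapping.keys g"
  have K: "finite ?K" by simp
  show ?thesis
    unfolding fa_eval_superset[OF K Poly_Mapping.keys_add] fa_eval_superset[OF K Un_upper1]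
      fa_eval_superset[OF K Un_upper2]
    by (simp add: lookup_add gconst_add mat_add mat_rdistrib sum.distrib)
qed

lemma lookup_fa_scale: "Poly_Mapping.lookup (fa_scale c f) u = c * Poly_Mapping.lookup f u"
proof -
  have "fa_scale c f = Poly_Mapping.map ((*) c) f"
    unfolding fa_scale_def by (metis mult_map_scale_conv_mult)
  then show ?thesis by (simp add: Poly_Mapping.map.rep_eq when_def)
qed

lemma keys_fa_scale: "Poly_Mapping.keys (fa_scale c f) \<subseteq> Poly_Mapping.keys f"
  by (auto simp: in_keys_iff lookup_fa_scale)

lemma fa_eval_scale: "fa_eval w (fa_scale c f) = mat (gconst c) ** fa_eval w f"
  by (simp add: fa_eval_superset[OF finite_keys keys_fa_scale] lookup_fa_scale gconst_mult mat_mult)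
   (simp add: fa_eval_def mat_sum_right matrix_mul_assoc[symmetric])

lemma fa_subspace_I_w: "fa_subspace I_w"
  by (simp add: fa_subspace_def I_w_def fa_eval_add fa_eval_scale)
    (simp add: fa_eval_def matrix_matrix_mult_def vec_eq_iff)

lemma fa_subspace_proper_comp: "fa_subspace (proper_comp ns)"
proof -
  have "is_subalgebra (proper_polys :: 'a free_alg set)"
    unfolding proper_polys_def by (rule hull_in) (simp add: is_subalgebra_def)
  then have sub: "f + g \<in> proper_polys" "fa_scale c f \<in> proper_polys" if "f \<in> proper_polys" "g \<in> proper_polys"
    for c and f g :: "'a free_alg"
    using that by (simp_all add: is_subalgebra_def)
  have one: "(1 :: 'a free_alg) \<in> proper_polys"
    using \<open>is_subalgebra proper_polys\<close> by (simp add: is_subalgebra_def)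
  have zero: "(0 :: 'a free_alg) \<in> proper_polys"
    using sub(2)[OF one one, of 0] by (simp add: fa_scale_simps)
  have "multihomogeneous ns (f + g)" "multihomogeneous ns (fa_scale c f)"
    if "multihomogeneous ns f" "multihomogeneous ns g" for c and f g :: "'a free_alg"
    using that Poly_Mapping.keys_add[of f g] keys_fa_scale[of c f]
    by (auto simp: multihomogeneous_def)
  moreover have "multihomogeneous ns (0 :: 'a free_alg)"
    by (simp add: multihomogeneous_def)
  ultimately show ?thesis
    using sub zero by (simp add: fa_subspace_def proper_comp_def)
qed

lemma vectorspace_proper_quotient: "vectorspace field_ring (proper_quotient ns)"
  unfolding proper_quotient_def
  using fa_subspace_I_w fa_subspace_proper_comp[of ns]
  by (intro vectorspace_fa_quotient) (auto simp: fa_subspace_def)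

end

theory Submission
  imports Defs "HOL-Library.Function_Algebras" "HOL-Library.Product_Lexorder"
begin

text \<open>
  A matrix of \<open>W\<close> is a central even scalar plus an off-diagonal part with two odd
  entries \<open>b\<close> and \<open>c\<close>. The commutator of two such matrices is the
  scalar matrix with entry \<open>b\<^sub>i c\<^sub>j + c\<^sub>i b\<^sub>j\<close>, the
  \<^emph>\<open>pairing\<close> of the odd vectors \<open>(b\<^sub>i, c\<^sub>i)\<close> and
  \<open>(b\<^sub>j, c\<^sub>j)\<close> (\<open>W_commutator\<close>). Hence longer commutators
  vanish on \<open>W\<close>, and the quotient in question is isomorphic to the space of
  functions of odd points spanned by the products of pairings \<open>array_val T\<close>, where
  \<open>T\<close> runs through the arrays of the given content
  (\<open>proper_in_I_w_iff\<close>, \<open>fa_val_in_value_space\<close>). The pairing is the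
  symmetric bilinear form of the plane, so the theorem belongs to the invariant theory of
  \<open>O(2)\<close> acting on odd vectors.

  The dimension comes from an explicit basis. Expanding a product of pairings gives words in the
  letters \<open>b\<^sub>i\<close>, \<open>c\<^sub>i\<close>, half of them of type
  \<open>b\<close>. Odd elements square to zero, so a word survives only if no letter repeats:
  an index of degree above 2 gives \<open>0\<close>, an index of degree 2 contributes
  \<open>b\<^sub>i c\<^sub>i\<close>, and an index of degree 1 contributes one of its letters.
  Pairings do not change when all \<open>b\<^sub>i\<close> and \<open>c\<^sub>i\<close> are
  interchanged, so a product of pairings is a combination of sums of a word and its mirror image
  (\<open>array_val_in_base_span\<close>). Conversely each such sum is a combination of products
  of pairings: \<open>2 b\<^sub>p c\<^sub>r\<close> is a pairing plus a
  \<^emph>\<open>twist\<close> \<open>b\<^sub>p c\<^sub>r - c\<^sub>p b\<^sub>r\<close>, which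
  changes sign under the interchange; only terms with an even number of twists survive the
  symmetrization, and a product of two twists is a polynomial in pairings
  (\<open>twist_twist\<close>, \<open>sym_pair_word\<close>). The words for \<open>l = 2
  s\<close> single indices correspond to the \<open>s\<close>-subsets of a set of \<open>2
  s\<close> elements, up to complement, which gives \<open>(2 s - 1) choose s\<close>. If
  \<open>l = 0\<close>, the only word is multiplied by \<open>(- 1) ^ q\<close> by the
  interchange, which explains the exceptional case.

  The normal arrays span because the \<open>3 \<times> 3\<close> permanents of pairings vanish,
  which they do since the form has rank 2 and its arguments are odd
  (\<open>pairing_permanent\<close>). Applied to three columns with \<open>b\<^sub>r \<le>
  b\<^sub>s \<le> b\<^sub>t\<close>, this relation rewrites the product through arrays of
  smaller \<open>weight\<close>, the sum of the \<open>a b\<close> over the columns: by the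
  rearrangement inequality the weight is largest when both rows increase together
  (\<open>straightening\<close>).

  The normal arrays are independent by a triangularity argument. In the coordinates \<open>b = u
  + v\<close>, \<open>c = u - v\<close> the pairing is \<open>2 (u\<^sub>i u\<^sub>j - v\<^sub>i
  v\<^sub>j)\<close>, so every monomial of \<open>array_val T\<close> comes from a division of
  the columns of \<open>T\<close> into \<open>u\<close>-columns and \<open>v\<close>-columns. A
  normal array can be divided into two families of nested intervals \<open>[b, a]\<close>
  (\<open>normal_splits_nested\<close>), and among all matchings of a set of letters the nested
  one is the unique matching of least weight (\<open>nested_minimal\<close>). Hence the monomial
  given by the nested division of \<open>S\<close> occurs in \<open>array_val T\<close> for no
  other c-array \<open>T\<close> of the same content with \<open>weight T \<le> weight S\<close>
  (\<open>normal_array_vals_independent\<close>). Since they also span, their number is the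
  dimension found above.
\<close>

section \<open>Supercommutativity of the Grassmann algebra\<close>

text \<open>
  Every pair of \<open>A \<times> B\<close> is an inversion of exactly one of the two
  concatenations.
\<close>

lemma gsign_swap:
  assumes "finite A" "finite B" "A \<inter> B = {}"
  shows "gsign B A = (- 1) ^ (card A * card B) * (gsign A B :: 'a::comm_ring_1)"
proof -
  let ?c = "\<lambda>(x, y). (y, x)"
  have "A \<times> B = inversions A B \<union> ?c ` inversions B A"
    using assms(3) by (auto simp: inversions_def image_iff)
  moreover have "inversions A B \<inter> ?c ` inversions B A = {}"
    by (auto simp: inversions_def)
  moreover have "card (?c ` inversions B A) = card (inversions B A)"
    by (intro card_image inj_onI) auto
  ultimately have "card A * card B = card (inversions A B) + card (inversions B A)"
    using assms by (metis card_Un_disjoint card_cartesian_product finite_imageI finite_inversions)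
  then show ?thesis
    by (simp add: gsign_def power_add power2_eq_square[symmetric] mult.commute mult.left_commute
        flip: power_mult_distrib)
qed

lemma gcoeff_mult_nonzero:
  assumes "gcoeff (x * y :: 'a::comm_ring_1 grassmann) C \<noteq> 0"
  obtains A where "A \<subseteq> C" "gcoeff x A \<noteq> 0" "gcoeff y (C - A) \<noteq> 0" "card C = card A + card (C - A)"
proof -
  from assms have nz: "(\<Sum>A\<in>Pow C. gsign A (C - A) * gcoeff x A * gcoeff y (C - A)) \<noteq> 0"
    by (simp add: times_grassmann.rep_eq)
  then have "finite (Pow C)" by (meson sum.infinite)
  moreover from nz obtain A where "A \<in> Pow C" "gsign A (C - A) * gcoeff x A * gcoeff y (C - A) \<noteq> 0"
    by (rule sum.not_neutral_contains_not_neutral)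
  moreover from calculation have "card C = card A + card (C - A)"
    by (metis PowD add.commute card_Diff_subset card_mono finite_Pow_iff finite_subset le_add_diff_inverse2)
  ultimately show thesis using that[of A] by force
qed

lemma gcoeff_mult_swap:
  assumes "\<And>A B. gcoeff x A \<noteq> 0 \<Longrightarrow> gcoeff y B \<noteq> 0 \<Longrightarrow> (- 1) ^ (card A * card B) = (e :: 'a)"
  shows "gcoeff (y * x) C = e * gcoeff (x * y :: 'a::comm_ring_1 grassmann) C"
proof (cases "finite C")
  case True
  have "gcoeff (y * x) C = (\<Sum>A\<in>Pow C. gsign (C - A) A * gcoeff y (C - A) * gcoeff x A)"
    unfolding times_grassmann.rep_eq
    by (rule sum.reindex_bij_witness[of _ "\<lambda>A. C - A" "\<lambda>A. C - A"]) (auto simp: double_diff)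
  also have "\<dots> = (\<Sum>A\<in>Pow C. e * (gsign A (C - A) * gcoeff x A * gcoeff y (C - A)))"
  proof (rule sum.cong)
    fix A assume "A \<in> Pow C"
    then have "finite A" "finite (C - A)" using True by (auto intro: finite_subset)
    then have "gsign (C - A) A = (- 1) ^ (card A * card (C - A)) * (gsign A (C - A) :: 'a)"
      by (intro gsign_swap) auto
    then show "gsign (C - A) A * gcoeff y (C - A) * gcoeff x A =
        e * (gsign A (C - A) * gcoeff x A * gcoeff y (C - A))"
      using assms[of A "C - A"] by (cases "gcoeff x A = 0 \<or> gcoeff y (C - A) = 0") (auto simp: mult_ac)
  qed simp
  finally show ?thesis by (simp add: times_grassmann.rep_eq sum_distrib_left)
next
  case False
  then have "infinite (Pow C)" by simp
  then show ?thesis by (simp add: times_grassmann.rep_eq)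
qed

lemma even_commute:
  assumes "x \<in> even_part"
  shows "y * x = x * (y :: 'a::comm_ring_1 grassmann)"
proof (rule gcoeff_eqI)
  fix C
  show "gcoeff (y * x) C = gcoeff (x * y) C"
    using assms by (subst gcoeff_mult_swap[where e = 1]) (auto simp: even_part_def)
qed

lemma odd_anticommute:
  assumes "x \<in> odd_part" "y \<in> odd_part"
  shows "y * x = - (x * y :: 'a::comm_ring_1 grassmann)"
proof (rule gcoeff_eqI)
  fix C
  show "gcoeff (y * x) C = gcoeff (- (x * y)) C"
    using assms by (subst gcoeff_mult_swap[where e = "- 1"]) (auto simp: odd_part_def uminus_grassmann.rep_eq)
qed

lemma odd_mult_odd: "x \<in> odd_part \<Longrightarrow> y \<in> odd_part \<Longrightarrow> x * y \<in> even_part"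
  unfolding even_part_def odd_part_def
  by (auto elim!: gcoeff_mult_nonzero)

lemma even_part_simps [simp]:
  "0 \<in> even_part" "1 \<in> even_part" "gconst c \<in> even_part"
  "x \<in> even_part \<Longrightarrow> - x \<in> even_part"
  "x \<in> even_part \<Longrightarrow> y \<in> even_part \<Longrightarrow> x + y \<in> even_part"
  "x \<in> even_part \<Longrightarrow> y \<in> even_part \<Longrightarrow> x - y \<in> even_part"
  by (auto simp: even_part_def zero_grassmann.rep_eq one_grassmann.rep_eq gconst.rep_eq
      uminus_grassmann.rep_eq plus_grassmann.rep_eq minus_grassmann.rep_eq split: if_splits)
    (metis add_0 diff_0 neg_equal_0_iff_equal)+

lemma odd_part_simps [simp]:
  "0 \<in> odd_part" "gen i \<in> odd_part"
  "x \<in> odd_part \<Longrightarrow> - x \<in> odd_part"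
  "x \<in> odd_part \<Longrightarrow> y \<in> odd_part \<Longrightarrow> x + y \<in> odd_part"
  "x \<in> odd_part \<Longrightarrow> y \<in> odd_part \<Longrightarrow> x - y \<in> odd_part"
  by (auto simp: odd_part_def zero_grassmann.rep_eq gen.rep_eq
      uminus_grassmann.rep_eq plus_grassmann.rep_eq minus_grassmann.rep_eq split: if_splits)
    (metis add_0 diff_0 neg_equal_0_iff_equal)+

lemma gconst_commute: "x * gconst c = gconst c * x"
  by (rule even_commute) simp

lemma gcoeff_gconst_mult: "gcoeff (gconst c * x) C = c * gcoeff x C"
proof (cases "finite C")
  case True
  have "gcoeff (gconst c * x) C = (\<Sum>A\<in>{{}}. gsign A (C - A) * gcoeff (gconst c) A * gcoeff x (C - A))"
    unfolding times_grassmann.rep_eq using True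
    by (intro sum.mono_neutral_right) (auto simp: gconst.rep_eq)
  then show ?thesis by (simp add: gconst.rep_eq)
next
  case False
  then have "infinite (Pow C)" "gcoeff x C = 0" using gcoeff[of x] by auto
  then show ?thesis by (simp add: times_grassmann.rep_eq)
qed

lemma gconst_1: "gconst 1 = 1"
  by (rule gcoeff_eqI) (simp add: gconst.rep_eq one_grassmann.rep_eq)

lemma gconst_minus: "gconst (- c) = - gconst c"
  by (rule gcoeff_eqI) (simp add: gconst.rep_eq uminus_grassmann.rep_eq)

lemma gconst_2: "gconst 2 = 2"
  using gconst_add[of 1 1] by (simp add: gconst_1)

lemma prod_list_even_perm:
  fixes f :: "'b \<Rightarrow> 'a::comm_ring_1 grassmann"
  assumes "mset xs = mset ys" "\<And>x. f x \<in> even_part"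
  shows "prod_list (map f xs) = prod_list (map f ys)"
  using assms(1)
proof (induction xs arbitrary: ys)
  case (Cons x xs)
  then obtain us vs where ys: "ys = us @ x # vs"
    by (metis list.set_intros(1) mset_eq_setD split_list)
  with Cons.prems have "mset xs = mset (us @ vs)" by simp
  then have "prod_list (map f (x # xs)) = f x * prod_list (map f us) * prod_list (map f vs)"
    using Cons.IH[of "us @ vs"] by (simp add: mult.assoc)
  also have "f x * prod_list (map f us) = prod_list (map f us) * f x"
    using assms(2) even_commute by metis
  finally show ?case by (simp add: ys mult.assoc)
qed simp

section \<open>Points with odd coordinates\<close>

text \<open>
  Odd elements as a type: a point with odd coordinates is then an arbitrary function, and the
  sign rules hold for all its values without side conditions.
\<close>

typedef (overloaded) 'a odd_elem = "odd_part :: 'a::comm_ring_1 grassmann set"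
  morphisms odd_val Odd_elem
  by (rule exI[of _ 0]) simp

lemma odd_val_odd [simp]: "odd_val x \<in> odd_part"
  by (rule odd_val)

lemma odd_val_anticommute: "odd_val x * odd_val y = - (odd_val y * odd_val x)"
  by (rule odd_anticommute) simp_all

lemma odd_val_anticommute_left: "odd_val x * (odd_val y * z) = - (odd_val y * (odd_val x * z))"
  by (simp only: odd_val_anticommute[of x y] mult.assoc[symmetric] mult_minus_left)

lemma odd_val_square:
  assumes "(2 :: 'a::field) \<noteq> 0"
  shows "odd_val (x :: 'a odd_elem) * odd_val x = 0"
proof (rule gcoeff_eqI)
  fix C
  have "gcoeff (odd_val x * odd_val x) C = - gcoeff (odd_val x * odd_val x) C"
    using arg_cong[OF odd_val_anticommute[of x x], of "\<lambda>z. gcoeff z C"] by (simp add: uminus_grassmann.rep_eq)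
  then have "2 * gcoeff (odd_val x * odd_val x) C = 0" by simp
  then show "gcoeff (odd_val x * odd_val x) C = gcoeff 0 C" using assms by (simp add: zero_grassmann.rep_eq)
qed

definition word_val :: "('l \<Rightarrow> 'a::comm_ring_1 odd_elem) \<Rightarrow> 'l list \<Rightarrow> 'a grassmann" where
  "word_val \<phi> w = prod_list (map (\<lambda>x. odd_val (\<phi> x)) w)"

lemma word_val_simps [simp]:
  "word_val \<phi> [] = 1" "word_val \<phi> (x # w) = odd_val (\<phi> x) * word_val \<phi> w"
  "word_val \<phi> (v @ w) = word_val \<phi> v * word_val \<phi> w"
  by (simp_all add: word_val_def)

lemma word_val_move: "word_val \<phi> (u @ x # v) = gconst ((- 1) ^ length u) * word_val \<phi> (x # u @ v)"
proof (induction u)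
  case (Cons y u)
  have "word_val \<phi> (y # u @ x # v) = gconst ((- 1) ^ length u) * (odd_val (\<phi> y) * word_val \<phi> (x # u @ v))"
    using Cons by (simp only: word_val_simps mult.assoc[symmetric] gconst_commute)
  then show ?case
    using odd_val_anticommute_left[of "\<phi> y" "\<phi> x"] by (simp add: gconst_minus)
qed (simp add: gconst_1)

text \<open>
  Reordering a word changes its value by the sign of a permutation. The point of the formulation
  is that this sign does not depend on \<open>\<phi>\<close>, so that the same sign applies to a
  word and to its mirror image.
\<close>

lemma word_val_perm:
  assumes "mset w = mset w'"
  obtains e :: "'a::comm_ring_1" where "e = 1 \<or> e = - 1" "\<And>\<phi>. word_val \<phi> w = gconst e * word_val \<phi> w'"
proof -
  have "\<exists>e :: 'a. (e = 1 \<or> e = - 1) \<and> (\<forall>\<phi>. word_val \<phi> w = gconst e * word_val \<phi> w')"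
    using assms
  proof (induction w arbitrary: w')
    case Nil
    then show ?case by (intro exI[of _ 1]) (simp add: gconst_1)
  next
    case (Cons x w)
    then obtain u v where w': "w' = u @ x # v"
      by (metis list.set_intros(1) mset_eq_setD split_list)
    with Cons.prems have "mset w = mset (u @ v)" by simp
    from Cons.IH[OF this] obtain e :: 'a where e: "e = 1 \<or> e = - 1" "\<And>\<phi>. word_val \<phi> w = gconst e * word_val \<phi> (u @ v)"
      by blast
    let ?s = "(- 1 :: 'a) ^ length u"
    have s: "?s = 1 \<or> ?s = - 1" by (simp add: minus_one_power_iff)
    have "word_val \<phi> (x # w) = gconst (e * ?s) * word_val \<phi> w'" for \<phi> :: "'b \<Rightarrow> 'a odd_elem"
    proof -
      have "gconst (e * ?s) * word_val \<phi> w' = gconst (e * ?s * ?s) * word_val \<phi> (x # u @ v)"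
        unfolding w' word_val_move by (simp only: gconst_mult mult.assoc)
      also have "e * ?s * ?s = e" using s by auto
      also have "gconst e * word_val \<phi> (x # u @ v) = odd_val (\<phi> x) * (gconst e * word_val \<phi> (u @ v))"
        by (simp only: word_val_simps(2) mult.assoc[symmetric] gconst_commute)
      finally show ?thesis by (simp add: e(2))
    qed
    moreover have "e * ?s = 1 \<or> e * ?s = - 1" using e(1) s by auto
    ultimately show ?case by blast
  qed
  then obtain e :: 'a where "e = 1 \<or> e = - 1" "\<forall>\<phi>. word_val \<phi> w = gconst e * word_val \<phi> w'"
    by (elim exE conjE)
  then show thesis using that[of e] by simp
qed

lemma word_val_not_distinct:
  fixes \<phi> :: "'l \<Rightarrow> 'a::field odd_elem"
  assumes "(2 :: 'a) \<noteq> 0" "\<not> distinct w"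
  shows "word_val \<phi> w = 0"
proof -
  from assms(2) obtain a x b c where "w = a @ [x] @ b @ [x] @ c"
    by (auto dest: not_distinct_decomp)
  then have "mset w = mset (x # x # a @ b @ c)" by simp
  then obtain e :: 'a where "word_val \<phi> w = gconst e * word_val \<phi> (x # x # a @ b @ c)"
    by (rule word_val_perm) blast
  then show ?thesis
    using odd_val_square[OF assms(1)] by (simp flip: mult.assoc)
qed

lemma gcoeff_gen_times:
  assumes "\<And>A. gcoeff x A \<noteq> 0 \<Longrightarrow> A = B" "i \<notin> B" "finite B"
  shows "gcoeff (gen i * x :: 'a::comm_ring_1 grassmann) C =
    (if C = insert i B then gsign {i} B * gcoeff x B else 0)"
proof (cases "C = insert i B")
  case True
  have "gcoeff (gen i * x) C = (\<Sum>A\<in>{{i}}. gsign A (C - A) * gcoeff (gen i) A * gcoeff x (C - A))"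
    unfolding times_grassmann.rep_eq using True assms
    by (intro sum.mono_neutral_right) (auto simp: gen.rep_eq)
  moreover have "C - {i} = B" using True assms by auto
  ultimately show ?thesis using True by (simp add: gen.rep_eq)
next
  case False
  have "gcoeff (gen i * x) C = 0"
  proof (rule ccontr)
    assume "gcoeff (gen i * x) C \<noteq> 0"
    then obtain A where "A \<subseteq> C" "gcoeff (gen i :: 'a grassmann) A \<noteq> 0" "gcoeff x (C - A) \<noteq> 0"
      by (rule gcoeff_mult_nonzero)
    moreover from this have "A = {i}" "C - A = B"
      using assms(1) by (auto simp: gen.rep_eq split: if_splits)
    ultimately show False using False by auto
  qed
  then show ?thesis using False by simp
qed

text \<open>
  At independent generators the value of a word is, up to sign, a basis monomial.
\<close>

lemma gcoeff_word_val_gen: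
  fixes \<phi> :: "'l \<Rightarrow> 'a::comm_ring_1 odd_elem"
  assumes "distinct w" "inj_on \<rho> (set w)" "\<And>x. x \<in> set w \<Longrightarrow> odd_val (\<phi> x) = gen (\<rho> x)"
  obtains e :: 'a where "e = 1 \<or> e = - 1"
    "\<And>C. gcoeff (word_val \<phi> w) C = (if C = \<rho> ` set w then e else 0)"
proof -
  have "\<exists>e :: 'a. (e = 1 \<or> e = - 1) \<and> (\<forall>C. gcoeff (word_val \<phi> w) C = (if C = \<rho> ` set w then e else 0))"
    using assms
  proof (induction w)
    case Nil
    then show ?case by (intro exI[of _ 1]) (simp add: one_grassmann.rep_eq)
  next
    case (Cons x w)
    then obtain e :: 'a where e: "e = 1 \<or> e = - 1" "\<And>C. gcoeff (word_val \<phi> w) C = (if C = \<rho> ` set w then e else 0)"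
      by auto
    have "\<rho> x \<notin> \<rho> ` set w" using Cons.prems by (auto simp: inj_on_def)
    then have *: "gcoeff (word_val \<phi> (x # w)) C =
        (if C = \<rho> ` set (x # w) then gsign {\<rho> x} (\<rho> ` set w) * e else 0)" for C
    proof -
      have A: "\<And>A. gcoeff (word_val \<phi> w) A \<noteq> 0 \<Longrightarrow> A = \<rho> ` set w"
        by (simp add: e(2) split: if_splits)
      have "gcoeff (gen (\<rho> x) * word_val \<phi> w) C =
          (if C = insert (\<rho> x) (\<rho> ` set w) then gsign {\<rho> x} (\<rho> ` set w) * gcoeff (word_val \<phi> w) (\<rho> ` set w) else 0)"
        by (rule gcoeff_gen_times[OF A \<open>\<rho> x \<notin> \<rho> ` set w\<close>]) simp_all
      then show ?thesis using Cons.prems(3)[of x] by (simp add: e(2))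
    qed
    have "gsign {\<rho> x} (\<rho> ` set w) = (1 :: 'a) \<or> gsign {\<rho> x} (\<rho> ` set w) = (- 1 :: 'a)"
      by (simp add: gsign_def minus_one_power_iff)
    then have "gsign {\<rho> x} (\<rho> ` set w) * e = 1 \<or> gsign {\<rho> x} (\<rho> ` set w) * e = - 1"
      using e(1) by auto
    then show ?case using * by (intro exI[of _ "gsign {\<rho> x} (\<rho> ` set w) * e"] conjI allI)
  qed
  then obtain e :: 'a where "e = 1 \<or> e = - 1" "\<forall>C. gcoeff (word_val \<phi> w) C = (if C = \<rho> ` set w then e else 0)"
    by (elim exE conjE)
  then show thesis using that[of e] by simp
qed

section \<open>The values of products of commutators\<close>

text \<open>
  Values of polynomials are compared as functions of the point at which they are taken; these
  functions form a vector space over the base field.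
\<close>

definition gf_scale :: "'a::field \<Rightarrow> ('p \<Rightarrow> 'a grassmann) \<Rightarrow> 'p \<Rightarrow> 'a grassmann" where
  "gf_scale c F = (\<lambda>\<phi>. gconst c * F \<phi>)"

interpretation gf: vector_space gf_scale
  by standard
    (simp_all add: gf_scale_def fun_eq_iff gconst_add gconst_mult gconst_1 distrib_left distrib_right mult.assoc)

text \<open>
  The letter \<open>(i, True)\<close> stands for the upper right entry \<open>b\<^sub>i\<close>
  of the \<open>i\<close>-th matrix, the letter \<open>(i, False)\<close> for the lower left
  entry \<open>c\<^sub>i\<close>.
\<close>

type_synonym letter = "nat \<times> bool"

definition pairing :: "(letter \<Rightarrow> 'a::comm_ring_1 odd_elem) \<Rightarrow> nat \<Rightarrow> nat \<Rightarrow> 'a grassmann" where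
  "pairing \<phi> i j = odd_val (\<phi> (i, True)) * odd_val (\<phi> (j, False)) + odd_val (\<phi> (i, False)) * odd_val (\<phi> (j, True))"

definition array_val :: "array \<Rightarrow> (letter \<Rightarrow> 'a::comm_ring_1 odd_elem) \<Rightarrow> 'a grassmann" where
  "array_val T \<phi> = prod_list (map (\<lambda>(i, j). pairing \<phi> i j) T)"

definition array_content :: "array \<Rightarrow> nat multiset" where
  "array_content T = mset (map fst T) + mset (map snd T)"

definition value_space :: "nat multiset \<Rightarrow> ((letter \<Rightarrow> 'a::field odd_elem) \<Rightarrow> 'a grassmann) set" where
  "value_space m = gf.span (array_val ` {T. array_content T = m})"

lemma array_val_simps [simp]:
  "array_val [] \<phi> = 1" "array_val (c # T) \<phi> = pairing \<phi> (fst c) (snd c) * array_val T \<phi>"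
  "array_val (S @ T) \<phi> = array_val S \<phi> * array_val T \<phi>"
  by (simp_all add: array_val_def case_prod_beta)

lemma pairing_even: "pairing \<phi> i j \<in> even_part"
  by (simp add: pairing_def odd_mult_odd)

lemma pairing_flip: "pairing \<phi> j i = - pairing \<phi> i j"
  using odd_val_anticommute[of "\<phi> (j, True)" "\<phi> (i, False)"]
    odd_val_anticommute[of "\<phi> (j, False)" "\<phi> (i, True)"]
  by (simp add: pairing_def)

lemma pairing_self: "pairing \<phi> i i = 0"
  using odd_val_anticommute[of "\<phi> (i, True)" "\<phi> (i, False)"] by (simp add: pairing_def)

lemma pairing_commute: "x * pairing \<phi> i j = pairing \<phi> i j * x"
  by (rule even_commute) (rule pairing_even)

lemma array_val_perm: "mset S = mset T \<Longrightarrow> array_val S = array_val T"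
  unfolding array_val_def by (rule ext, rule prod_list_even_perm) (auto simp: pairing_even)

lemma array_val_in: "array_content T = m \<Longrightarrow> array_val T \<in> value_space m"
  unfolding value_space_def by (intro gf.span_base) auto

lemma value_space_zero: "(\<lambda>\<phi>. 0) \<in> value_space m"
  using gf.span_zero unfolding value_space_def zero_fun_def .

lemma value_space_mult:
  assumes "F \<in> value_space m"
  shows "(\<lambda>\<phi>. pairing \<phi> i j * F \<phi>) \<in> value_space (m + {#i, j#})"
  using assms unfolding value_space_def
proof (induction F rule: gf.span_induct_alt)
  case base
  show ?case using gf.span_zero by (simp add: zero_fun_def)
next
  case (step c F G)
  then obtain T where T: "array_content T = m" "F = array_val T" by auto
  then have "array_content ((i, j) # T) = m + {#i, j#}" by (simp add: array_content_def)
  moreover have "(\<lambda>\<phi>. pairing \<phi> i j * (gf_scale c F + G) \<phi>) =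
      gf_scale c (array_val ((i, j) # T)) + (\<lambda>\<phi>. pairing \<phi> i j * G \<phi>)"
    by (simp add: fun_eq_iff gf_scale_def T distrib_left mult.assoc flip: gconst_commute)
  moreover from calculation(1) have "gf_scale c (array_val ((i, j) # T)) \<in>
      gf.span (array_val ` {T. array_content T = m + {#i, j#}})"
    by (intro gf.span_scale gf.span_base) blast
  ultimately show ?case using gf.span_add[OF _ step.IH] by simp
qed

text \<open>
  Expand the permanent. In each term two of the three factors come from the same matrix,
  \<open>X\<close> or \<open>Y\<close>; exchanging their column indices is a sign-reversing
  involution on the terms.
\<close>

lemma rank_two_permanent:
  fixes X Y :: "nat \<Rightarrow> nat \<Rightarrow> 'r::ring"
  assumes X: "\<And>i j k l. X i j * X k l = - (X i l * X k j)"
    and Y: "\<And>i j k l. Y i j * Y k l = - (Y i l * Y k j)"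
    and XY: "\<And>i j k l. Y i j * X k l = X k l * Y i j"
  defines "h \<equiv> \<lambda>i j. X i j + Y i j"
  shows "h 0 0 * (h 1 1 * h 2 2) + h 0 1 * (h 1 0 * h 2 2) + h 0 0 * (h 1 2 * h 2 1)
       + h 0 1 * (h 1 2 * h 2 0) + h 0 2 * (h 1 0 * h 2 1) + h 0 2 * (h 1 1 * h 2 0) = 0"
proof -
  have X': "l < j \<Longrightarrow> X i j * X k l = - (X i l * X k j)"
    "l < j \<Longrightarrow> X i j * (X k l * z) = - (X i l * (X k j * z))" for i j k l z
    by (rule X) (simp only: X[of i j k l] mult.assoc[symmetric] mult_minus_left)
  have Y': "l < j \<Longrightarrow> Y i j * Y k l = - (Y i l * Y k j)"
    "l < j \<Longrightarrow> Y i j * (Y k l * z) = - (Y i l * (Y k j * z))" for i j k l z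
    by (rule Y) (simp only: Y[of i j k l] mult.assoc[symmetric] mult_minus_left)
  have XY': "Y i j * (X k l * z) = X k l * (Y i j * z)" for i j k l z
    by (simp only: XY mult.assoc[symmetric])
  show ?thesis
    by (simp add: h_def distrib_left distrib_right right_diff_distrib left_diff_distrib mult.assoc X' Y' XY XY')
qed

lemma pairing_permanent:
  fixes a b :: "nat \<Rightarrow> nat"
  defines "h \<equiv> \<lambda>\<phi> i j. pairing \<phi> (a i) (b j)"
  shows "h \<phi> 0 0 * (h \<phi> 1 1 * h \<phi> 2 2) + h \<phi> 0 1 * (h \<phi> 1 0 * h \<phi> 2 2) + h \<phi> 0 0 * (h \<phi> 1 2 * h \<phi> 2 1)
       + h \<phi> 0 1 * (h \<phi> 1 2 * h \<phi> 2 0) + h \<phi> 0 2 * (h \<phi> 1 0 * h \<phi> 2 1) + h \<phi> 0 2 * (h \<phi> 1 1 * h \<phi> 2 0) = 0"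
proof -
  have *: "odd_val p * odd_val q * (odd_val r * odd_val s) = - (odd_val p * odd_val s * (odd_val r * odd_val q))"
    for p q r s :: "'a odd_elem"
  proof -
    have "odd_val q * (odd_val r * odd_val s) = odd_val s * (odd_val r * odd_val q) * (- 1)"
      by (simp add: odd_val_anticommute[of q r] odd_val_anticommute_left[of q r] odd_val_anticommute[of q s]
          odd_val_anticommute_left[of r s])
    then show ?thesis by (simp add: mult.assoc)
  qed
  let ?X = "\<lambda>i j. odd_val (\<phi> (a i, True)) * odd_val (\<phi> (b j, False))"
  let ?Y = "\<lambda>i j. odd_val (\<phi> (a i, False)) * odd_val (\<phi> (b j, True))"
  have "?Y i j * ?X k l = ?X k l * ?Y i j" for i j k l
    by (rule even_commute) (simp add: odd_mult_odd)
  from rank_two_permanent[of ?X ?Y, OF * * this] show ?thesis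
    unfolding h_def pairing_def .
qed

text \<open>
  The skew counterpart of the pairing: it changes sign when the two coordinates of all vectors
  are interchanged, and is symmetric in the indices. Together with the pairing it recovers the
  products of the form \<open>b\<^sub>i c\<^sub>j\<close>.
\<close>

definition twist :: "(letter \<Rightarrow> 'a::comm_ring_1 odd_elem) \<Rightarrow> nat \<Rightarrow> nat \<Rightarrow> 'a grassmann" where
  "twist \<phi> i j = odd_val (\<phi> (i, True)) * odd_val (\<phi> (j, False)) - odd_val (\<phi> (i, False)) * odd_val (\<phi> (j, True))"

text \<open>
  The identity expressing a product of two determinants by a Gram determinant, with the signs
  that odd coordinates cause.
\<close>

lemma twist_twist:
  "twist \<phi> i j * twist \<phi> k l = pairing \<phi> i k * pairing \<phi> j l + pairing \<phi> i l * pairing \<phi> j k"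
proof -
  have sw: "odd_val (\<phi> (k, c)) * (odd_val (\<phi> (j, d)) * z) = - (odd_val (\<phi> (j, d)) * (odd_val (\<phi> (k, c)) * z))"
    "odd_val (\<phi> (l, c)) * (odd_val (\<phi> (j, d)) * z) = - (odd_val (\<phi> (j, d)) * (odd_val (\<phi> (l, c)) * z))"
    "odd_val (\<phi> (l, c)) * odd_val (\<phi> (k, d)) = - (odd_val (\<phi> (k, d)) * odd_val (\<phi> (l, c)))" for c d z
    by (rule odd_val_anticommute odd_val_anticommute_left)+
  show ?thesis
    unfolding twist_def pairing_def
    by (simp add: distrib_left distrib_right left_diff_distrib right_diff_distrib mult.assoc sw)
qed

text \<open>
  The interchange of the two coordinates, an element of \<open>O(2)\<close> of determinant
  \<open>- 1\<close>.
\<close>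

definition flip_point :: "(letter \<Rightarrow> 'e) \<Rightarrow> letter \<Rightarrow> 'e" where
  "flip_point \<phi> = (\<lambda>(i, c). \<phi> (i, \<not> c))"

definition sym_val :: "letter list \<Rightarrow> (letter \<Rightarrow> 'a::comm_ring_1 odd_elem) \<Rightarrow> 'a grassmann" where
  "sym_val w \<phi> = word_val \<phi> w + word_val (flip_point \<phi>) w"

lemma sym_val_perm:
  assumes "mset w = mset w'"
  obtains e :: "'a::field" where "e = 1 \<or> e = - 1" "sym_val w = gf_scale e (sym_val w')"
proof -
  from word_val_perm[OF assms] obtain e :: 'a
    where e: "e = 1 \<or> e = - 1" "\<And>\<phi>. word_val \<phi> w = gconst e * word_val \<phi> w'" by blast
  show thesis
    by (rule that[OF e(1)]) (simp add: fun_eq_iff sym_val_def gf_scale_def e(2) distrib_left)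
qed

definition pair_word :: "array \<Rightarrow> letter list" where
  "pair_word Q = concat (map (\<lambda>(p, r). [(p, True), (r, False)]) Q)"

text \<open>
  A factor \<open>b\<^sub>p c\<^sub>r\<close> is half of pairing plus twist, and the interchange
  changes the sign of the twist. In the word plus its mirror image only products with an even
  number of twists survive, and these are eliminated in pairs by \<open>twist_twist\<close>. The
  second conclusion, about the word minus its mirror image multiplied by one more twist, is what
  the induction needs in addition.
\<close>

lemma sym_pair_word:
  assumes two: "(2 :: 'a::field) \<noteq> 0"
  shows "sym_val (pair_word Q) \<in> (value_space (array_content Q) :: ((letter \<Rightarrow> 'a odd_elem) \<Rightarrow> _) set) \<and>
    (\<forall>i j. (\<lambda>\<phi>. twist \<phi> i j * (word_val \<phi> (pair_word Q) - word_val (flip_point \<phi>) (pair_word Q)))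
      \<in> (value_space (array_content Q + {#i, j#}) :: ((letter \<Rightarrow> 'a odd_elem) \<Rightarrow> _) set))"
proof (induction Q)
  case Nil
  have "sym_val (pair_word []) = gf_scale (2 :: 'a) (array_val [])"
    by (simp add: fun_eq_iff sym_val_def pair_word_def gf_scale_def gconst_2)
  then have "(sym_val (pair_word []) :: (letter \<Rightarrow> 'a odd_elem) \<Rightarrow> _) \<in> value_space (array_content ([] :: array))"
    using gf.span_scale[OF array_val_in[OF refl, unfolded value_space_def], of "2 :: 'a" "[]"]
    by (simp add: value_space_def)
  then show ?case
    by (simp add: pair_word_def value_space_zero)
next
  case (Cons pr Q)
  obtain p r where pr: "pr = (p, r)" by force
  let ?X = "\<lambda>\<phi> :: letter \<Rightarrow> 'a odd_elem. word_val \<phi> (pair_word Q)"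
  let ?X' = "\<lambda>\<phi> :: letter \<Rightarrow> 'a odd_elem. word_val (flip_point \<phi>) (pair_word Q)"
  let ?Y = "\<lambda>\<phi> :: letter \<Rightarrow> 'a odd_elem. word_val \<phi> (pair_word (pr # Q))"
  let ?Y' = "\<lambda>\<phi> :: letter \<Rightarrow> 'a odd_elem. word_val (flip_point \<phi>) (pair_word (pr # Q))"
  let ?m = "array_content Q"
  have half: "gconst (1 / 2) * (x + x) = x" for x :: "'a grassmann"
  proof -
    have "gconst (1 / 2) * (x + x) = gconst (1 / 2 + 1 / 2) * x"
      by (simp only: gconst_add distrib_left distrib_right)
    then show ?thesis using two by (simp add: gconst_1)
  qed
  have Y: "?Y \<phi> = gconst (1 / 2) * ((pairing \<phi> p r + twist \<phi> p r) * ?X \<phi>)" for \<phi>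
    using half[of "?Y \<phi>"] by (simp add: pr pair_word_def pairing_def twist_def distrib_right mult.assoc)
  have Y': "?Y' \<phi> = gconst (1 / 2) * ((pairing \<phi> p r - twist \<phi> p r) * ?X' \<phi>)" for \<phi>
    using half[of "?Y' \<phi>"]
    by (simp add: pr pair_word_def pairing_def twist_def flip_point_def distrib_right mult.assoc)
  have IH: "(\<lambda>\<phi>. ?X \<phi> + ?X' \<phi>) \<in> value_space ?m"
    "\<And>i j. (\<lambda>\<phi>. twist \<phi> i j * (?X \<phi> - ?X' \<phi>)) \<in> value_space (?m + {#i, j#})"
    using Cons.IH unfolding sym_val_def by (auto simp: sym_val_def[abs_def])
  have m: "array_content (pr # Q) = ?m + {#p, r#}" by (simp add: array_content_def pr)
  have add: "(\<lambda>\<phi>. gconst c * (F \<phi> + G \<phi>)) \<in> value_space m'"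
    if "F \<in> value_space m'" "G \<in> value_space m'" for c and m' and F G :: "(letter \<Rightarrow> 'a odd_elem) \<Rightarrow> _"
    using gf.span_scale[OF gf.span_add[OF that[unfolded value_space_def]], of c]
    by (simp add: value_space_def gf_scale_def)
  have "sym_val (pair_word (pr # Q)) =
      (\<lambda>\<phi>. gconst (1 / 2) * (pairing \<phi> p r * (?X \<phi> + ?X' \<phi>) + twist \<phi> p r * (?X \<phi> - ?X' \<phi>)))"
  proof
    fix \<phi> :: "letter \<Rightarrow> 'a odd_elem"
    show "sym_val (pair_word (pr # Q)) \<phi> =
        gconst (1 / 2) * (pairing \<phi> p r * (?X \<phi> + ?X' \<phi>) + twist \<phi> p r * (?X \<phi> - ?X' \<phi>))"
      unfolding sym_val_def Y[of \<phi>] Y'[of \<phi>] by (simp add: algebra_simps)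
  qed
  moreover have "\<dots> \<in> value_space (?m + {#p, r#})"
    by (rule add[OF value_space_mult[OF IH(1)] IH(2)])
  moreover have "(\<lambda>\<phi>. twist \<phi> i j * (?Y \<phi> - ?Y' \<phi>)) \<in> value_space (?m + {#p, r#} + {#i, j#})" for i j
  proof -
    have "twist \<phi> i j * (?Y \<phi> - ?Y' \<phi>) = gconst (1 / 2) *
        (pairing \<phi> p r * (twist \<phi> i j * (?X \<phi> - ?X' \<phi>)) +
         gconst 1 * (pairing \<phi> i p * (pairing \<phi> j r * (?X \<phi> + ?X' \<phi>)) + pairing \<phi> i r * (pairing \<phi> j p * (?X \<phi> + ?X' \<phi>))))" for \<phi>
    proof -
      have "twist \<phi> i j * (?Y \<phi> - ?Y' \<phi>) = gconst (1 / 2) * (twist \<phi> i j * (pairing \<phi> p r * (?X \<phi> - ?X' \<phi>))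
          + twist \<phi> i j * twist \<phi> p r * (?X \<phi> + ?X' \<phi>))"
      proof -
        have "?Y \<phi> - ?Y' \<phi> = gconst (1 / 2) * (pairing \<phi> p r * (?X \<phi> - ?X' \<phi>) + twist \<phi> p r * (?X \<phi> + ?X' \<phi>))"
          unfolding Y[of \<phi>] Y'[of \<phi>] by (simp add: algebra_simps)
        then have "twist \<phi> i j * (?Y \<phi> - ?Y' \<phi>) = (twist \<phi> i j * gconst (1 / 2)) *
            (pairing \<phi> p r * (?X \<phi> - ?X' \<phi>) + twist \<phi> p r * (?X \<phi> + ?X' \<phi>))"
          by (simp only: mult.assoc)
        then show ?thesis
          by (simp only: gconst_commute) (simp only: mult.assoc distrib_left)
      qed
      also have "twist \<phi> i j * (pairing \<phi> p r * (?X \<phi> - ?X' \<phi>)) = pairing \<phi> p r * (twist \<phi> i j * (?X \<phi> - ?X' \<phi>))"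
        by (simp only: mult.assoc[symmetric] pairing_commute)
      finally show ?thesis
        by (simp only: twist_twist distrib_right mult.assoc gconst_1 mult_1_left)
    qed
    moreover have "(\<lambda>\<phi>. pairing \<phi> p r * (twist \<phi> i j * (?X \<phi> - ?X' \<phi>))) \<in> value_space (?m + {#p, r#} + {#i, j#})"
      using value_space_mult[OF IH(2)[of i j], of p r] by (simp add: add_mset_commute)
    moreover have "(\<lambda>\<phi>. pairing \<phi> i p * (pairing \<phi> j r * (?X \<phi> + ?X' \<phi>))) \<in> value_space (?m + {#p, r#} + {#i, j#})"
      using value_space_mult[OF value_space_mult[OF IH(1), of j r], of i p] by (simp add: add_mset_commute)
    moreover have "(\<lambda>\<phi>. pairing \<phi> i r * (pairing \<phi> j p * (?X \<phi> + ?X' \<phi>))) \<in> value_space (?m + {#p, r#} + {#i, j#})"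
      using value_space_mult[OF value_space_mult[OF IH(1), of j p], of i r] by (simp add: add_mset_commute)
    ultimately show ?thesis
      by (simp only:) (intro add)
  qed
  ultimately show ?case by (simp only: m) blast
qed

fun expansions :: "array \<Rightarrow> letter list list" where
  "expansions [] = [[]]"
| "expansions ((i, j) # T) = map (\<lambda>w. (i, True) # (j, False) # w) (expansions T) @
     map (\<lambda>w. (i, False) # (j, True) # w) (expansions T)"

lemma array_val_expansions: "array_val T \<phi> = (\<Sum>w\<leftarrow>expansions T. word_val \<phi> w)"
  by (induction T rule: expansions.induct)
    (simp_all add: pairing_def distrib_right o_def mult.assoc sum_list_const_mult)

lemma array_val_flip: "array_val T (flip_point \<phi>) = array_val T \<phi>"
  by (simp add: array_val_def pairing_def flip_point_def add.commute)

lemma expansions_content: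
  assumes "w \<in> set (expansions T)"
  shows "mset (map fst w) = array_content T"
    "length (filter snd w) = length T" "length (filter (Not \<circ> snd) w) = length T"
  using assms
  by (induction T arbitrary: w rule: expansions.induct) (auto simp: array_content_def)

text \<open>
  Pairings are invariant under the interchange, so a product of pairings is the mean of its own
  expansion and the expansion at the mirror point.
\<close>

lemma array_val_sym:
  assumes two: "(2 :: 'a::field) \<noteq> 0"
  shows "(array_val T :: (letter \<Rightarrow> 'a odd_elem) \<Rightarrow> _) \<in> gf.span (sym_val ` set (expansions T))"
proof -
  have "gf_scale (2 :: 'a) (array_val T) = (\<Sum>w\<leftarrow>expansions T. sym_val w)"
  proof
    fix \<phi> :: "letter \<Rightarrow> 'a odd_elem"
    have "gf_scale 2 (array_val T) \<phi> = array_val T \<phi> + array_val T (flip_point \<phi>)"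
      by (simp add: gf_scale_def array_val_flip gconst_2 mult_2)
    also have "\<dots> = (\<Sum>w\<leftarrow>expansions T. sym_val w \<phi>)"
      by (simp add: array_val_expansions sym_val_def sum_list_addf)
    also have "\<dots> = (\<Sum>w\<leftarrow>expansions T. sym_val w) \<phi>"
    proof -
      have "(\<Sum>w\<leftarrow>ws. sym_val w \<phi>) = (\<Sum>w\<leftarrow>ws. sym_val w) \<phi>" for ws
        by (induction ws) simp_all
      then show ?thesis .
    qed
    finally show "gf_scale 2 (array_val T) \<phi> = (\<Sum>w\<leftarrow>expansions T. sym_val w) \<phi>" .
  qed
  moreover have "(\<Sum>w\<leftarrow>ws. sym_val w) \<in> gf.span (sym_val ` V :: ((letter \<Rightarrow> 'a odd_elem) \<Rightarrow> _) set)"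
    if "set ws \<subseteq> V" for ws :: "letter list list" and V
    using that by (induction ws) (auto intro: gf.span_add gf.span_base gf.span_zero)
  from this[OF subset_refl, of "expansions T"]
  have "(\<Sum>w\<leftarrow>expansions T. sym_val w) \<in> gf.span (sym_val ` set (expansions T) :: ((letter \<Rightarrow> 'a odd_elem) \<Rightarrow> _) set)" .
  ultimately have "gf_scale (2 :: 'a) (array_val T) \<in> gf.span (sym_val ` set (expansions T))" by simp
  then have "gf_scale (1 / 2 :: 'a) (gf_scale 2 (array_val T)) \<in> gf.span (sym_val ` set (expansions T))"
    by (rule gf.span_scale)
  then show ?thesis using two by simp
qed

section \<open>A basis of the space of values\<close>

lemma gf_independent_family:
  assumes "finite I" "\<And>c. (\<Sum>i\<in>I. gf_scale (c i) (f i)) = 0 \<Longrightarrow> \<forall>i\<in>I. c i = 0"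
  shows "inj_on f I" "\<not> gf.dependent (f ` I)"
proof -
  show inj: "inj_on f I"
  proof (rule inj_onI, rule ccontr)
    fix i j assume ij: "i \<in> I" "j \<in> I" "f i = f j" "i \<noteq> j"
    let ?c = "\<lambda>x. if x = i then 1 else if x = j then - 1 else 0"
    have "(\<Sum>x\<in>I. gf_scale (?c x) (f x)) = (\<Sum>x\<in>{i, j}. gf_scale (?c x) (f x))"
      using assms(1) ij by (intro sum.mono_neutral_right) auto
    also have "\<dots> = 0" using ij by simp
    finally show False using assms(2)[of ?c] ij by fastforce
  qed
  show "\<not> gf.dependent (f ` I)"
  proof (rule gf.independent_if_scalars_zero)
    fix u x assume "(\<Sum>x\<in>f ` I. gf_scale (u x) x) = 0" "x \<in> f ` I"
    then show "u x = 0"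
      using assms(2)[of "\<lambda>i. u (f i)"] inj by (auto simp: sum.reindex)
  qed (use assms(1) in simp)
qed

definition singles :: "nat multiset \<Rightarrow> nat set" where
  "singles m = {i. count m i = 1}"

definition doubles :: "nat multiset \<Rightarrow> nat set" where
  "doubles m = {i. count m i = 2}"

lemma finite_singles [simp]: "finite (singles m)" and finite_doubles [simp]: "finite (doubles m)"
  by (rule finite_subset[of _ "set_mset m"]; auto simp: singles_def doubles_def simp flip: count_greater_zero_iff)+

text \<open>
  A word without repeated letters in which \<open>i\<close> occurs \<open>count m i\<close>
  times is, up to order, \<open>base_word m A\<close>: every index of degree 2 brings both its
  letters, an index \<open>i\<close> of degree 1 brings \<open>b\<^sub>i\<close> if \<open>i
  \<in> A\<close> and \<open>c\<^sub>i\<close> otherwise.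
\<close>

definition single_word :: "nat set \<Rightarrow> nat list \<Rightarrow> letter list" where
  "single_word A = map (\<lambda>i. (i, i \<in> A))"

definition double_word :: "nat list \<Rightarrow> letter list" where
  "double_word ds = concat (map (\<lambda>d. [(d, True), (d, False)]) ds)"

definition base_word :: "nat multiset \<Rightarrow> nat set \<Rightarrow> letter list" where
  "base_word m A = double_word (sorted_list_of_set (doubles m)) @ single_word A (sorted_list_of_set (singles m))"

definition base_val :: "nat multiset \<Rightarrow> nat set \<Rightarrow> (letter \<Rightarrow> 'a::comm_ring_1 odd_elem) \<Rightarrow> 'a grassmann" where
  "base_val m A = sym_val (base_word m A)"

lemma set_base_word: "set (base_word m A) = doubles m \<times> UNIV \<union> (\<lambda>i. (i, i \<in> A)) ` singles m"
  by (auto simp: base_word_def double_word_def single_word_def UNIV_bool)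

lemma distinct_base_word: "distinct (base_word m A)"
proof -
  have "distinct (double_word ds)" if "distinct ds" for ds
    using that by (induction ds) (auto simp: double_word_def)
  moreover have "distinct (single_word A ls)" if "distinct ls" for ls
    using that by (simp add: single_word_def distinct_map inj_on_def)
  moreover have "set (double_word ds) \<inter> set (single_word A ls) = {}" if "set ds \<inter> set ls = {}" for ds ls
    using that by (auto simp: double_word_def single_word_def)
  moreover have "singles m \<inter> doubles m = {}" by (auto simp: singles_def doubles_def)
  ultimately show ?thesis by (simp add: base_word_def Int_commute)
qed

lemma base_word_content:
  assumes "\<And>i. count m i \<le> 2"
  shows "mset (map fst (base_word m A)) = m"
proof -
  have "mset (map fst (double_word ds)) = mset ds + mset ds" for ds
    by (induction ds) (auto simp: double_word_def)
  moreover have "map fst (single_word A ls) = ls" for ls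
    by (simp add: single_word_def o_def)
  moreover have "mset (sorted_list_of_set X) = mset_set X" if "finite X" for X :: "nat set"
    using mset_set_set[OF distinct_sorted_list_of_set, of X] that by simp
  ultimately have *: "mset (map fst (base_word m A)) = mset_set (doubles m) + mset_set (doubles m) + mset_set (singles m)"
    by (simp add: base_word_def)
  show ?thesis
  proof (rule multiset_eqI)
    fix i show "count (mset (map fst (base_word m A))) i = count m i"
      using assms[of i] unfolding * by (simp add: count_mset_set') (auto simp: singles_def doubles_def)
  qed
qed

lemma base_word_lengths:
  assumes "A \<subseteq> singles m"
  shows "length (filter snd (base_word m A)) = card (doubles m) + card A"
    "length (filter (Not \<circ> snd) (base_word m A)) = card (doubles m) + card (singles m - A)"
proof -
  have d: "length (filter snd (double_word ds)) = length ds"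
    "length (filter (Not \<circ> snd) (double_word ds)) = length ds" for ds
    by (induction ds) (auto simp: double_word_def)
  have f: "length (filter P (sorted_list_of_set (singles m))) = card (singles m \<inter> Collect P)" for P
    by (subst distinct_length_filter) (auto simp: Int_commute)
  have "length (filter snd (single_word A (sorted_list_of_set (singles m)))) = card (singles m \<inter> A)"
    "length (filter (Not \<circ> snd) (single_word A (sorted_list_of_set (singles m)))) = card (singles m - A)"
    by (simp_all add: single_word_def filter_map o_def f) (simp_all add: set_diff_eq Int_def)
  moreover have "singles m \<inter> A = A" using assms by auto
  ultimately show "length (filter snd (base_word m A)) = card (doubles m) + card A"
    "length (filter (Not \<circ> snd) (base_word m A)) = card (doubles m) + card (singles m - A)"
    by (simp_all add: base_word_def d)
qed

lemma count_map_fst_distinct: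
  "distinct w \<Longrightarrow> count (mset (map fst w)) i = of_bool ((i, True) \<in> set w) + of_bool ((i, False) \<in> set w)"
proof (induction w)
  case (Cons x w)
  then show ?case by (cases x; cases "snd x") auto
qed simp

lemma distinct_word_is_base:
  assumes w: "distinct w" "mset (map fst w) = m"
  obtains A where "A \<subseteq> singles m" "mset w = mset (base_word m A)"
proof -
  let ?A = "{i \<in> singles m. (i, True) \<in> set w}"
  have c: "count m i = of_bool ((i, True) \<in> set w) + of_bool ((i, False) \<in> set w)" for i
    using count_map_fst_distinct[OF w(1)] w(2) by metis
  have mem: "(i, c) \<in> set w \<longleftrightarrow> (i, c) \<in> set (base_word m ?A)" for i c
    using c[of i] by (cases c) (auto simp: set_base_word singles_def doubles_def split: if_splits)
  have "set w = set (base_word m ?A)"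
  proof (rule Set.set_eqI)
    show "x \<in> set w \<longleftrightarrow> x \<in> set (base_word m ?A)" for x
      using mem[of "fst x" "snd x"] by simp
  qed
  then have "mset w = mset (base_word m ?A)"
    using w(1) distinct_base_word set_eq_iff_mset_eq_distinct by blast
  then show thesis using that[of ?A] by auto
qed

text \<open>
  The interchange turns \<open>A\<close> into its complement, and each \<open>b\<^sub>d
  c\<^sub>d\<close> into \<open>c\<^sub>d b\<^sub>d = - b\<^sub>d c\<^sub>d\<close>.
\<close>

lemma flip_base_word:
  fixes \<phi> :: "letter \<Rightarrow> 'a::comm_ring_1 odd_elem"
  shows "word_val (flip_point \<phi>) (base_word m A) =
    gconst ((- 1) ^ card (doubles m)) * word_val \<phi> (base_word m (singles m - A))"
proof -
  have d: "word_val (flip_point \<phi>) (double_word ds) = gconst ((- 1) ^ length ds) * word_val \<phi> (double_word ds)" for ds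
  proof (induction ds)
    case (Cons d ds)
    let ?b = "odd_val (\<phi> (d, True))" and ?g = "odd_val (\<phi> (d, False))"
    have "word_val (flip_point \<phi>) (double_word (d # ds)) = ?g * ?b * (gconst ((- 1) ^ length ds) * word_val \<phi> (double_word ds))"
      using Cons by (simp add: double_word_def flip_point_def mult.assoc)
    also have "\<dots> = - (gconst ((- 1) ^ length ds) * (?b * ?g * word_val \<phi> (double_word ds)))"
      by (simp only: odd_val_anticommute[of "\<phi> (d, False)"] mult.assoc[symmetric] gconst_commute mult_minus_left)
        (simp only: mult.assoc gconst_commute mult_minus_left mult_minus_right)
    finally show ?case by (simp add: double_word_def gconst_minus mult.assoc)
  qed (simp add: double_word_def gconst_1)
  have "word_val (flip_point \<phi>) (single_word A ls) = word_val \<phi> (single_word (singles m - A) ls)"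
    if "set ls \<subseteq> singles m" for ls
    using that by (induction ls) (auto simp: single_word_def flip_point_def)
  then show ?thesis by (simp add: base_word_def d mult.assoc)
qed

lemma base_val_eq:
  "base_val m A \<phi> = word_val \<phi> (base_word m A) +
    gconst ((- 1) ^ card (doubles m)) * word_val \<phi> (base_word m (singles m - A))"
  by (simp add: base_val_def sym_val_def flip_base_word)

lemma base_val_compl:
  assumes "A \<subseteq> singles m"
  shows "base_val m A = gf_scale ((- 1) ^ card (doubles m)) (base_val m (singles m - A))"
proof -
  have "singles m - (singles m - A) = A" using assms by auto
  then show ?thesis
    by (simp add: fun_eq_iff base_val_eq gf_scale_def distrib_left mult.assoc[symmetric]
        gconst_mult[symmetric] power_mult_distrib[symmetric] gconst_1)
qed

text \<open>
  The halves of the set of single indices up to complement: of two complementary halves, the one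
  containing the least index is taken. If there are no single indices, the empty set is the only
  half.
\<close>

definition halves :: "nat multiset \<Rightarrow> nat set set" where
  "halves m = {A. A \<subseteq> singles m \<and> 2 * card A = card (singles m) \<and> (singles m = {} \<or> Min (singles m) \<in> A)}"

lemma finite_halves: "finite (halves m)"
  by (rule finite_subset[of _ "Pow (singles m)"]) (auto simp: halves_def)

lemma sym_val_not_distinct:
  fixes w :: "letter list"
  assumes "(2 :: 'a::field) \<noteq> 0" "\<not> distinct w"
  shows "sym_val w = (0 :: (letter \<Rightarrow> 'a odd_elem) \<Rightarrow> _)"
  using assms by (simp add: fun_eq_iff sym_val_def word_val_not_distinct)

text \<open>
  Words with a repeated letter vanish. In the others the number of letters \<open>b\<close>
  equals the number of letters \<open>c\<close>, so that \<open>A\<close> is a half.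
\<close>

lemma array_val_in_base_span:
  assumes two: "(2 :: 'a::field) \<noteq> 0" and T: "array_content T = m"
  shows "(array_val T :: (letter \<Rightarrow> 'a odd_elem) \<Rightarrow> _) \<in> gf.span (base_val m ` halves m)"
proof -
  have "(sym_val w :: (letter \<Rightarrow> 'a odd_elem) \<Rightarrow> _) \<in> gf.span (base_val m ` halves m)"
    if w: "w \<in> set (expansions T)" for w
  proof (cases "distinct w")
    case False
    then show ?thesis using two gf.span_zero by (simp add: sym_val_not_distinct)
  next
    case True
    from distinct_word_is_base[OF this] obtain A where A: "A \<subseteq> singles m" "mset w = mset (base_word m A)"
      using expansions_content(1)[OF w] T by metis
    from sym_val_perm[OF A(2)] obtain e :: 'a where "sym_val w = gf_scale e (base_val m A)"
      unfolding base_val_def by metis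
    moreover have "(base_val m A :: (letter \<Rightarrow> 'a odd_elem) \<Rightarrow> _) \<in> gf.span (base_val m ` halves m)"
    proof -
      have "size (filter_mset P (mset (base_word m A))) = length (filter P w)" for P
        by (metis A(2) mset_filter size_mset)
      then have "length (filter P (base_word m A)) = length (filter P w)" for P
        by (metis mset_filter size_mset)
      then have "card A = card (singles m - A)"
        using base_word_lengths[OF A(1)] expansions_content(2,3)[OF w] by simp
      then have card: "2 * card A = card (singles m)"
        using A(1) by (simp add: card_Diff_subset finite_subset card_mono)
      show ?thesis
      proof (cases "A \<in> halves m")
        case False
        then have "singles m \<noteq> {}" "Min (singles m) \<notin> A" using A(1) card by (auto simp: halves_def)
        then have "Min (singles m) \<in> singles m - A" by simp
        moreover have "2 * card (singles m - A) = card (singles m)"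
          using A(1) card by (simp add: card_Diff_subset finite_subset)
        ultimately have "singles m - A \<in> halves m" by (simp add: halves_def)
        then show ?thesis
          by (subst base_val_compl[OF A(1)]) (intro gf.span_scale gf.span_base imageI)
      qed (intro gf.span_base imageI)
    qed
    ultimately show ?thesis by (simp add: gf.span_scale)
  qed
  then have "gf.span (sym_val ` set (expansions T)) \<subseteq> gf.span (base_val m ` halves m :: ((letter \<Rightarrow> 'a odd_elem) \<Rightarrow> _) set)"
    by (intro gf.span_minimal) auto
  then show ?thesis using array_val_sym[OF two, of T] by auto
qed

text \<open>
  The two types of letters are equally frequent in \<open>base_word m A\<close>, so the word can
  be reordered into pairs \<open>b\<^sub>p c\<^sub>r\<close>.
\<close>

lemma base_val_in_value_space:
  assumes two: "(2 :: 'a::field) \<noteq> 0" and m: "\<And>i. count m i \<le> 2" and A: "A \<in> halves m"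
  shows "(base_val m A :: (letter \<Rightarrow> 'a odd_elem) \<Rightarrow> _) \<in> value_space m"
proof -
  let ?w = "base_word m A"
  let ?ps = "map fst (filter snd ?w)" and ?rs = "map fst (filter (Not \<circ> snd) ?w)"
  have A': "A \<subseteq> singles m" "card A = card (singles m - A)"
    using A by (auto simp: halves_def card_Diff_subset finite_subset)
  have len: "length ?ps = length ?rs"
    using base_word_lengths[OF A'(1)] A'(2) by simp
  have "mset (pair_word (zip ps rs)) = mset (map (\<lambda>p. (p, True)) ps) + mset (map (\<lambda>r. (r, False)) rs)"
    if "length ps = length rs" for ps rs
    using that by (induction ps rs rule: list_induct2) (auto simp: pair_word_def)
  from this[OF len] have "mset (pair_word (zip ?ps ?rs)) =
      mset (map (\<lambda>x. (fst x, True)) (filter snd ?w)) + mset (map (\<lambda>x. (fst x, False)) (filter (Not \<circ> snd) ?w))"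
    by (simp add: o_def multiset.map_comp)
  also have "map (\<lambda>x. (fst x, True)) (filter snd ?w) = filter snd ?w"
    by (rule map_idI) auto
  also have "map (\<lambda>x. (fst x, False)) (filter (Not \<circ> snd) ?w) = filter (Not \<circ> snd) ?w"
    by (rule map_idI) auto
  also have "mset (filter snd ?w) + mset (filter (Not \<circ> snd) ?w) = mset ?w"
    by (simp add: o_def flip: mset_filter) (metis multiset_partition mset_filter)
  finally have "mset (pair_word (zip ?ps ?rs)) = mset ?w" .
  from sym_val_perm[OF this[symmetric]] obtain e :: 'a where e: "base_val m A = gf_scale e (sym_val (pair_word (zip ?ps ?rs)))"
    unfolding base_val_def by metis
  have "array_content (zip ?ps ?rs) = mset ?ps + mset ?rs"
    using len by (simp only: array_content_def map_fst_zip map_snd_zip)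
  also have "\<dots> = image_mset fst (mset ?w)"
    by (simp add: o_def) (metis image_mset_union multiset_partition)
  also have "\<dots> = m" using base_word_content[OF m] by simp
  finally have "(sym_val (pair_word (zip ?ps ?rs)) :: (letter \<Rightarrow> 'a odd_elem) \<Rightarrow> _) \<in> value_space m"
    using sym_pair_word[OF two, of "zip ?ps ?rs"] by simp
  then show ?thesis unfolding e value_space_def by (rule gf.span_scale)
qed

definition letter_index :: "letter \<Rightarrow> nat" where
  "letter_index x = 2 * fst x + of_bool (snd x)"

lemma inj_letter_index: "inj letter_index"
  by (rule injI) (auto simp: letter_index_def prod_eq_iff of_bool_def split: if_splits; presburger)

definition generic_point :: "letter \<Rightarrow> 'a::comm_ring_1 odd_elem" where
  "generic_point x = Odd_elem (gen (letter_index x))"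

lemma gcoeff_base_word_generic:
  obtains e :: "'a::comm_ring_1" where "e = 1 \<or> e = - 1"
    "\<And>A. gcoeff (word_val generic_point (base_word m B)) (letter_index ` set (base_word m A)) =
      (if singles m \<inter> A = singles m \<inter> B then e else 0)"
proof -
  have "odd_val (generic_point x) = (gen (letter_index x) :: 'a grassmann)" for x
    by (simp add: generic_point_def Odd_elem_inverse)
  then obtain e :: 'a where e: "e = 1 \<or> e = - 1"
    "\<And>C. gcoeff (word_val generic_point (base_word m B)) C = (if C = letter_index ` set (base_word m B) then e else 0)"
    using gcoeff_word_val_gen[OF distinct_base_word inj_on_subset[OF inj_letter_index subset_UNIV]] by metis
  have "letter_index ` set (base_word m A) = letter_index ` set (base_word m B) \<longleftrightarrow>
      set (base_word m A) = set (base_word m B)" for A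
    by (rule inj_image_eq_iff[OF inj_letter_index])
  moreover have "set (base_word m A) = set (base_word m B) \<longleftrightarrow> singles m \<inter> A = singles m \<inter> B" for A
  proof -
    have mem: "(i, True) \<in> set (base_word m A) \<longleftrightarrow> i \<in> A" if "i \<in> singles m" for i A
      using that by (auto simp: set_base_word singles_def doubles_def)
    show ?thesis
    proof
      assume "set (base_word m A) = set (base_word m B)"
      then have "i \<in> A \<longleftrightarrow> i \<in> B" if "i \<in> singles m" for i
        using mem[OF that, of A] mem[OF that, of B] by simp
      then show "singles m \<inter> A = singles m \<inter> B" by blast
    next
      assume "singles m \<inter> A = singles m \<inter> B"
      then have "i \<in> A \<longleftrightarrow> i \<in> B" if "i \<in> singles m" for i
        using that by blast
      then show "set (base_word m A) = set (base_word m B)"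
        unfolding set_base_word by (intro arg_cong2[where f = "(\<union>)"] refl image_cong) simp_all
    qed
  qed
  ultimately show thesis using that[OF e(1)] e(2) by simp
qed

text \<open>
  At the generic point the words are distinct basis monomials. The mirror image of
  \<open>B\<close> cannot interfere with \<open>A\<close>, because both contain the least single
  index; without single indices it is the same monomial with sign \<open>+ 1\<close>, and the
  coefficient \<open>2\<close> is invertible.
\<close>

lemma base_val_independent:
  assumes two: "(2 :: 'a::field) \<noteq> 0" and ok: "singles m \<noteq> {} \<or> even (card (doubles m))"
  shows "inj_on (base_val m :: nat set \<Rightarrow> (letter \<Rightarrow> 'a odd_elem) \<Rightarrow> _) (halves m)"
    "\<not> gf.dependent (base_val m ` halves m :: ((letter \<Rightarrow> 'a odd_elem) \<Rightarrow> _) set)"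
proof -
  let ?\<phi> = "generic_point :: letter \<Rightarrow> 'a odd_elem"
  let ?q = "(- 1) ^ card (doubles m) :: 'a"
  have key: "gcoeff (base_val m B ?\<phi>) (letter_index ` set (base_word m A)) = 0 \<longleftrightarrow> A \<noteq> B"
    if A: "A \<in> halves m" and B: "B \<in> halves m" for A B
  proof -
    have sub: "A \<subseteq> singles m" "B \<subseteq> singles m" using A B by (auto simp: halves_def)
    obtain e :: 'a where e: "e = 1 \<or> e = - 1"
      "gcoeff (word_val ?\<phi> (base_word m B)) (letter_index ` set (base_word m A)) = (if singles m \<inter> A = singles m \<inter> B then e else 0)"
      by (rule gcoeff_base_word_generic) blast
    obtain e' :: 'a where e': "e' = 1 \<or> e' = - 1"
      "gcoeff (word_val ?\<phi> (base_word m (singles m - B))) (letter_index ` set (base_word m A)) =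
        (if singles m \<inter> A = singles m \<inter> (singles m - B) then e' else 0)"
      by (rule gcoeff_base_word_generic) blast
    show ?thesis
    proof (cases "singles m = {}")
      case True
      then have "A = {}" "B = {}" using sub by auto
      moreover have "gcoeff (base_val m B ?\<phi>) (letter_index ` set (base_word m A)) = 2 * e"
        using ok True e(2) calculation by (simp add: base_val_eq gconst_1 plus_grassmann.rep_eq)
      ultimately show ?thesis using two e(1) by auto
    next
      case False
      then have "Min (singles m) \<in> A" "Min (singles m) \<in> B" using A B by (auto simp: halves_def)
      then have "singles m \<inter> A \<noteq> singles m \<inter> (singles m - B)" using sub by blast
      moreover have "singles m \<inter> A = singles m \<inter> B \<longleftrightarrow> A = B" using sub by blast
      ultimately have "gcoeff (base_val m B ?\<phi>) (letter_index ` set (base_word m A)) = (if A = B then e else 0)"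
        using e(2) e'(2) by (simp add: base_val_eq gcoeff_gconst_mult plus_grassmann.rep_eq)
      then show ?thesis using e(1) by auto
    qed
  qed
  have gsum: "gcoeff (\<Sum>B\<in>I. F B) C = (\<Sum>B\<in>I. gcoeff (F B) C)" for I :: "nat set set" and F :: "_ \<Rightarrow> 'a grassmann" and C
    by (induction I rule: infinite_finite_induct) (simp_all add: zero_grassmann.rep_eq plus_grassmann.rep_eq)
  have fsum: "(\<Sum>B\<in>I. F B) \<phi> = (\<Sum>B\<in>I. F B \<phi>)" for I :: "nat set set" and F :: "_ \<Rightarrow> (letter \<Rightarrow> 'a odd_elem) \<Rightarrow> 'a grassmann" and \<phi>
    by (induction I rule: infinite_finite_induct) simp_all
  have "\<forall>A\<in>halves m. c A = 0" if c: "(\<Sum>B\<in>halves m. gf_scale (c B) (base_val m B :: (letter \<Rightarrow> 'a odd_elem) \<Rightarrow> _)) = 0" for c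
  proof
    fix A assume A: "A \<in> halves m"
    let ?C = "letter_index ` set (base_word m A)"
    have "0 = gcoeff ((\<Sum>B\<in>halves m. gf_scale (c B) (base_val m B)) ?\<phi>) ?C"
      by (simp add: c zero_grassmann.rep_eq)
    also have "\<dots> = (\<Sum>B\<in>halves m. c B * gcoeff (base_val m B ?\<phi>) ?C)"
      by (simp add: fsum gsum gf_scale_def gcoeff_gconst_mult)
    also have "\<dots> = (\<Sum>B\<in>{A}. c B * gcoeff (base_val m B ?\<phi>) ?C)"
      using A key by (intro sum.mono_neutral_right finite_halves) auto
    finally show "c A = 0" using key[OF A A] by auto
  qed
  from gf_independent_family[OF finite_halves this]
  show "inj_on (base_val m :: nat set \<Rightarrow> (letter \<Rightarrow> 'a odd_elem) \<Rightarrow> _) (halves m)"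
    "\<not> gf.dependent (base_val m ` halves m :: ((letter \<Rightarrow> 'a odd_elem) \<Rightarrow> _) set)" by blast+
qed

lemma dim_value_space:
  assumes two: "(2 :: 'a::field) \<noteq> 0" and m: "\<And>i. count m i \<le> 2"
    and ok: "singles m \<noteq> {} \<or> even (card (doubles m))"
  shows "gf.dim (value_space m :: ((letter \<Rightarrow> 'a odd_elem) \<Rightarrow> _) set) = card (halves m)"
proof -
  have "value_space m \<subseteq> gf.span (base_val m ` halves m :: ((letter \<Rightarrow> 'a odd_elem) \<Rightarrow> _) set)"
    unfolding value_space_def using array_val_in_base_span[OF two] by (intro gf.span_minimal) auto
  moreover have "base_val m ` halves m \<subseteq> (value_space m :: ((letter \<Rightarrow> 'a odd_elem) \<Rightarrow> _) set)"
    using base_val_in_value_space[OF two m] by auto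
  ultimately show ?thesis
    using gf.basis_card_eq_dim[OF _ _ base_val_independent(2)[OF two ok], of "value_space m"]
      card_image[OF base_val_independent(1)[OF two ok]]
    by simp
qed

text \<open>
  A high degree forces a repeated letter. Without single indices, a word and its mirror image
  cancel if the number of double indices is odd.
\<close>

lemma value_space_trivial:
  assumes two: "(2 :: 'a::field) \<noteq> 0" and "(\<exists>i. count m i > 2) \<or> singles m = {} \<and> odd (card (doubles m))"
  shows "value_space m \<subseteq> {0 :: (letter \<Rightarrow> 'a odd_elem) \<Rightarrow> _}"
proof -
  have "array_val T = (0 :: (letter \<Rightarrow> 'a odd_elem) \<Rightarrow> _)" if T: "array_content T = m" for T
    using assms(2)
  proof
    assume "\<exists>i. count m i > 2"
    then obtain i where i: "count m i > 2" by blast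
    have "\<not> distinct w" if "w \<in> set (expansions T)" for w
      using count_map_fst_distinct[of w i] i expansions_content(1)[OF that] T by (auto simp: of_bool_def split: if_splits)
    then have "sym_val ` set (expansions T) \<subseteq> {0 :: (letter \<Rightarrow> 'a odd_elem) \<Rightarrow> _}"
      using two by (auto simp: sym_val_not_distinct)
    then have "gf.span (sym_val ` set (expansions T)) \<subseteq> {0 :: (letter \<Rightarrow> 'a odd_elem) \<Rightarrow> _}"
      by (intro gf.span_minimal gf.subspace_single_0)
    then show ?thesis using array_val_sym[OF two, of T] by auto
  next
    assume *: "singles m = {} \<and> odd (card (doubles m))"
    then have "base_val m A = (0 :: (letter \<Rightarrow> 'a odd_elem) \<Rightarrow> _)" if "A \<in> halves m" for A
      using that by (auto simp: fun_eq_iff base_val_eq halves_def gconst_minus gconst_1)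
    then have "base_val m ` halves m \<subseteq> {0 :: (letter \<Rightarrow> 'a odd_elem) \<Rightarrow> _}" by auto
    then have "gf.span (base_val m ` halves m) \<subseteq> {0 :: (letter \<Rightarrow> 'a odd_elem) \<Rightarrow> _}"
      by (intro gf.span_minimal gf.subspace_single_0)
    then show ?thesis using array_val_in_base_span[OF two T] by auto
  qed
  then show ?thesis unfolding value_space_def by (intro gf.span_minimal gf.subspace_single_0) auto
qed

text \<open>
  Removing the least index leaves the \<open>(s - 1)\<close>-subsets of a set with \<open>2 s -
  1\<close> elements.
\<close>

lemma card_halves:
  assumes "card (singles m) = 2 * s"
  shows "card (halves m) = (if s = 0 then 1 else (2 * s - 1) choose s)"
proof (cases "s = 0")
  case True
  then have "singles m = {}" using assms by simp
  then have "halves m = {{}}" by (auto simp: halves_def)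
  then show ?thesis using True by simp
next
  case False
  let ?x = "Min (singles m)" and ?L = "singles m - {Min (singles m)}"
  have ne: "singles m \<noteq> {}" using False assms by auto
  then have x: "?x \<in> singles m" by simp
  have "halves m = insert ?x ` {B. B \<subseteq> ?L \<and> card B = s - 1}"
  proof (intro equalityI subsetI)
    fix A assume "A \<in> halves m"
    then have A: "A \<subseteq> singles m" "card A = s" "?x \<in> A" using assms ne by (auto simp: halves_def)
    then have "A = insert ?x (A - {?x})" "A - {?x} \<subseteq> ?L" "card (A - {?x}) = s - 1"
      by (auto simp: finite_subset)
    then show "A \<in> insert ?x ` {B. B \<subseteq> ?L \<and> card B = s - 1}" by blast
  next
    fix A assume "A \<in> insert ?x ` {B. B \<subseteq> ?L \<and> card B = s - 1}"
    then obtain B where B: "A = insert ?x B" "B \<subseteq> ?L" "card B = s - 1" by auto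
    then have "finite B" "?x \<notin> B" by (auto intro: finite_subset)
    then have "card A = s" using B False by simp
    then show "A \<in> halves m" using B x assms by (auto simp: halves_def)
  qed
  moreover have "inj_on (insert ?x) {B. B \<subseteq> ?L \<and> card B = s - 1}"
    by (rule inj_onI) blast
  ultimately have "card (halves m) = card ?L choose (s - 1)"
    by (simp add: card_image n_subsets)
  also have "card ?L = 2 * s - 1" using x assms by simp
  also have "(2 * s - 1) choose (s - 1) = (2 * s - 1) choose s"
    using binomial_symmetric[of s "2 * s - 1"] False by (simp add: numeral_2_eq_2)
  finally show ?thesis using False by simp
qed

section \<open>Straightening\<close>

text \<open>
  The quantity that measures progress in straightening, and that orders the arrays in the proof
  of independence.
\<close>

definition weight :: "array \<Rightarrow> nat" where
  "weight T = (\<Sum>(a, b)\<leftarrow>T. a * b)"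

lemma weight_perm: "mset S = mset T \<Longrightarrow> weight S = weight T"
  unfolding weight_def by (metis mset_map sum_mset_sum_list)

lemma array_content_perm: "mset S = mset T \<Longrightarrow> array_content S = array_content T"
  unfolding array_content_def by (metis mset_map)

definition normal_array :: "array \<Rightarrow> bool" where
  "normal_array S \<longleftrightarrow> c_array S \<and> \<not> (\<exists>r s t. r < s \<and> s < t \<and> t < length S \<and>
           snd (S ! r) \<le> snd (S ! s) \<and> snd (S ! s) \<le> snd (S ! t))"

lemma lex_le_iff: "lex_le x y \<longleftrightarrow> x \<le> y"
  by (auto simp: lex_le_def less_eq_prod_def)

lemma c_array_iff: "c_array S \<longleftrightarrow> (\<forall>(a, b)\<in>set S. b < a) \<and> sorted S"
  by (simp add: c_array_def lex_le_iff sorted_iff_nth_Suc)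

text \<open>
  The pairing is skew in its indices and its values commute, so orienting and sorting the
  columns turns every product of pairings that has no factor \<open>pairing \<phi> i i =
  0\<close> into that of a c-array, up to sign and without changing the weight.
\<close>

lemma array_val_orient:
  obtains "array_val T = (0 :: (letter \<Rightarrow> 'a::field odd_elem) \<Rightarrow> _)"
  | S and e :: "'a::field" where "c_array S" "array_content S = array_content T" "weight S = weight T"
    "array_val T = gf_scale e (array_val S)"
proof (cases "\<exists>i. (i, i) \<in> set T")
  case True
  then obtain i where "(i, i) \<in> set T" by blast
  then have "array_val T \<phi> = (0 :: 'a grassmann)" for \<phi>
    by (induction T) (auto simp: pairing_self)
  then show thesis by (intro that(1)) (simp add: fun_eq_iff)
next
  case False
  \<comment> \<open>Orienting the columns; the sign is absorbed in a scalar.\<close>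
  define o' :: "nat \<times> nat \<Rightarrow> nat \<times> nat" where "o' = (\<lambda>(a, b). (max a b, min a b))"
  have "\<exists>e :: 'a. array_val T = gf_scale e (array_val (map o' T))"
  proof (induction T)
    case Nil
    then show ?case by (intro exI[of _ 1]) simp
  next
    case (Cons c T)
    then obtain e :: 'a where e: "array_val T = gf_scale e (array_val (map o' T))" by blast
    obtain d :: 'a where d: "pairing \<phi> (fst c) (snd c) = gconst d * pairing \<phi> (fst (o' c)) (snd (o' c))" for \<phi>
    proof (cases "snd c \<le> fst c")
      case True
      then show thesis using that[of 1] by (simp add: o'_def case_prod_beta gconst_1 max_absorb1 min_absorb2)
    next
      case False
      have "pairing \<phi> (fst c) (snd c) = - pairing \<phi> (snd c) (fst c)" for \<phi> :: "letter \<Rightarrow> 'a odd_elem"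
        by (rule pairing_flip)
      with False show thesis
        by (intro that[of "- 1"]) (simp add: o'_def case_prod_beta gconst_1 gconst_minus)
    qed
    have "array_val (c # T) = gf_scale (d * e) (array_val (map o' (c # T)))"
    proof
      fix \<phi> :: "letter \<Rightarrow> 'a odd_elem"
      have "array_val (c # T) \<phi> = gconst d * (pairing \<phi> (fst (o' c)) (snd (o' c)) * gconst e) * array_val (map o' T) \<phi>"
        by (simp add: e d gf_scale_def mult.assoc)
      then show "array_val (c # T) \<phi> = gf_scale (d * e) (array_val (map o' (c # T))) \<phi>"
        by (simp only: gconst_commute) (simp add: gf_scale_def gconst_mult mult.assoc)
    qed
    then show ?case by blast
  qed
  then obtain e :: 'a where e: "array_val T = gf_scale e (array_val (map o' T))" by blast
  let ?S = "sort (map o' T)"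
  have ms: "mset ?S = mset (map o' T)" by simp
  have "array_content (map o' T) = array_content T"
    by (induction T) (auto simp: array_content_def o'_def max_def min_def)
  moreover have "weight (map o' T) = weight T"
    by (induction T) (auto simp: weight_def o'_def max_def min_def)
  moreover have "c_array ?S"
    using False by (auto simp: c_array_iff o'_def max_def min_def) (metis le_less_linear le_neq_implies_less)
  ultimately show thesis
    using that(2)[of ?S e] e weight_perm[OF ms] array_content_perm[OF ms] by (simp add: array_val_perm[OF ms])
qed

text \<open>
  The rearrangement inequality for three terms, for each of the five nontrivial permutations and
  with the exact condition for strictness. In the nonstrict cases the permuted columns are a
  reordering of the original ones.
\<close>

lemma rearrangement_deficits:
  fixes a\<^sub>1 a\<^sub>2 a\<^sub>3 b\<^sub>1 b\<^sub>2 b\<^sub>3 :: nat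
  assumes a: "a\<^sub>1 \<le> a\<^sub>2" "a\<^sub>2 \<le> a\<^sub>3" "a\<^sub>1 < a\<^sub>3" and b: "b\<^sub>1 \<le> b\<^sub>2" "b\<^sub>2 \<le> b\<^sub>3" "b\<^sub>1 < b\<^sub>3"
  shows "a\<^sub>1 \<noteq> a\<^sub>2 \<and> b\<^sub>1 \<noteq> b\<^sub>2 \<Longrightarrow> a\<^sub>1 * b\<^sub>2 + a\<^sub>2 * b\<^sub>1 < a\<^sub>1 * b\<^sub>1 + a\<^sub>2 * b\<^sub>2"
    "a\<^sub>2 \<noteq> a\<^sub>3 \<and> b\<^sub>2 \<noteq> b\<^sub>3 \<Longrightarrow> a\<^sub>2 * b\<^sub>3 + a\<^sub>3 * b\<^sub>2 < a\<^sub>2 * b\<^sub>2 + a\<^sub>3 * b\<^sub>3"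
    "b\<^sub>1 \<noteq> b\<^sub>2 \<or> a\<^sub>2 \<noteq> a\<^sub>3 \<and> b\<^sub>2 \<noteq> b\<^sub>3 \<Longrightarrow> a\<^sub>1 * b\<^sub>2 + a\<^sub>2 * b\<^sub>3 + a\<^sub>3 * b\<^sub>1 < a\<^sub>1 * b\<^sub>1 + a\<^sub>2 * b\<^sub>2 + a\<^sub>3 * b\<^sub>3"
    "b\<^sub>2 \<noteq> b\<^sub>3 \<or> a\<^sub>1 \<noteq> a\<^sub>2 \<and> b\<^sub>1 \<noteq> b\<^sub>2 \<Longrightarrow> a\<^sub>1 * b\<^sub>3 + a\<^sub>2 * b\<^sub>1 + a\<^sub>3 * b\<^sub>2 < a\<^sub>1 * b\<^sub>1 + a\<^sub>2 * b\<^sub>2 + a\<^sub>3 * b\<^sub>3"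
    "a\<^sub>1 * b\<^sub>3 + a\<^sub>2 * b\<^sub>2 + a\<^sub>3 * b\<^sub>1 < a\<^sub>1 * b\<^sub>1 + a\<^sub>2 * b\<^sub>2 + a\<^sub>3 * b\<^sub>3"
proof -
  define p q u v where "p = a\<^sub>2 - a\<^sub>1" and "q = a\<^sub>3 - a\<^sub>2" and "u = b\<^sub>2 - b\<^sub>1" and "v = b\<^sub>3 - b\<^sub>2"
  then have eq: "a\<^sub>2 = a\<^sub>1 + p" "a\<^sub>3 = a\<^sub>1 + p + q" "b\<^sub>2 = b\<^sub>1 + u" "b\<^sub>3 = b\<^sub>1 + u + v"
    using a b by auto
  have pos: "0 < p + q" "0 < u + v" using a b by (auto simp: eq)
  show "a\<^sub>1 \<noteq> a\<^sub>2 \<and> b\<^sub>1 \<noteq> b\<^sub>2 \<Longrightarrow> a\<^sub>1 * b\<^sub>2 + a\<^sub>2 * b\<^sub>1 < a\<^sub>1 * b\<^sub>1 + a\<^sub>2 * b\<^sub>2"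
    "a\<^sub>2 \<noteq> a\<^sub>3 \<and> b\<^sub>2 \<noteq> b\<^sub>3 \<Longrightarrow> a\<^sub>2 * b\<^sub>3 + a\<^sub>3 * b\<^sub>2 < a\<^sub>2 * b\<^sub>2 + a\<^sub>3 * b\<^sub>3"
    "b\<^sub>1 \<noteq> b\<^sub>2 \<or> a\<^sub>2 \<noteq> a\<^sub>3 \<and> b\<^sub>2 \<noteq> b\<^sub>3 \<Longrightarrow> a\<^sub>1 * b\<^sub>2 + a\<^sub>2 * b\<^sub>3 + a\<^sub>3 * b\<^sub>1 < a\<^sub>1 * b\<^sub>1 + a\<^sub>2 * b\<^sub>2 + a\<^sub>3 * b\<^sub>3"
    "b\<^sub>2 \<noteq> b\<^sub>3 \<or> a\<^sub>1 \<noteq> a\<^sub>2 \<and> b\<^sub>1 \<noteq> b\<^sub>2 \<Longrightarrow> a\<^sub>1 * b\<^sub>3 + a\<^sub>2 * b\<^sub>1 + a\<^sub>3 * b\<^sub>2 < a\<^sub>1 * b\<^sub>1 + a\<^sub>2 * b\<^sub>2 + a\<^sub>3 * b\<^sub>3"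
    "a\<^sub>1 * b\<^sub>3 + a\<^sub>2 * b\<^sub>2 + a\<^sub>3 * b\<^sub>1 < a\<^sub>1 * b\<^sub>1 + a\<^sub>2 * b\<^sub>2 + a\<^sub>3 * b\<^sub>3"
    using pos by (auto simp: eq algebra_simps)
qed

text \<open>
  Each of the six terms of the vanishing permanent either has smaller weight or equals the term
  in question. The latter happens for one, two or four of them, depending on which neighbouring
  entries coincide, so only division by 2 is needed.
\<close>

lemma straighten_triple:
  fixes V :: "((letter \<Rightarrow> 'a::field odd_elem) \<Rightarrow> 'a grassmann) set"
  assumes two: "(2 :: 'a) \<noteq> 0" and V: "gf.subspace V"
    and a: "a\<^sub>1 \<le> a\<^sub>2" "a\<^sub>2 \<le> a\<^sub>3" "a\<^sub>1 < a\<^sub>3" and b: "b\<^sub>1 \<le> b\<^sub>2" "b\<^sub>2 \<le> b\<^sub>3" "b\<^sub>1 < b\<^sub>3"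
    and small: "\<And>S. array_content S = array_content ([(a\<^sub>1, b\<^sub>1), (a\<^sub>2, b\<^sub>2), (a\<^sub>3, b\<^sub>3)] @ R) \<Longrightarrow>
      weight S < weight ([(a\<^sub>1, b\<^sub>1), (a\<^sub>2, b\<^sub>2), (a\<^sub>3, b\<^sub>3)] @ R) \<Longrightarrow> array_val S \<in> V"
  shows "array_val ([(a\<^sub>1, b\<^sub>1), (a\<^sub>2, b\<^sub>2), (a\<^sub>3, b\<^sub>3)] @ R) \<in> V"
proof -
  define T :: "nat \<Rightarrow> nat \<Rightarrow> nat \<Rightarrow> (letter \<Rightarrow> 'a odd_elem) \<Rightarrow> 'a grassmann"
    where "T x y z = array_val ([(a\<^sub>1, x), (a\<^sub>2, y), (a\<^sub>3, z)] @ R)" for x y z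
  have perm: "T b\<^sub>1 b\<^sub>2 b\<^sub>3 + T b\<^sub>2 b\<^sub>1 b\<^sub>3 + T b\<^sub>1 b\<^sub>3 b\<^sub>2 + T b\<^sub>2 b\<^sub>3 b\<^sub>1 + T b\<^sub>3 b\<^sub>1 b\<^sub>2 + T b\<^sub>3 b\<^sub>2 b\<^sub>1 = 0"
  proof
    fix \<phi> :: "letter \<Rightarrow> 'a odd_elem"
    let ?a = "(\<lambda>_. a\<^sub>3)(0 := a\<^sub>1, 1 := a\<^sub>2)" and ?b = "(\<lambda>_. b\<^sub>3)(0 := b\<^sub>1, 1 := b\<^sub>2)"
    show "(T b\<^sub>1 b\<^sub>2 b\<^sub>3 + T b\<^sub>2 b\<^sub>1 b\<^sub>3 + T b\<^sub>1 b\<^sub>3 b\<^sub>2 + T b\<^sub>2 b\<^sub>3 b\<^sub>1 + T b\<^sub>3 b\<^sub>1 b\<^sub>2 + T b\<^sub>3 b\<^sub>2 b\<^sub>1) \<phi> = 0 \<phi>"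
      using arg_cong[OF pairing_permanent[of \<phi> ?a ?b], of "\<lambda>x. x * array_val R \<phi>"]
      by (simp add: T_def distrib_right mult.assoc)
  qed
  note defi = rearrangement_deficits[OF a b]
  have lt: "T x y z \<in> V" if "{#x, y, z#} = {#b\<^sub>1, b\<^sub>2, b\<^sub>3#}" "a\<^sub>1 * x + a\<^sub>2 * y + a\<^sub>3 * z < a\<^sub>1 * b\<^sub>1 + a\<^sub>2 * b\<^sub>2 + a\<^sub>3 * b\<^sub>3" for x y z
    unfolding T_def
  proof (rule small)
    have "array_content ([(a\<^sub>1, x), (a\<^sub>2, y), (a\<^sub>3, z)] @ R) = {#x, y, z#} + ({#a\<^sub>1, a\<^sub>2, a\<^sub>3#} + array_content R)" for x y z
      by (simp add: array_content_def)
    then show "array_content ([(a\<^sub>1, x), (a\<^sub>2, y), (a\<^sub>3, z)] @ R) = array_content ([(a\<^sub>1, b\<^sub>1), (a\<^sub>2, b\<^sub>2), (a\<^sub>3, b\<^sub>3)] @ R)"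
      by (simp only: that(1))
  qed (use that(2) in \<open>simp add: weight_def\<close>)
  have t12: "T x y z = T y x z" if "a\<^sub>1 = a\<^sub>2" for x y z
    unfolding T_def by (rule array_val_perm) (simp add: that)
  have t23: "T x y z = T x z y" if "a\<^sub>2 = a\<^sub>3" for x y z
    unfolding T_def by (rule array_val_perm) (simp add: that)
  let ?X = "T b\<^sub>1 b\<^sub>2 b\<^sub>3"
  have s12: "T b\<^sub>2 b\<^sub>1 b\<^sub>3 = ?X" if "a\<^sub>1 = a\<^sub>2 \<or> b\<^sub>1 = b\<^sub>2"
    using that t12 by auto
  have s23: "T b\<^sub>1 b\<^sub>3 b\<^sub>2 = ?X" if "a\<^sub>2 = a\<^sub>3 \<or> b\<^sub>2 = b\<^sub>3"
    using that t23 by auto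
  have c1: "T b\<^sub>2 b\<^sub>3 b\<^sub>1 = ?X" if "b\<^sub>1 = b\<^sub>2" "a\<^sub>2 = a\<^sub>3"
    using that t23[of b\<^sub>2 b\<^sub>3 b\<^sub>1] by simp
  have c2: "T b\<^sub>3 b\<^sub>1 b\<^sub>2 = ?X" if "b\<^sub>2 = b\<^sub>3" "a\<^sub>1 = a\<^sub>2"
    using that t12[of b\<^sub>2 b\<^sub>1 b\<^sub>2] by simp
  have V12: "T b\<^sub>2 b\<^sub>1 b\<^sub>3 \<in> V" if "\<not> (a\<^sub>1 = a\<^sub>2 \<or> b\<^sub>1 = b\<^sub>2)"
    using that defi(1) by (intro lt) auto
  have V23: "T b\<^sub>1 b\<^sub>3 b\<^sub>2 \<in> V" if "\<not> (a\<^sub>2 = a\<^sub>3 \<or> b\<^sub>2 = b\<^sub>3)"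
    using that defi(2) by (intro lt) auto
  have Vc1: "T b\<^sub>2 b\<^sub>3 b\<^sub>1 \<in> V" if "\<not> (b\<^sub>1 = b\<^sub>2 \<and> a\<^sub>2 = a\<^sub>3)"
    using that defi(3) b(3) by (intro lt) auto
  have Vc2: "T b\<^sub>3 b\<^sub>1 b\<^sub>2 \<in> V" if "\<not> (b\<^sub>2 = b\<^sub>3 \<and> a\<^sub>1 = a\<^sub>2)"
    using that defi(4) b(3) by (intro lt) auto
  have V13: "T b\<^sub>3 b\<^sub>2 b\<^sub>1 \<in> V"
    using defi(5) by (intro lt) auto
  have neg: "F \<in> V" if "F + G = 0" "G \<in> V" for F G
    using that gf.subspace_neg[OF V] by (metis eq_neg_iff_add_eq_0)
  have halve: "F \<in> V" if "F + F \<in> V" for F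
  proof -
    have "gf_scale (1 / 2) (F + F) = F"
      using two by (simp add: gf.scale_right_distrib flip: gf.scale_left_distrib)
    then show ?thesis using gf.subspace_scale[OF V that, of "1 / 2"] by simp
  qed
  note add = gf.subspace_add[OF V]
  consider (one) "\<not> (a\<^sub>1 = a\<^sub>2 \<or> b\<^sub>1 = b\<^sub>2)" "\<not> (a\<^sub>2 = a\<^sub>3 \<or> b\<^sub>2 = b\<^sub>3)"
    | (left) "a\<^sub>1 = a\<^sub>2 \<or> b\<^sub>1 = b\<^sub>2" "\<not> (a\<^sub>2 = a\<^sub>3 \<or> b\<^sub>2 = b\<^sub>3)"
    | (right) "\<not> (a\<^sub>1 = a\<^sub>2 \<or> b\<^sub>1 = b\<^sub>2)" "a\<^sub>2 = a\<^sub>3 \<or> b\<^sub>2 = b\<^sub>3"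
    | (both1) "b\<^sub>1 = b\<^sub>2" "a\<^sub>2 = a\<^sub>3" "b\<^sub>2 \<noteq> b\<^sub>3"
    | (both2) "b\<^sub>2 = b\<^sub>3" "a\<^sub>1 = a\<^sub>2" "b\<^sub>1 \<noteq> b\<^sub>2"
    using a(3) b(3) by auto
  then have "?X \<in> V"
  proof cases
    case one
    then show ?thesis
      by (intro neg[OF perm[unfolded add.assoc]] add V12 V23 Vc1 Vc2 V13) auto
  next
    case left
    have "(?X + ?X) + (T b\<^sub>1 b\<^sub>3 b\<^sub>2 + T b\<^sub>2 b\<^sub>3 b\<^sub>1 + T b\<^sub>3 b\<^sub>1 b\<^sub>2 + T b\<^sub>3 b\<^sub>2 b\<^sub>1) = 0"
      using perm unfolding s12[OF left(1)] by (simp only: add.assoc)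
    then have "?X + ?X \<in> V"
      by (rule neg) (use left(2) in \<open>intro add V23 Vc1 Vc2 V13; auto\<close>)
    then show ?thesis by (rule halve)
  next
    case right
    have "(?X + ?X) + (T b\<^sub>2 b\<^sub>1 b\<^sub>3 + T b\<^sub>2 b\<^sub>3 b\<^sub>1 + T b\<^sub>3 b\<^sub>1 b\<^sub>2 + T b\<^sub>3 b\<^sub>2 b\<^sub>1) = 0"
      using perm unfolding s23[OF right(2)] by (simp only: add.assoc add.left_commute)
    then have "?X + ?X \<in> V"
      by (rule neg) (use right(1) in \<open>intro add V12 Vc1 Vc2 V13; auto\<close>)
    then show ?thesis by (rule halve)
  next
    case both1
    then have s: "a\<^sub>1 = a\<^sub>2 \<or> b\<^sub>1 = b\<^sub>2" "a\<^sub>2 = a\<^sub>3 \<or> b\<^sub>2 = b\<^sub>3" by auto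
    have "((?X + ?X) + (?X + ?X)) + (T b\<^sub>3 b\<^sub>1 b\<^sub>2 + T b\<^sub>3 b\<^sub>2 b\<^sub>1) = 0"
      using perm unfolding s12[OF s(1)] s23[OF s(2)] c1[OF both1(1,2)] by (simp only: add.assoc)
    then have "(?X + ?X) + (?X + ?X) \<in> V"
      by (rule neg) (use both1(3) in \<open>intro add Vc2 V13; auto\<close>)
    then show ?thesis by (rule halve[OF halve])
  next
    case both2
    then have s: "a\<^sub>1 = a\<^sub>2 \<or> b\<^sub>1 = b\<^sub>2" "a\<^sub>2 = a\<^sub>3 \<or> b\<^sub>2 = b\<^sub>3" by auto
    have "((?X + ?X) + (?X + ?X)) + (T b\<^sub>2 b\<^sub>3 b\<^sub>1 + T b\<^sub>3 b\<^sub>2 b\<^sub>1) = 0"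
      using perm unfolding s12[OF s(1)] s23[OF s(2)] c2[OF both2(1,2)] by (simp only: add.assoc add.left_commute)
    then have "(?X + ?X) + (?X + ?X) \<in> V"
      by (rule neg) (use both2(3) in \<open>intro add Vc1 V13; auto\<close>)
    then show ?thesis by (rule halve[OF halve])
  qed
  then show ?thesis by (simp only: T_def)
qed

text \<open>
  No index has degree above 2, so the entries of three columns violating normality are not all
  equal within a row, as \<open>straighten_triple\<close> requires.
\<close>

lemma straightening:
  assumes two: "(2 :: 'a::field) \<noteq> 0" and m: "\<And>i. count m i \<le> 2" and T: "array_content T = m"
  shows "(array_val T :: (letter \<Rightarrow> 'a odd_elem) \<Rightarrow> _) \<in> gf.span (array_val ` {S. normal_array S \<and> array_content S = m})"
    (is "_ \<in> ?V")
  using T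
proof (induction "weight T" arbitrary: T rule: less_induct)
  case less
  consider "array_val T = (0 :: (letter \<Rightarrow> 'a odd_elem) \<Rightarrow> _)"
    | S and e :: 'a where "c_array S" "array_content S = array_content T" "weight S = weight T"
      "array_val T = gf_scale e (array_val S)"
    by (rule array_val_orient)
  then show ?case
  proof cases
    case 1
    then show ?thesis by (simp add: gf.span_zero)
  next
    case (2 S e)
    have "array_val S \<in> ?V"
    proof (cases "normal_array S")
      case True
      then show ?thesis using 2 less.prems by (intro gf.span_base) auto
    next
      case False
      then obtain r s t where rst: "r < s" "s < t" "t < length S"
        "snd (S ! r) \<le> snd (S ! s)" "snd (S ! s) \<le> snd (S ! t)"
        using 2(1) by (auto simp: normal_array_def)
      have srt: "sorted S" using 2(1) by (simp add: c_array_iff)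
      have "S ! r \<le> S ! s" "S ! s \<le> S ! t"
        using sorted_nth_mono[OF srt] rst by auto
      then have a: "fst (S ! r) \<le> fst (S ! s)" "fst (S ! s) \<le> fst (S ! t)"
        by (auto simp: less_eq_prod_def)
      have "mset_set {r, s, t} \<subseteq># mset_set {..<length S}"
        using rst by (intro subset_imp_msubset_mset_set) auto
      then have "image_mset ((!) S) (mset_set {r, s, t}) \<subseteq># image_mset ((!) S) (mset_set {..<length S})"
        by (rule image_mset_subseteq_mono)
      moreover have "image_mset ((!) S) (mset_set {..<length S}) = mset S"
        by (metis atLeast_upt map_nth mset_map mset_upt lessThan_atLeast0)
      ultimately obtain M where "mset S = {#S ! r, S ! s, S ! t#} + M"
        using rst by (auto simp: subset_mset.le_iff_add)
      moreover obtain R where "mset R = M" using ex_mset by blast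
      ultimately have R: "mset S = mset ([S ! r, S ! s, S ! t] @ R)" by simp
      let ?S = "[(fst (S ! r), snd (S ! r)), (fst (S ! s), snd (S ! s)), (fst (S ! t), snd (S ! t))] @ R"
      have content: "array_content ?S = m" and wt: "weight ?S = weight T"
        using array_content_perm[OF R] weight_perm[OF R] 2 less.prems by simp_all
      have "fst (S ! r) < fst (S ! t)"
      proof (rule ccontr)
        assume "\<not> ?thesis"
        then have "fst (S ! r) = fst (S ! s)" "fst (S ! t) = fst (S ! s)" using a by auto
        then show False using m[of "fst (S ! s)"] unfolding content[symmetric] by (auto simp: array_content_def split: if_splits)
      qed
      moreover have "snd (S ! r) < snd (S ! t)"
      proof (rule ccontr)
        assume "\<not> ?thesis"
        then have "snd (S ! r) = snd (S ! s)" "snd (S ! t) = snd (S ! s)" using rst by auto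
        then show False using m[of "snd (S ! s)"] unfolding content[symmetric] by (auto simp: array_content_def split: if_splits)
      qed
      moreover have "array_val S' \<in> ?V" if "array_content S' = array_content ?S" "weight S' < weight ?S" for S'
        by (rule less.hyps) (use that content wt in simp_all)
      ultimately have "array_val ?S \<in> ?V"
        using a rst(4,5) by (intro straighten_triple[OF two gf.subspace_span])
      then show ?thesis by (simp add: array_val_perm[OF R])
    qed
    then show ?thesis unfolding 2(4) by (rule gf.span_scale)
  qed
qed

section \<open>Independence of the normal arrays\<close>

text \<open>
  The divisions of a list into two complementary sublists. A product of binomials expands along
  them: the first sublist collects the factors that contribute their first term.
\<close>

fun splits :: "'c list \<Rightarrow> ('c list \<times> 'c list) list" where
  "splits [] = [([], [])]"
| "splits (c # cs) = map (\<lambda>(x, y). (c # x, y)) (splits cs) @ map (\<lambda>(x, y). (x, c # y)) (splits cs)"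

lemma prod_list_splits:
  fixes p r :: "'c \<Rightarrow> 'a::comm_ring_1 grassmann"
  assumes "\<And>c. p c \<in> even_part" "\<And>c. r c \<in> even_part"
  shows "prod_list (map (\<lambda>c. p c + r c) T) = (\<Sum>(x, y)\<leftarrow>splits T. prod_list (map p x) * prod_list (map r y))"
proof (induction T)
  case (Cons c T)
  have swap: "r c * (P * Q) = P * (r c * Q)" for P Q
    using even_commute[OF assms(2), of P c] by (simp flip: mult.assoc)
  have "prod_list (map (\<lambda>c. p c + r c) (c # T)) =
      p c * (\<Sum>(x, y)\<leftarrow>splits T. prod_list (map p x) * prod_list (map r y)) +
      r c * (\<Sum>(x, y)\<leftarrow>splits T. prod_list (map p x) * prod_list (map r y))"
    by (simp add: Cons distrib_right)
  also have "\<dots> = (\<Sum>(x, y)\<leftarrow>splits (c # T). prod_list (map p x) * prod_list (map r y))"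
    by (simp add: o_def case_prod_beta swap mult.assoc flip: sum_list_const_mult)
  finally show ?case .
qed simp

lemma splits_mset: "(x, y) \<in> set (splits T) \<Longrightarrow> mset T = mset x + mset y"
  by (induction T arbitrary: x y) auto

lemma splits_sorted_wrt:
  "(x, y) \<in> set (splits T) \<Longrightarrow> sorted_wrt P T \<Longrightarrow> sorted_wrt P x \<and> sorted_wrt P y"
proof (induction T arbitrary: x y)
  case (Cons c T)
  have sub: "set x' \<subseteq> set T \<and> set y' \<subseteq> set T" if "(x', y') \<in> set (splits T)" for x' y'
    using arg_cong[OF splits_mset[OF that], of set_mset] by auto
  show ?case using Cons sub by fastforce
qed simp

text \<open>
  Only the common elements of \<open>X\<close> and \<open>Y\<close> leave a choice: they occur
  twice in \<open>T\<close>, and either occurrence may go to \<open>X\<close>. What matters is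
  that the number is a power of 2, hence nonzero in the field whenever 2 is.
\<close>

lemma card_splits:
  assumes "mset T = X + Y" "\<And>c. count X c \<le> 1" "\<And>c. count Y c \<le> 1"
  shows "length (filter (\<lambda>(x, y). mset x = X \<and> mset y = Y) (splits T)) = 2 ^ size (X \<inter># Y)"
  using assms
proof (induction T arbitrary: X Y)
  case Nil
  then show ?case by auto
next
  case (Cons c T)
  let ?N = "\<lambda>X Y. length (filter (\<lambda>(x, y). mset x = X \<and> mset y = Y) (splits T))"
  have eq: "add_mset c M = X \<longleftrightarrow> c \<in># X \<and> M = X - {#c#}" for M X :: "'a multiset"
    by auto
  have N: "length (filter (\<lambda>(x, y). mset x = X \<and> mset y = Y) (splits (c # T))) =
      (if c \<in># X then ?N (X - {#c#}) Y else 0) + (if c \<in># Y then ?N X (Y - {#c#}) else 0)"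
    by (simp add: filter_map o_def case_prod_beta' eq)
  have X: "?N (X - {#c#}) Y = 2 ^ size ((X - {#c#}) \<inter># Y)" if "c \<in># X"
  proof (rule Cons.IH)
    show "mset T = X - {#c#} + Y" using Cons.prems(1) that by (auto dest!: multi_member_split)
    show "count (X - {#c#}) d \<le> 1" for d using Cons.prems(2)[of d] by (simp add: le_diff_conv)
  qed (rule Cons.prems(3))
  have Y: "?N X (Y - {#c#}) = 2 ^ size (X \<inter># (Y - {#c#}))" if "c \<in># Y"
  proof (rule Cons.IH)
    show "mset T = X + (Y - {#c#})" using Cons.prems(1) that by (auto dest!: multi_member_split)
    show "count (Y - {#c#}) d \<le> 1" for d using Cons.prems(3)[of d] by (simp add: le_diff_conv)
  qed (rule Cons.prems(2))
  have "c \<in># X \<or> c \<in># Y" using arg_cong[OF Cons.prems(1), of "\<lambda>M. c \<in># M"] by simp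
  moreover have rest: "c \<notin># M" if "Z = add_mset c M" "count Z c \<le> 1" for M Z
    using that by (simp add: not_in_iff)
  ultimately consider (both) X' Y' where "X = add_mset c X'" "Y = add_mset c Y'" "c \<notin># X'" "c \<notin># Y'"
    | (left) X' where "X = add_mset c X'" "c \<notin># Y" | (right) Y' where "Y = add_mset c Y'" "c \<notin># X"
    using Cons.prems(2,3)[of c] by (metis multi_member_split)
  then show ?case
  proof cases
    case both
    then show ?thesis unfolding N using X Y by (simp add: inter_add_left1 inter_add_left2 inter_add_right1)
  next
    case left
    then show ?thesis unfolding N using X by (simp add: inter_add_left1)
  next
    case right
    then show ?thesis unfolding N using Y by (simp add: inter_add_right1)
  qed
qed

text \<open>
  The intervals \<open>[b, a]\<close> are nested, each inside all later ones.
\<close>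

definition nested :: "array \<Rightarrow> bool" where
  "nested x \<longleftrightarrow> sorted_wrt (\<lambda>c d. fst c < fst d \<and> snd d < snd c) x \<and> (\<forall>c\<in>set x. snd c < fst c)"

text \<open>
  The greedy division: a column goes to the first family if its lower entry is a strict minimum
  so far, and to the second family otherwise. Here \<open>m\<close> and \<open>v\<close> are the
  last lower entries already put into the two families. A failure of the second family to
  decrease would give two columns with weakly increasing lower entries above an earlier minimum,
  that is, a forbidden triple.
\<close>

lemma decreasing_splits:
  assumes "\<forall>r s t. r < s \<longrightarrow> s < t \<longrightarrow> t < length S \<longrightarrow> \<not> (snd (S ! r) \<le> snd (S ! s) \<and> snd (S ! s) \<le> snd (S ! t))"
    and "\<forall>r s. r < s \<longrightarrow> s < length S \<longrightarrow> \<not> (m \<le> snd (S ! r) \<and> snd (S ! r) \<le> snd (S ! s))"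
    and "\<forall>c\<in>set S. m \<le> snd c \<longrightarrow> snd c < v" and "m \<le> v"
  shows "\<exists>(x, y)\<in>set (splits S). sorted_wrt (\<lambda>c d. snd d < snd c) x \<and> sorted_wrt (\<lambda>c d. snd d < snd c) y
    \<and> (\<forall>c\<in>set x. snd c < (m :: nat)) \<and> (\<forall>c\<in>set y. snd c < v)"
  using assms
proof (induction S arbitrary: m v)
  case (Cons c S)
  have tri: "\<forall>r s t. r < s \<longrightarrow> s < t \<longrightarrow> t < length S \<longrightarrow> \<not> (snd (S ! r) \<le> snd (S ! s) \<and> snd (S ! s) \<le> snd (S ! t))"
  proof (intro allI impI)
    fix r s t assume "r < s" "s < t" "t < length S"
    then show "\<not> (snd (S ! r) \<le> snd (S ! s) \<and> snd (S ! s) \<le> snd (S ! t))"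
      using Cons.prems(1)[rule_format, of "Suc r" "Suc s" "Suc t"] by simp
  qed
  show ?case
  proof (cases "snd c < m")
    case True
    have "\<forall>r s. r < s \<longrightarrow> s < length S \<longrightarrow> \<not> (snd c \<le> snd (S ! r) \<and> snd (S ! r) \<le> snd (S ! s))"
    proof (intro allI impI)
      fix r s assume "r < s" "s < length S"
      then show "\<not> (snd c \<le> snd (S ! r) \<and> snd (S ! r) \<le> snd (S ! s))"
        using Cons.prems(1)[rule_format, of 0 "Suc r" "Suc s"] by simp
    qed
    moreover have "\<forall>d\<in>set S. snd c \<le> snd d \<longrightarrow> snd d < v"
      using Cons.prems(3,4) by fastforce
    ultimately obtain x y where xy: "(x, y) \<in> set (splits S)" "sorted_wrt (\<lambda>c d. snd d < snd c) x"
      "sorted_wrt (\<lambda>c d. snd d < snd c) y" "\<forall>d\<in>set x. snd d < snd c" "\<forall>d\<in>set y. snd d < v"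
      using Cons.IH[OF tri, of "snd c" v] True Cons.prems(4) by auto
    then show ?thesis using True
      by (intro bexI[of _ "(c # x, y)"]) auto
  next
    case False
    have "\<forall>r s. r < s \<longrightarrow> s < length S \<longrightarrow> \<not> (m \<le> snd (S ! r) \<and> snd (S ! r) \<le> snd (S ! s))"
    proof (intro allI impI)
      fix r s assume "r < s" "s < length S"
      then show "\<not> (m \<le> snd (S ! r) \<and> snd (S ! r) \<le> snd (S ! s))"
        using Cons.prems(2)[rule_format, of "Suc r" "Suc s"] by simp
    qed
    moreover have "\<forall>d\<in>set S. m \<le> snd d \<longrightarrow> snd d < snd c"
    proof (intro ballI impI)
      fix d assume "d \<in> set S" "m \<le> snd d"
      then obtain s where "s < length S" "d = S ! s" by (auto simp: in_set_conv_nth)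
      then show "snd d < snd c"
        using Cons.prems(2)[rule_format, of 0 "Suc s"] False by simp
    qed
    ultimately obtain x y where xy: "(x, y) \<in> set (splits S)" "sorted_wrt (\<lambda>c d. snd d < snd c) x"
      "sorted_wrt (\<lambda>c d. snd d < snd c) y" "\<forall>d\<in>set x. snd d < m" "\<forall>d\<in>set y. snd d < snd c"
      using Cons.IH[OF tri, of m "snd c"] False by auto
    moreover have "snd c < v" using False Cons.prems(3) by simp
    ultimately show ?thesis
      by (intro bexI[of _ "(x, c # y)"]) auto
  qed
qed simp

lemma normal_splits_nested:
  assumes "normal_array S"
  obtains x y where "(x, y) \<in> set (splits S)" "nested x" "nested y"
proof -
  \<comment> \<open>A bound above all lower entries: both families are still empty.\<close>
  let ?v = "Suc (Max (insert 0 (snd ` set S)))"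
  have v: "snd c < ?v" if "c \<in> set S" for c
    using that by (simp add: le_imp_less_Suc)
  have "\<exists>(x, y)\<in>set (splits S). sorted_wrt (\<lambda>c d. snd d < snd c) x \<and> sorted_wrt (\<lambda>c d. snd d < snd c) y
    \<and> (\<forall>c\<in>set x. snd c < ?v) \<and> (\<forall>c\<in>set y. snd c < ?v)"
  proof (rule decreasing_splits)
    show "\<forall>r s. r < s \<longrightarrow> s < length S \<longrightarrow> \<not> (?v \<le> snd (S ! r) \<and> snd (S ! r) \<le> snd (S ! s))"
      using v by (metis less_trans not_less nth_mem)
  qed (use assms v in \<open>auto simp: normal_array_def\<close>)
  then obtain x y where xy: "(x, y) \<in> set (splits S)"
    "sorted_wrt (\<lambda>c d. snd d < snd c) x" "sorted_wrt (\<lambda>c d. snd d < snd c) y" by blast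
  have S: "sorted_wrt (\<le>) S" "\<forall>c\<in>set S. snd c < fst c"
    using assms by (auto simp: normal_array_def c_array_iff)
  have "nested z" if z: "sorted_wrt (\<lambda>c d. snd d < snd c) z" "sorted_wrt (\<le>) z" "set z \<subseteq> set S" for z
  proof -
    have "sorted_wrt (\<lambda>c d. fst c < fst d \<and> snd d < snd c) z"
      using z(1,2) by (induction z) (fastforce simp: less_eq_prod_def)+
    then show ?thesis using S(2) z(3) by (auto simp: nested_def)
  qed
  moreover have "set x \<subseteq> set S" "set y \<subseteq> set S"
    using arg_cong[OF splits_mset[OF xy(1)], of set_mset] by auto
  ultimately show thesis
    using that[OF xy(1)] splits_sorted_wrt[OF xy(1) S(1)] xy(2,3) by blast
qed

lemma nested_snoc:
  "nested (x @ [(p, q)]) \<longleftrightarrow> nested x \<and> q < p \<and> (\<forall>z\<in>#array_content x. q < z \<and> z < p)"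
proof -
  have "nested x \<Longrightarrow> q < p \<Longrightarrow> (\<forall>c\<in>set x. fst c < p \<and> q < snd c) \<longleftrightarrow> (\<forall>z\<in>#array_content x. q < z \<and> z < p)"
    by (force simp: array_content_def nested_def)
  then show ?thesis by (auto simp: nested_def sorted_wrt_append)
qed

lemma array_content_append [simp]: "array_content (x @ y) = array_content x + array_content y"
  by (simp add: array_content_def)

lemma nested_content_le_1: "nested x \<Longrightarrow> count (array_content x) z \<le> 1"
proof (induction x rule: rev_induct)
  case (snoc c x)
  obtain p q where c: "c = (p, q)" by force
  have "z \<notin># array_content x" if "z = p \<or> z = q"
    using snoc.prems that unfolding c nested_snoc by auto
  moreover have "q < p" using snoc.prems unfolding c nested_snoc by simp
  ultimately show ?case using snoc unfolding c nested_snoc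
    by (auto simp: array_content_def not_in_iff)
qed (simp add: array_content_def)

text \<open>
  Content and weight of an array do not depend on the order of its columns; the exchange
  argument below works with multisets of columns.
\<close>

definition mcontent :: "(nat \<times> nat) multiset \<Rightarrow> nat multiset" where
  "mcontent M = image_mset fst M + image_mset snd M"

definition mweight :: "(nat \<times> nat) multiset \<Rightarrow> nat" where
  "mweight M = (\<Sum>(a, b)\<in>#M. a * b)"

text \<open>
  Exchange argument. The nested matching joins the greatest letter \<open>p\<close> with the
  least letter \<open>q\<close>. If \<open>M\<close> joins them with \<open>c\<close> and
  \<open>d\<close> instead, then replacing the pairs \<open>(p, c)\<close>, \<open>(d,
  q)\<close> by \<open>(p, q)\<close> and the pair of \<open>c\<close> and \<open>d\<close>
  lowers the weight by \<open>(p - d) (c - q) > 0\<close>.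
\<close>

lemma nested_minimal:
  assumes "nested x" "mcontent M = array_content x" "\<forall>(a, b)\<in>#M. b < a"
  shows "M = mset x \<or> weight x < mweight M"
  using assms
proof (induction x arbitrary: M rule: rev_induct)
  case Nil
  then show ?case by (simp add: mcontent_def array_content_def)
next
  case (snoc pq x)
  obtain p q where pq: "pq = (p, q)" by force
  have x: "nested x" "q < p" "\<And>z. z \<in># array_content x \<Longrightarrow> q < z \<and> z < p"
    using snoc.prems(1) unfolding pq nested_snoc by auto
  have content: "mcontent M = array_content x + {#p, q#}"
    using snoc.prems(2) by (simp add: pq array_content_def)
  have bounds: "q \<le> z \<and> z \<le> p" if "z \<in># mcontent M" for z
    using that x(2,3) unfolding content by (auto dest: less_imp_le)
  have pair: "q \<le> b \<and> b < a \<and> a \<le> p" if "(a, b) \<in># M" for a b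
  proof -
    have "a \<in># mcontent M" "b \<in># mcontent M" using that by (force simp: mcontent_def)+
    then show ?thesis using bounds snoc.prems(3) that by auto
  qed
  have wt: "weight (x @ [pq]) = weight x + p * q" by (simp add: weight_def pq)
  have "p \<in># mcontent M" by (simp add: content)
  then obtain c where c: "(p, c) \<in># M"
    using pair by (fastforce simp: mcontent_def)
  then obtain M\<^sub>1 where M1: "M = add_mset (p, c) M\<^sub>1" by (auto dest: multi_member_split)
  have content1: "add_mset c (mcontent M\<^sub>1) = add_mset q (array_content x)"
    using content by (simp add: M1 mcontent_def add_mset_commute)
  show ?case
  proof (cases "c = q")
    case True
    then have "M\<^sub>1 = mset x \<or> weight x < mweight M\<^sub>1"
      using content1 snoc.prems(3) by (intro snoc.IH[OF x(1)]) (auto simp: M1)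
    then show ?thesis using True by (auto simp: M1 pq wt[unfolded pq] mweight_def)
  next
    case False
    have "q \<in># mcontent M\<^sub>1" using False arg_cong[OF content1, of "\<lambda>N. q \<in># N"] by simp
    then obtain d where d: "(d, q) \<in># M\<^sub>1"
      using pair by (fastforce simp: mcontent_def M1)
    then obtain M\<^sub>2 where M2: "M\<^sub>1 = add_mset (d, q) M\<^sub>2" by (auto dest: multi_member_split)
    have content2: "add_mset c (add_mset d (mcontent M\<^sub>2)) = array_content x"
      using content1 by (simp add: M2 mcontent_def add_mset_commute)
    \<comment> \<open>A letter of a nested array occurs only once, so \<open>c\<close> and \<open>d\<close> form a legitimate column.\<close>
    have "c \<noteq> d"
      using nested_content_le_1[OF x(1), of c] unfolding content2[symmetric] by auto
    have cd: "q < c" "d < p"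
      using x(3)[of c] x(3)[of d] unfolding content2[symmetric] by auto
    let ?M = "add_mset (max c d, min c d) M\<^sub>2"
    have "mcontent ?M = array_content x"
      unfolding content2[symmetric] by (simp add: mcontent_def max_def min_def add_mset_commute)
    moreover have "\<forall>(a, b)\<in>#?M. b < a"
      using snoc.prems(3) \<open>c \<noteq> d\<close> by (auto simp: M1 M2 max_def min_def)
    ultimately have "?M = mset x \<or> weight x < mweight ?M" by (rule snoc.IH[OF x(1)])
    moreover have "mweight (mset x) = weight x"
      unfolding weight_def mweight_def by (metis mset_map sum_mset_sum_list)
    ultimately have "weight x \<le> mweight ?M" by (metis less_imp_le order_refl)
    also have "mweight ?M = c * d + mweight M\<^sub>2"
      by (simp add: mweight_def max_def min_def mult.commute)
    finally have le: "weight x \<le> c * d + mweight M\<^sub>2" .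
    obtain i j where "p = d + i" "0 < i" "c = q + j" "0 < j"
      using cd by (metis less_imp_add_positive)
    then have "c * d + p * q < p * c + d * q"
      by (simp add: algebra_simps)
    then show ?thesis using le by (simp add: M1 M2 mweight_def wt)
  qed
qed

text \<open>
  In the coordinates \<open>u\<close>, \<open>v\<close> (letters \<open>(i, True)\<close> and
  \<open>(i, False)\<close>): independent generators, except that \<open>u\<^sub>i = 0\<close>
  for \<open>i\<close> outside \<open>U\<close> and \<open>v\<^sub>i = 0\<close> for
  \<open>i\<close> outside \<open>V\<close>.
\<close>

definition uv_point :: "nat set \<Rightarrow> nat set \<Rightarrow> letter \<Rightarrow> 'a::comm_ring_1 odd_elem" where
  "uv_point U V x = Odd_elem (if fst x \<in> (if snd x then U else V) then gen (letter_index x) else 0)"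

text \<open>
  The point with coordinates \<open>b = u + v\<close>, \<open>c = u - v\<close>, in which the
  form is diagonal.
\<close>

definition rotate_point :: "(letter \<Rightarrow> 'a::comm_ring_1 odd_elem) \<Rightarrow> letter \<Rightarrow> 'a odd_elem" where
  "rotate_point \<mu> = (\<lambda>(i, c). Odd_elem (if c then odd_val (\<mu> (i, True)) + odd_val (\<mu> (i, False))
      else odd_val (\<mu> (i, True)) - odd_val (\<mu> (i, False))))"

definition mono_word :: "bool \<Rightarrow> array \<Rightarrow> letter list" where
  "mono_word c x = concat (map (\<lambda>(a, b). [(a, c), (b, c)]) x)"

lemma mset_mono_word: "mset (mono_word c x) = image_mset (\<lambda>i. (i, c)) (array_content x)"
  by (induction x) (auto simp: mono_word_def array_content_def)

lemma count_mono_word: "count (mset (mono_word c x)) (i, d) = (if d = c then count (array_content x) i else 0)"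
proof -
  have "count (image_mset (\<lambda>i. (i, c)) M) (i, d) = (if d = c then count M i else 0)" for M
    by (induction M) auto
  then show ?thesis by (simp add: mset_mono_word)
qed

lemma pairing_rotate:
  "pairing (rotate_point \<mu>) i j = gconst 2 *
    (odd_val (\<mu> (i, True)) * odd_val (\<mu> (j, True)) + - (odd_val (\<mu> (i, False)) * odd_val (\<mu> (j, False))))"
  by (simp add: pairing_def rotate_point_def Odd_elem_inverse gconst_2 mult_2 algebra_simps)

lemma array_val_rotate:
  fixes \<mu> :: "letter \<Rightarrow> 'a::field odd_elem"
  shows "array_val T (rotate_point \<mu>) = gconst (2 ^ length T) *
    (\<Sum>(x, y)\<leftarrow>splits T. gconst ((- 1) ^ length y) * word_val \<mu> (mono_word True x @ mono_word False y))"
proof -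
  let ?p = "\<lambda>c. odd_val (\<mu> (fst c, True)) * odd_val (\<mu> (snd c, True))"
  let ?r = "\<lambda>c. - (odd_val (\<mu> (fst c, False)) * odd_val (\<mu> (snd c, False)))"
  have lhs: "array_val T (rotate_point \<mu>) = gconst (2 ^ length T) * prod_list (map (\<lambda>c. ?p c + ?r c) T)"
  proof (induction T)
    case (Cons c T)
    have "array_val (c # T) (rotate_point \<mu>) =
        gconst 2 * ((?p c + ?r c) * gconst (2 ^ length T)) * prod_list (map (\<lambda>c. ?p c + ?r c) T)"
      by (simp only: array_val_simps Cons pairing_rotate mult.assoc)
    then show ?case by (simp only: gconst_commute) (simp add: gconst_mult mult.assoc)
  qed (simp add: gconst_1)
  have expand: "prod_list (map (\<lambda>c. ?p c + ?r c) T) =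
      (\<Sum>(x, y)\<leftarrow>splits T. prod_list (map ?p x) * prod_list (map ?r y))"
    by (rule prod_list_splits) (simp_all add: odd_mult_odd)
  have P: "prod_list (map ?p x) = word_val \<mu> (mono_word True x)" for x
    by (induction x) (auto simp: mono_word_def mult.assoc)
  have R: "prod_list (map ?r y) = gconst ((- 1) ^ length y) * word_val \<mu> (mono_word False y)" for y
  proof (induction y)
    case (Cons c y)
    have "prod_list (map ?r (c # y)) = (?r c * gconst ((- 1) ^ length y)) * word_val \<mu> (mono_word False y)"
      by (simp add: Cons mult.assoc)
    then show ?case
      by (simp only: gconst_commute) (simp add: mono_word_def case_prod_beta gconst_minus mult.assoc)
  qed (simp add: mono_word_def gconst_1)
  have W: "word_val \<mu> (mono_word True x) * (gconst ((- 1) ^ length y) * word_val \<mu> (mono_word False y)) =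
      gconst ((- 1) ^ length y) * word_val \<mu> (mono_word True x @ mono_word False y)" for x y
    by (simp only: word_val_simps mult.assoc[symmetric] gconst_commute)
  show ?thesis
    unfolding lhs expand by (simp only: P R W)
qed

lemma word_val_uv_nonzero:
  assumes two: "(2 :: 'a::field) \<noteq> 0"
    and nz: "word_val (uv_point U V) (mono_word True x @ mono_word False y) \<noteq> (0 :: 'a grassmann)"
    and fin: "finite U" "finite V"
  shows "array_content x \<subseteq># mset_set U" "array_content y \<subseteq># mset_set V"
proof -
  let ?w = "mono_word True x @ mono_word False y"
  have dist: "distinct ?w" using nz word_val_not_distinct[OF two] by blast
  have zero: "word_val \<phi> w = 0" if "z \<in> set w" "odd_val (\<phi> z) = 0" for w z and \<phi> :: "letter \<Rightarrow> 'a odd_elem"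
    using that by (induction w) auto
  have letters: "fst z \<in> (if snd z then U else V)" if "z \<in> set ?w" for z
  proof (rule ccontr)
    assume "\<not> ?thesis"
    then have "odd_val (uv_point U V z :: 'a odd_elem) = 0" by (simp add: uv_point_def Odd_elem_inverse)
    then show False using nz zero[OF that] by blast
  qed
  have "array_content v \<subseteq># mset_set X"
    if d: "distinct (mono_word c v)" and X: "finite X" "\<And>z. z \<in> set (mono_word c v) \<Longrightarrow> fst z \<in> X" for c v X
  proof (rule mset_subset_eqI)
    fix i
    have "count (array_content v) i = count (mset (mono_word c v)) (i, c)"
      by (simp add: count_mono_word)
    also have "\<dots> = (if (i, c) \<in> set (mono_word c v) then 1 else 0)"
      using d by (simp add: distinct_count_atmost_1)
    also have "\<dots> \<le> count (mset_set X) i"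
      using X(2)[of "(i, c)"] X(1) by auto
    finally show "count (array_content v) i \<le> count (mset_set X) i" .
  qed
  note sub = this
  have snd: "snd z = c" if "z \<in> set (mono_word c v)" for z c v
    using that by (auto simp: mono_word_def)
  have "fst z \<in> U" if "z \<in> set (mono_word True x)" for z
    using letters[of z] snd[OF that] that by simp
  then show "array_content x \<subseteq># mset_set U" using dist fin by (intro sub[of True]) auto
  have "fst z \<in> V" if "z \<in> set (mono_word False y)" for z
    using letters[of z] snd[OF that] that by simp
  then show "array_content y \<subseteq># mset_set V" using dist fin by (intro sub[of False]) auto
qed

lemma weight_mset: "weight x = mweight (mset x)"
  unfolding weight_def mweight_def by (metis mset_map sum_mset_sum_list)

lemma mcontent_mset: "mcontent (mset x) = array_content x"
  by (simp add: mcontent_def array_content_def)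

text \<open>
  A nonvanishing division of \<open>T\<close> matches exactly the letters that the nested
  division of \<open>S\<close> matches. Nested matchings have least weight, so \<open>weight T
  \<le> weight S\<close> forces both matchings to be the nested ones.
\<close>

lemma uv_selects_splitting:
  assumes two: "(2 :: 'a::field) \<noteq> 0"
    and S: "(x\<^sub>0, y\<^sub>0) \<in> set (splits S)" "nested x\<^sub>0" "nested y\<^sub>0"
    and T: "c_array T" "array_content T = array_content S" "weight T \<le> weight S" "(x, y) \<in> set (splits T)"
    and nz: "word_val (uv_point (set_mset (array_content x\<^sub>0)) (set_mset (array_content y\<^sub>0)))
      (mono_word True x @ mono_word False y) \<noteq> (0 :: 'a grassmann)"
  shows "mset x = mset x\<^sub>0" "mset y = mset y\<^sub>0"
proof -
  have split: "array_content U = array_content u + array_content v" "weight U = weight u + weight v"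
    if "(u, v) \<in> set (splits U)" for U u v
    using splits_mset[OF that]
    by (simp_all add: weight_mset mweight_def flip: mcontent_mset) (simp add: mcontent_def)
  have set: "mset_set (set_mset (array_content z)) = array_content z" if "nested z" for z
  proof (rule multiset_eqI)
    show "count (mset_set (set_mset (array_content z))) i = count (array_content z) i" for i
      using nested_content_le_1[OF that, of i] by (cases "i \<in># array_content z") (auto simp: le_Suc_eq count_eq_zero_iff)
  qed
  have sub: "array_content x \<subseteq># array_content x\<^sub>0" "array_content y \<subseteq># array_content y\<^sub>0"
    using word_val_uv_nonzero[OF two nz] S(2,3) by (simp_all add: set)
  have sum: "array_content x + array_content y = array_content x\<^sub>0 + array_content y\<^sub>0"
    using split(1)[OF S(1)] split(1)[OF T(4)] T(2) by simp
  have content: "array_content x = array_content x\<^sub>0" "array_content y = array_content y\<^sub>0"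
    using sub sum by (metis add_left_cancel add_right_cancel subset_mset.add_mono subset_mset.antisym
        subset_mset.add_le_cancel_left subset_mset.add_le_cancel_right subset_mset.order_refl)+
  have "set x \<subseteq> set T" "set y \<subseteq> set T"
    using arg_cong[OF splits_mset[OF T(4)], of set_mset] by auto
  then have orient: "\<forall>(a, b)\<in>#mset x. b < a" "\<forall>(a, b)\<in>#mset y. b < a"
    using T(1) by (auto simp: c_array_iff)
  have "mset x = mset x\<^sub>0 \<or> weight x\<^sub>0 < weight x" "mset y = mset y\<^sub>0 \<or> weight y\<^sub>0 < weight y"
    using nested_minimal[OF S(2) _ orient(1)] nested_minimal[OF S(3) _ orient(2)] content
    by (simp_all add: mcontent_mset weight_mset)
  moreover have "weight x + weight y \<le> weight x\<^sub>0 + weight y\<^sub>0"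
    using split(2)[OF S(1)] split(2)[OF T(4)] T(3) by simp
  ultimately show "mset x = mset x\<^sub>0" "mset y = mset y\<^sub>0"
    using weight_mset by (metis add_le_cancel_left add_le_cancel_right add_less_mono le_less_linear less_le_not_le not_less)+
qed

lemma uv_splitting_nonzero:
  fixes x\<^sub>0 y\<^sub>0 :: array
  assumes "nested x\<^sub>0" "nested y\<^sub>0"
  shows "word_val (uv_point (set_mset (array_content x\<^sub>0)) (set_mset (array_content y\<^sub>0)))
    (mono_word True x\<^sub>0 @ mono_word False y\<^sub>0) \<noteq> (0 :: 'a::comm_ring_1 grassmann)"
proof -
  let ?\<mu> = "uv_point (set_mset (array_content x\<^sub>0)) (set_mset (array_content y\<^sub>0)) :: letter \<Rightarrow> 'a odd_elem"
  let ?w = "mono_word True x\<^sub>0 @ mono_word False y\<^sub>0"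
  have "count (mset ?w) z \<le> 1" for z
    using nested_content_le_1[OF assms(1), of "fst z"] nested_content_le_1[OF assms(2), of "fst z"]
    by (cases z) (simp add: count_mono_word)
  then have "distinct ?w"
    unfolding distinct_count_atmost_1 by (metis One_nat_def count_eq_zero_iff le_Suc_eq le_zero_eq set_mset_mset)
  moreover have "odd_val (?\<mu> z) = gen (letter_index z)" if "z \<in> set ?w" for z
  proof -
    have "(i, c) \<in> set (mono_word d v) \<Longrightarrow> c = d \<and> i \<in># array_content v" for i c d v
      using count_mono_word[of d v i c] by (metis count_eq_zero_iff set_mset_mset)
    then have "fst z \<in> (if snd z then set_mset (array_content x\<^sub>0) else set_mset (array_content y\<^sub>0))"
      using that by (cases z) auto
    then show ?thesis by (simp add: uv_point_def Odd_elem_inverse)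
  qed
  ultimately obtain e :: 'a where e: "e = 1 \<or> e = - 1"
    "\<And>C. gcoeff (word_val ?\<mu> ?w) C = (if C = letter_index ` set ?w then e else 0)"
    using gcoeff_word_val_gen[of ?w letter_index ?\<mu>] inj_on_subset[OF inj_letter_index subset_UNIV] by metis
  show ?thesis
  proof
    assume "word_val ?\<mu> ?w = 0"
    then have "e = 0" using e(2)[of "letter_index ` set ?w"] by (simp add: zero_grassmann.rep_eq)
    then show False using e(1) by auto
  qed
qed

text \<open>
  Take an array \<open>S\<close> of greatest weight in a linear relation and evaluate at the
  point selecting its nested division. All other terms of the relation vanish there, while the
  value of \<open>S\<close> is a basis monomial times a power of 2, up to sign.
\<close>

lemma normal_array_vals_independent:
  assumes two: "(2 :: 'a::field) \<noteq> 0" and fin: "finite N"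
    and N: "\<And>S. S \<in> N \<Longrightarrow> normal_array S \<and> array_content S = m"
  shows "inj_on (array_val :: array \<Rightarrow> (letter \<Rightarrow> 'a odd_elem) \<Rightarrow> _) N"
    "\<not> gf.dependent (array_val ` N :: ((letter \<Rightarrow> 'a odd_elem) \<Rightarrow> _) set)"
proof -
  have "\<forall>S\<in>N. c S = 0" if c: "(\<Sum>S\<in>N. gf_scale (c S) (array_val S :: (letter \<Rightarrow> 'a odd_elem) \<Rightarrow> _)) = 0" for c
  proof (rule ccontr)
    assume "\<not> ?thesis"
    then have ne: "{S \<in> N. c S \<noteq> 0} \<noteq> {}" by auto
    have "finite {S \<in> N. c S \<noteq> 0}" using fin by simp
    then have "Max (weight ` {S \<in> N. c S \<noteq> 0}) \<in> weight ` {S \<in> N. c S \<noteq> 0}" using ne by simp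
    then obtain S where S: "S \<in> N" "c S \<noteq> 0" "weight S = Max (weight ` {S \<in> N. c S \<noteq> 0})" by auto
    have max: "weight T \<le> weight S" if "T \<in> N" "c T \<noteq> 0" for T
      unfolding S(3) using that fin by (intro Max_ge) auto
    obtain x\<^sub>0 y\<^sub>0 where xy: "(x\<^sub>0, y\<^sub>0) \<in> set (splits S)" "nested x\<^sub>0" "nested y\<^sub>0"
      using normal_splits_nested N S(1) by metis
    define \<mu> :: "letter \<Rightarrow> 'a odd_elem" where
      "\<mu> = uv_point (set_mset (array_content x\<^sub>0)) (set_mset (array_content y\<^sub>0))"
    define F where "F = (\<lambda>(x, y). gconst ((- 1) ^ length y) * word_val \<mu> (mono_word True x @ mono_word False y))"
    have val: "array_val T (rotate_point \<mu>) = gconst (2 ^ length T) * (\<Sum>z\<leftarrow>splits T. F z)" for T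
      unfolding array_val_rotate F_def by (simp add: case_prod_beta')
    \<comment> \<open>At this point only divisions equal to the nested one contribute.\<close>
    have sel: "mset x = mset x\<^sub>0 \<and> mset y = mset y\<^sub>0"
      if "T \<in> N" "c T \<noteq> 0" "(x, y) \<in> set (splits T)" "F (x, y) \<noteq> 0" for T x y
    proof -
      have "word_val \<mu> (mono_word True x @ mono_word False y) \<noteq> 0"
        using that(4) by (auto simp: F_def)
      then show ?thesis
        using uv_selects_splitting[OF two xy _ _ max[OF that(1,2)] that(3)] N[OF that(1)] N[OF S(1)]
        unfolding \<mu>_def by (auto simp: normal_array_def)
    qed
    have vanish: "array_val T (rotate_point \<mu>) = 0" if T: "T \<in> N" "c T \<noteq> 0" "T \<noteq> S" for T
    proof -
      have "F z = 0" if z: "z \<in> set (splits T)" for z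
      proof (rule ccontr)
        assume "F z \<noteq> 0"
        then have "mset (fst z) = mset x\<^sub>0" "mset (snd z) = mset y\<^sub>0"
          using sel[OF T(1,2), of "fst z" "snd z"] z by auto
        then have "mset T = mset S"
          using splits_mset[OF xy(1)] splits_mset[of "fst z" "snd z" T] z by simp
        moreover have "sorted T" "sorted S"
          using N T(1) S(1) by (auto simp: normal_array_def c_array_iff)
        ultimately show False using T(3) by (metis sort_key_id_if_sorted sorted_sort_id properties_for_sort)
      qed
      then have "(\<Sum>z\<leftarrow>splits T. F z) = 0" by (simp cong: map_cong)
      then show ?thesis by (simp add: val)
    qed
    let ?t = "F (x\<^sub>0, y\<^sub>0)"
    let ?Q = "\<lambda>(x, y). mset x = mset x\<^sub>0 \<and> mset y = mset y\<^sub>0"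
    have F: "F z = (if ?Q z then ?t else 0)" if "z \<in> set (splits S)" for z
    proof (cases "?Q z")
      case True
      have word: "word_val \<mu> (mono_word d x) = prod_list (map (\<lambda>c. odd_val (\<mu> (fst c, d)) * odd_val (\<mu> (snd c, d))) x)" for d x
        by (induction x) (auto simp: mono_word_def mult.assoc)
      have perm: "word_val \<mu> (mono_word d x) = word_val \<mu> (mono_word d x')" if "mset x = mset x'" for d x x'
        unfolding word by (rule prod_list_even_perm[OF that]) (simp add: odd_mult_odd)
      obtain x y where z: "z = (x, y)" by force
      with True have "mset x = mset x\<^sub>0" "mset y = mset y\<^sub>0" by auto
      then have "F (x, y) = ?t"
        by (simp only: F_def split word_val_simps perm[of x x\<^sub>0] perm[of y y\<^sub>0] mset_eq_length[of y y\<^sub>0])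
      then show ?thesis using True z by simp
    next
      case False
      then show ?thesis using sel[OF S(1,2), of "fst z" "snd z"] that by (cases z) auto
    qed
    have count: "(\<Sum>z\<leftarrow>L. if Q z then t else 0) = gconst (of_nat (length (filter Q L))) * t"
      for L :: "(array \<times> array) list" and Q and t :: "'a grassmann"
      by (induction L) (simp_all add: gconst_0 gconst_add gconst_1 distrib_right)
    \<comment> \<open>The equal contributions are as many as there are ways to divide \<open>S\<close> like this.\<close>
    have K: "length (filter ?Q (splits S)) = 2 ^ size (mset x\<^sub>0 \<inter># mset y\<^sub>0)"
    proof (rule card_splits[OF splits_mset[OF xy(1)]])
      have dist: "distinct z" if "nested z" for z
        using that by (auto simp: nested_def sorted_wrt_iff_nth_less distinct_conv_nth nat_neq_iff) (metis less_irrefl)+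
      have "count (mset z) c \<le> 1" if "nested z" for z c
        by (cases c) (use dist[OF that] in \<open>simp add: distinct_count_atmost_1\<close>)
      then show "count (mset x\<^sub>0) c \<le> 1" "count (mset y\<^sub>0) c \<le> 1" for c using xy(2,3) by blast+
    qed
    have "(\<Sum>z\<leftarrow>splits S. F z) = (\<Sum>z\<leftarrow>splits S. if ?Q z then ?t else 0)"
      using F by (simp cong: map_cong)
    then have vS: "array_val S (rotate_point \<mu>) =
        gconst (2 ^ length S * 2 ^ size (mset x\<^sub>0 \<inter># mset y\<^sub>0) * (- 1) ^ length y\<^sub>0) * word_val \<mu> (mono_word True x\<^sub>0 @ mono_word False y\<^sub>0)"
      by (simp add: val count K) (simp add: F_def gconst_mult mult.assoc)
    have scale: "r * gcoeff z C = 0" if "gconst r * z = 0" for r and z :: "'a grassmann" and C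
      using arg_cong[OF that, of "\<lambda>z. gcoeff z C"] by (simp add: gcoeff_gconst_mult zero_grassmann.rep_eq)
    have fsum: "(\<Sum>B\<in>I. G B) \<phi> = (\<Sum>B\<in>I. G B \<phi>)" for I :: "array set" and G :: "_ \<Rightarrow> (letter \<Rightarrow> 'a odd_elem) \<Rightarrow> 'a grassmann" and \<phi>
      by (induction I rule: infinite_finite_induct) simp_all
    have "0 = (\<Sum>T\<in>N. gf_scale (c T) (array_val T)) (rotate_point \<mu>)" by (simp add: c)
    also have "\<dots> = (\<Sum>T\<in>N. gconst (c T) * array_val T (rotate_point \<mu>))"
      by (simp add: fsum gf_scale_def)
    also have "\<dots> = (\<Sum>T\<in>{S}. gconst (c T) * array_val T (rotate_point \<mu>))"
    proof (rule sum.mono_neutral_right)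
      show "\<forall>T\<in>N - {S}. gconst (c T) * array_val T (rotate_point \<mu>) = 0"
        using vanish by (auto simp: gconst_0) (metis gconst_0 mult_zero_left mult_zero_right)
    qed (use fin S in auto)
    finally have "gconst (c S * (2 ^ length S * 2 ^ size (mset x\<^sub>0 \<inter># mset y\<^sub>0) * (- 1) ^ length y\<^sub>0)) *
        word_val \<mu> (mono_word True x\<^sub>0 @ mono_word False y\<^sub>0) = 0"
      by (simp add: vS gconst_mult mult.assoc)
    from scale[OF this] have "gcoeff (word_val \<mu> (mono_word True x\<^sub>0 @ mono_word False y\<^sub>0)) C = 0" for C
      using S(2) two by simp
    then have "word_val \<mu> (mono_word True x\<^sub>0 @ mono_word False y\<^sub>0) = 0"
      by (intro gcoeff_eqI) (simp add: zero_grassmann.rep_eq)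
    then show False using uv_splitting_nonzero[OF xy(2,3)] unfolding \<mu>_def by blast
  qed
  from gf_independent_family[OF fin this]
  show "inj_on (array_val :: array \<Rightarrow> (letter \<Rightarrow> 'a odd_elem) \<Rightarrow> _) N"
    "\<not> gf.dependent (array_val ` N :: ((letter \<Rightarrow> 'a odd_elem) \<Rightarrow> _) set)" by blast+
qed

section \<open>Evaluating proper polynomials\<close>

lemma UNIV_two: "(UNIV :: 2 set) = {1, 2}"
proof -
  have "card {1, 2 :: 2} = card (UNIV :: 2 set)" by simp
  then show ?thesis by (metis card_subset_eq finite subset_UNIV)
qed

lemma matrix_two_eqI:
  fixes A B :: "'a ^ 2 ^ 2"
  assumes "A $ 1 $ 1 = B $ 1 $ 1" "A $ 1 $ 2 = B $ 1 $ 2" "A $ 2 $ 1 = B $ 2 $ 1" "A $ 2 $ 2 = B $ 2 $ 2"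
  shows "A = B"
proof -
  have two: "k = 2" if "k \<noteq> 1" for k :: 2
    using that UNIV_two by blast
  have "A $ i $ j = B $ i $ j" for i j
    using assms two[of i] two[of j] by (cases "i = 1"; cases "j = 1") simp_all
  then show ?thesis by (simp add: vec_eq_iff)
qed

lemma matrix_two_mult: "((A :: 'a::semiring_1 ^ 2 ^ 2) ** B) $ i $ j = A $ i $ 1 * B $ 1 $ j + A $ i $ 2 * B $ 2 $ j"
  by (simp add: matrix_matrix_mult_def UNIV_two)

lemma mat_two [simp]:
  "(mat c :: 'a::zero ^ 2 ^ 2) $ 1 $ 1 = c" "(mat c :: 'a ^ 2 ^ 2) $ 1 $ 2 = 0"
  "(mat c :: 'a ^ 2 ^ 2) $ 2 $ 1 = 0" "(mat c :: 'a ^ 2 ^ 2) $ 2 $ 2 = c"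
  by (simp_all add: mat_def)

lemma mat_even_commute: "c \<in> even_part \<Longrightarrow> M ** mat c = mat c ** (M :: 'a::comm_ring_1 grassmann ^ 2 ^ 2)"
  by (rule matrix_two_eqI) (simp_all add: matrix_two_mult even_commute)

lemma fa_eval_0: "fa_eval w 0 = 0"
  by (simp add: fa_eval_def)

lemma fa_eval_minus: "fa_eval w (f - g) = fa_eval w f - fa_eval w g"
  using fa_eval_add[of w "f - g" g] by simp

lemma fa_eval_sum: "fa_eval w (\<Sum>i\<in>I. f i) = (\<Sum>i\<in>I. fa_eval w (f i))"
  by (induction I rule: infinite_finite_induct) (simp_all add: fa_eval_0 fa_eval_add)

lemma fa_eval_single: "fa_eval w (Poly_Mapping.single u a) = mat (gconst a) ** word_eval w u"
  by (subst fa_eval_superset[of "{u}"]) auto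

lemma word_eval_add: "word_eval w (u + v) = word_eval w u ** word_eval w v"
proof -
  have "foldr (\<lambda>i M. w i ** M) xs N = foldr (\<lambda>i M. w i ** M) xs (mat 1) ** N" for xs N
    by (induction xs) (simp_all add: matrix_mul_assoc[symmetric])
  then show ?thesis by (simp add: word_eval_def plus_word_def)
qed

lemma sum_monomials: "f = (\<Sum>u\<in>Poly_Mapping.keys f. Poly_Mapping.single u (Poly_Mapping.lookup f u))"
  by (rule poly_mapping_eqI)
    (simp add: lookup_sum lookup_single when_def in_keys_iff)

lemma fa_eval_mult: "fa_eval w (f * g) = fa_eval w f ** fa_eval w g"
proof -
  have single: "fa_eval w (Poly_Mapping.single u a * Poly_Mapping.single v b) =
      fa_eval w (Poly_Mapping.single u a) ** fa_eval w (Poly_Mapping.single v b)" for u v a b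
  proof -
    let ?U = "word_eval w u" and ?V = "word_eval w v" and ?a = "mat (gconst a) :: 'a grassmann ^ 2 ^ 2"
      and ?b = "mat (gconst b) :: 'a grassmann ^ 2 ^ 2"
    have "?a ** ?b ** (?U ** ?V) = ?a ** (?b ** ?U) ** ?V" by (simp only: matrix_mul_assoc)
    also have "?b ** ?U = ?U ** ?b" by (rule mat_even_commute[symmetric]) simp
    also have "?a ** (?U ** ?b) ** ?V = (?a ** ?U) ** (?b ** ?V)" by (simp only: matrix_mul_assoc)
    finally show ?thesis by (simp only: mult_single fa_eval_single gconst_mult mat_mult word_eval_add)
  qed
  have zero: "0 ** N = (0 :: 'a grassmann ^ 2 ^ 2)" for N :: "'a grassmann ^ 2 ^ 2"
    by (simp add: matrix_matrix_mult_def vec_eq_iff)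
  have sum_left: "(\<Sum>i\<in>I. F i) ** N = (\<Sum>i\<in>I. F i ** (N :: 'a grassmann ^ 2 ^ 2))" for F and I :: "word set" and N
    by (induction I rule: infinite_finite_induct) (simp_all add: mat_rdistrib zero)
  have "fa_eval w (f * g) = fa_eval w ((\<Sum>u\<in>Poly_Mapping.keys f. Poly_Mapping.single u (Poly_Mapping.lookup f u)) *
      (\<Sum>v\<in>Poly_Mapping.keys g. Poly_Mapping.single v (Poly_Mapping.lookup g v)))"
    by (simp flip: sum_monomials)
  also have "\<dots> = (\<Sum>u\<in>Poly_Mapping.keys f. fa_eval w (Poly_Mapping.single u (Poly_Mapping.lookup f u))) **
      (\<Sum>v\<in>Poly_Mapping.keys g. fa_eval w (Poly_Mapping.single v (Poly_Mapping.lookup g v)))"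
    by (simp add: sum_product fa_eval_sum single sum_left mat_sum_right) (rule sum.swap)
  also have "\<dots> = fa_eval w f ** fa_eval w g"
    by (simp flip: fa_eval_sum sum_monomials)
  finally show ?thesis .
qed

lemma fa_eval_1: "fa_eval w 1 = mat 1"
  by (simp add: fa_eval_single gconst_1 word_eval_def zero_word_def flip: single_one)

lemma fa_eval_var: "fa_eval w (var i) = w i"
  by (simp add: var_def fa_eval_single gconst_1 word_eval_def)

text \<open>
  The off-diagonal entries of a family of matrices in \<open>W\<close>; the diagonal parts are
  central and leave no trace in commutators.
\<close>

definition point_of :: "(nat \<Rightarrow> 'a::comm_ring_1 grassmann ^ 2 ^ 2) \<Rightarrow> letter \<Rightarrow> 'a odd_elem" where
  "point_of w = (\<lambda>(i, c). Odd_elem (if c then w i $ 1 $ 2 else w i $ 2 $ 1))"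

lemma W_commutator:
  assumes "w i \<in> W_space" "w j \<in> W_space"
  shows "w i ** w j - w j ** w i = mat (pairing (point_of w) i j :: 'a::comm_ring_1 grassmann)"
proof -
  let ?b = "\<lambda>i. w i $ 1 $ 2" and ?c = "\<lambda>i. w i $ 2 $ 1" and ?a = "\<lambda>i. w i $ 1 $ 1"
  have w: "?a k \<in> even_part" "?b k \<in> odd_part" "?c k \<in> odd_part" "w k $ 2 $ 2 = ?a k" if "k = i \<or> k = j" for k
    using assms that by (auto simp: W_space_def M11_def supertrace_def)
  have p: "pairing (point_of w) i j = ?b i * ?c j + ?c i * ?b j"
    using w by (simp add: pairing_def point_of_def Odd_elem_inverse)
  have comm: "?a j * ?a i = ?a i * ?a j" "?b i * ?a j = ?a j * ?b i" "?b j * ?a i = ?a i * ?b j"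
    "?c i * ?a j = ?a j * ?c i" "?c j * ?a i = ?a i * ?c j"
    using w(1) even_commute by blast+
  have anti: "?b j * ?c i = - (?c i * ?b j)" "?c j * ?b i = - (?b i * ?c j)"
    using w(2,3) odd_anticommute by blast+
  show ?thesis
    by (rule matrix_two_eqI) (simp_all add: matrix_two_mult p w(4) comm anti)
qed

definition commutator_product :: "nat list list \<Rightarrow> 'a::field free_alg" where
  "commutator_product iss = prod_list (map (\<lambda>is. left_normed (map var is)) iss)"

text \<open>
  A commutator of length two has a scalar even value, which is central; all further commutators
  are therefore zero.
\<close>

lemma fa_eval_left_normed:
  assumes "\<And>i. w i \<in> W_space" "length is \<ge> 2"
  shows "fa_eval w (left_normed (map var is)) =
    mat (if length is = 2 then pairing (point_of w) (is ! 0) (is ! 1) else 0)"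
proof -
  obtain i j js where is': "is = i # j # js" using assms(2) by (cases "is"; cases "tl is") auto
  have step: "fa_eval w (foldl commutator c (map var js)) = mat (if js = [] then e else 0)"
    if "fa_eval w c = mat e" "e \<in> even_part" for c e js
    using that
  proof (induction js arbitrary: c e)
    case (Cons j js)
    have "fa_eval w (commutator c (var j)) = mat 0"
      using Cons.prems mat_even_commute[OF Cons.prems(2), of "w j"]
      by (simp add: commutator_def fa_eval_minus fa_eval_mult fa_eval_var mat_0)
    from Cons.IH[OF this] show ?case by simp
  qed simp
  have "fa_eval w (commutator (var i) (var j)) = mat (pairing (point_of w) i j)"
    using W_commutator[OF assms(1,1)] by (simp add: commutator_def fa_eval_minus fa_eval_mult fa_eval_var)
  from step[OF this pairing_even, of js] show ?thesis by (simp add: is')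
qed

lemma fa_eval_commutator_product:
  assumes "\<And>i. w i \<in> W_space" "\<forall>is\<in>set iss. length is \<ge> 2"
  shows "fa_eval w (commutator_product iss) =
    mat (if \<forall>is\<in>set iss. length is = 2 then array_val (map (\<lambda>is. (is ! 0, is ! 1)) iss) (point_of w) else 0)"
  using assms(2)
proof (induction iss)
  case Nil
  then show ?case by (simp add: commutator_product_def fa_eval_1)
next
  case (Cons is' iss)
  have "fa_eval w (commutator_product (is' # iss)) =
      fa_eval w (left_normed (map var is')) ** fa_eval w (commutator_product iss)"
    by (simp add: commutator_product_def fa_eval_mult)
  then show ?case
    using Cons fa_eval_left_normed[OF assms(1), of is'] by (auto simp flip: mat_mult)
qed

section \<open>Proper polynomials as combinations of products of commutators\<close>

interpretation fa: vector_space fa_scale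
  by standard (simp_all add: fa_scale_simps)

lemma single_0_commute: "f * Poly_Mapping.single (0 :: word) c = Poly_Mapping.single 0 c * (f :: 'a::field free_alg)"
proof -
  have "(\<Sum>u\<in>K. Poly_Mapping.single u (g u)) * Poly_Mapping.single 0 c =
      Poly_Mapping.single 0 c * (\<Sum>u\<in>K. Poly_Mapping.single u (g u))" for K :: "word set" and g
    by (simp add: sum_distrib_left sum_distrib_right mult_single mult.commute)
  then show ?thesis by (metis sum_monomials)
qed

lemma fa_scale_mult_left: "fa_scale c f * g = fa_scale c (f * g)"
  by (simp add: fa_scale_def mult.assoc)

lemma fa_scale_mult_right: "g * fa_scale c f = fa_scale c (g * f)"
  by (simp add: fa_scale_def single_0_commute flip: mult.assoc)

definition commutator_products :: "'a::field free_alg set" where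
  "commutator_products = commutator_product ` {iss. \<forall>is\<in>set iss. length is \<ge> 2}"

lemma proper_polys_span: "(proper_polys :: 'a::field free_alg set) \<subseteq> fa.span commutator_products"
  unfolding proper_polys_def
proof (rule hull_minimal)
  show "{left_normed (map var is) | is. 2 \<le> length is} \<subseteq> (fa.span commutator_products :: 'a free_alg set)"
  proof
    fix f :: "'a free_alg" assume "f \<in> {left_normed (map var is) | is. 2 \<le> length is}"
    then obtain "is" where "2 \<le> length is" "f = commutator_product [is]"
      by (auto simp: commutator_product_def)
    then show "f \<in> fa.span commutator_products"
      unfolding commutator_products_def by (intro fa.span_base) auto
  qed
  have "commutator_product [] \<in> (commutator_products :: 'a free_alg set)"
    unfolding commutator_products_def by (intro imageI) simp
  then have one: "1 \<in> fa.span (commutator_products :: 'a free_alg set)"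
    by (intro fa.span_base) (simp add: commutator_product_def)
  have base: "f * g \<in> commutator_products" if fg: "f \<in> commutator_products" "g \<in> commutator_products" for f g :: "'a free_alg"
  proof -
    obtain iss jss where "f = commutator_product iss" "g = commutator_product jss"
      "\<forall>is\<in>set (iss @ jss). length is \<ge> 2"
      using fg by (auto simp: commutator_products_def)
    then have "f * g = commutator_product (iss @ jss)" by (simp add: commutator_product_def)
    then show ?thesis using \<open>\<forall>is\<in>set (iss @ jss). length is \<ge> 2\<close> by (auto simp: commutator_products_def)
  qed
  have right: "f * g \<in> fa.span commutator_products"
    if f: "f \<in> commutator_products" and g: "g \<in> fa.span commutator_products" for f g :: "'a free_alg"
    using g
  proof (induction g rule: fa.span_induct_alt)
    case (step c x y)
    then show ?case using base[OF f step(1)]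
      by (auto simp: distrib_left fa_scale_mult_right intro: fa.span_add fa.span_scale fa.span_base)
  qed (simp add: fa.span_zero)
  have "f * g \<in> fa.span commutator_products"
    if f: "f \<in> fa.span commutator_products" and g: "g \<in> fa.span commutator_products" for f g :: "'a free_alg"
    using f
  proof (induction f rule: fa.span_induct_alt)
    case (step c x y)
    then show ?case using right[OF step(1) g]
      by (auto simp: distrib_right fa_scale_mult_left intro: fa.span_add fa.span_scale)
  qed (simp add: fa.span_zero)
  then show "is_subalgebra (fa.span (commutator_products :: 'a free_alg set))"
    unfolding is_subalgebra_def using one fa.span_add fa.span_scale by blast
qed

definition homogeneous :: "nat multiset \<Rightarrow> 'a::field free_alg \<Rightarrow> bool" where
  "homogeneous m f \<longleftrightarrow> (\<forall>u\<in>Poly_Mapping.keys f. mset (letters u) = m)"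

lemma homogeneous_var: "homogeneous {#i#} (var i)"
  by (simp add: homogeneous_def var_def)

lemma homogeneous_1: "homogeneous {#} 1"
  by (simp add: homogeneous_def zero_word_def flip: single_one)

lemma homogeneous_minus: "homogeneous m f \<Longrightarrow> homogeneous m g \<Longrightarrow> homogeneous m (f - g)"
  using Poly_Mapping.keys_diff[of f g] by (auto simp: homogeneous_def)

lemma homogeneous_mult:
  assumes "homogeneous m f" "homogeneous m' g"
  shows "homogeneous (m + m') (f * g)"
  unfolding homogeneous_def
proof
  fix u assume "u \<in> Poly_Mapping.keys (f * g)"
  then obtain a b where "u = a + b" "a \<in> Poly_Mapping.keys f" "b \<in> Poly_Mapping.keys g"
    using keys_mult[of f g] by auto
  then show "mset (letters u) = m + m'"
    using assms by (simp add: homogeneous_def plus_word_def)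
qed

lemma homogeneous_commutator:
  assumes "homogeneous m f" "homogeneous m' g"
  shows "homogeneous (m + m') (commutator f g)"
  unfolding commutator_def
  using homogeneous_minus[OF homogeneous_mult[OF assms] homogeneous_mult[OF assms(2,1), unfolded add.commute[of m' m]]] .

lemma homogeneous_left_normed: "is \<noteq> [] \<Longrightarrow> homogeneous (mset is) (left_normed (map var is))"
proof -
  have "homogeneous (m + mset js) (foldl commutator c (map var js))" if "homogeneous m c" for m c js
    using that
  proof (induction js arbitrary: c m)
    case (Cons j js)
    from Cons.IH[OF homogeneous_commutator[OF Cons.prems homogeneous_var[of j]]] show ?case by simp
  qed simp
  from this[OF homogeneous_var] show "is \<noteq> [] \<Longrightarrow> homogeneous (mset is) (left_normed (map var is))"
    by (cases "is") auto
qed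

lemma homogeneous_commutator_product:
  "\<forall>is\<in>set iss. length is \<ge> 2 \<Longrightarrow> homogeneous (mset (concat iss)) (commutator_product iss)"
proof (induction iss)
  case (Cons is' iss)
  have "is' \<noteq> []" using Cons.prems by auto
  from homogeneous_mult[OF homogeneous_left_normed[OF this] Cons.IH] Cons.prems show ?case
    by (simp add: commutator_product_def)
qed (simp add: commutator_product_def homogeneous_1)

text \<open>
  Products of commutators of variables are homogeneous, so in a combination equal to a
  homogeneous polynomial the terms of other multidegrees cancel among themselves.
\<close>

lemma homogeneous_proper_span:
  assumes f: "f \<in> fa.span commutator_products" "homogeneous m f"
  shows "f \<in> fa.span {p \<in> commutator_products. homogeneous m p}"
proof -
  from f(1) obtain t r where t: "finite t" "t \<subseteq> commutator_products" "f = (\<Sum>p\<in>t. fa_scale (r p) p)"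
    unfolding fa.span_explicit by blast
  let ?A = "{p \<in> t. homogeneous m p}" and ?B = "{p \<in> t. \<not> homogeneous m p}"
  let ?f = "\<lambda>A. \<Sum>p\<in>A. fa_scale (r p) p"
  have lookup: "Poly_Mapping.lookup (?f A) u = (\<Sum>p\<in>A. r p * Poly_Mapping.lookup p u)" for A u
    by (simp add: lookup_sum lookup_fa_scale)
  have split: "f = ?f ?A + ?f ?B"
    unfolding t(3) using t(1) by (subst sum.union_disjoint[symmetric]) (auto intro: sum.cong)
  \<comment> \<open>A product of commutators of another multidegree has no term of multidegree \<open>m\<close>.\<close>
  have off: "Poly_Mapping.lookup p u = 0" if p: "p \<in> ?B" and u: "mset (letters u) = m" for p u
  proof -
    obtain iss where "p = commutator_product iss" "\<forall>is\<in>set iss. length is \<ge> 2"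
      using p t(2) by (auto simp: commutator_products_def)
    then obtain m' where m': "homogeneous m' p" using homogeneous_commutator_product by blast
    then have "m' \<noteq> m" using p by auto
    then show ?thesis using m' u by (auto simp: homogeneous_def in_keys_iff)
  qed
  have on: "Poly_Mapping.lookup g u = 0" if "homogeneous m g" "mset (letters u) \<noteq> m" for g :: "'a free_alg" and u
    using that by (auto simp: homogeneous_def in_keys_iff)
  have "f = ?f ?A"
  proof (rule poly_mapping_eqI)
    fix u
    show "Poly_Mapping.lookup f u = Poly_Mapping.lookup (?f ?A) u"
    proof (cases "mset (letters u) = m")
      case True
      then have "Poly_Mapping.lookup (?f ?B) u = 0" using off by (simp add: lookup)
      moreover have "Poly_Mapping.lookup f u = Poly_Mapping.lookup (?f ?A) u + Poly_Mapping.lookup (?f ?B) u"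
        by (subst split) (rule lookup_add)
      ultimately show ?thesis by simp
    next
      case False
      have "Poly_Mapping.lookup (?f ?A) u = 0"
        unfolding lookup using on[OF _ False] by (intro sum.neutral) auto
      then show ?thesis using on[OF f(2) False] by simp
    qed
  qed
  also have "\<dots> \<in> fa.span {p \<in> commutator_products. homogeneous m p}"
    using t(2) by (intro fa.span_sum fa.span_scale fa.span_base) auto
  finally show ?thesis .
qed

section \<open>The value of a polynomial\<close>

definition odd_matrices :: "(letter \<Rightarrow> 'a::comm_ring_1 odd_elem) \<Rightarrow> nat \<Rightarrow> 'a grassmann ^ 2 ^ 2" where
  "odd_matrices \<phi> i = (\<chi> r s. if r = s then 0 else odd_val (\<phi> (i, r = 1)))"

text \<open>
  On proper polynomials evaluation in \<open>W\<close> gives scalar matrices that depend only on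
  off-diagonal entries, so nothing is lost by keeping one entry of the value at matrices with
  zero diagonal.
\<close>

definition fa_val :: "'a::field free_alg \<Rightarrow> (letter \<Rightarrow> 'a odd_elem) \<Rightarrow> 'a grassmann" where
  "fa_val f \<phi> = fa_eval (odd_matrices \<phi>) f $ 1 $ 1"

lemma odd_matrices_W: "odd_matrices \<phi> i \<in> W_space"
  by (simp add: odd_matrices_def W_space_def M11_def supertrace_def)

lemma point_of_odd_matrices: "point_of (odd_matrices \<phi>) = \<phi>"
  by (auto simp: fun_eq_iff point_of_def odd_matrices_def odd_val_inverse)

lemma fa_val_add: "fa_val (f + g) = fa_val f + fa_val g"
  and fa_val_scale: "fa_val (fa_scale c f) = gf_scale c (fa_val f)"
  by (simp_all add: fun_eq_iff fa_val_def fa_eval_add fa_eval_scale gf_scale_def matrix_two_mult)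

lemma fa_val_0: "fa_val 0 = 0"
  by (simp add: fun_eq_iff fa_val_def fa_eval_0)

lemma fa_val_commutator_product:
  assumes "\<forall>is\<in>set iss. length is \<ge> 2"
  shows "fa_val (commutator_product iss) =
    (if \<forall>is\<in>set iss. length is = 2 then array_val (map (\<lambda>is. (is ! 0, is ! 1)) iss) else 0)"
proof
  fix \<phi>
  show "fa_val (commutator_product iss) \<phi> =
      (if \<forall>is\<in>set iss. length is = 2 then array_val (map (\<lambda>is. (is ! 0, is ! 1)) iss) else 0) \<phi>"
    using fa_eval_commutator_product[of "odd_matrices \<phi>" iss, OF odd_matrices_W assms]
    by (simp add: fa_val_def point_of_odd_matrices)
qed

lemma fa_eval_proper:
  assumes w: "\<And>i. w i \<in> W_space" and f: "f \<in> fa.span commutator_products"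
  shows "fa_eval w f = mat (fa_val f (point_of w))"
  using f
proof (induction f rule: fa.span_induct_alt)
  case base
  then show ?case by (simp add: fa_eval_0 fa_val_0 mat_0)
next
  case (step c p g)
  then obtain iss where iss: "p = commutator_product iss" "\<forall>is\<in>set iss. length is \<ge> 2"
    by (auto simp: commutator_products_def)
  have "fa_eval w p = mat (fa_val p (point_of w))"
    unfolding iss(1) fa_eval_commutator_product[OF w iss(2)] fa_val_commutator_product[OF iss(2)] by simp
  then show ?case
    using step.IH by (simp add: fa_eval_add fa_eval_scale fa_val_add fa_val_scale gf_scale_def mat_add mat_mult)
qed

lemma proper_in_I_w_iff:
  assumes "f \<in> proper_polys"
  shows "f \<in> I_w \<longleftrightarrow> fa_val f = 0"
proof
  assume "f \<in> I_w"
  then show "fa_val f = 0" by (simp add: I_w_def fa_val_def fun_eq_iff odd_matrices_W)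
next
  assume "fa_val f = 0"
  moreover have "f \<in> fa.span commutator_products" using assms proper_polys_span by blast
  ultimately show "f \<in> I_w" by (simp add: I_w_def fa_eval_proper mat_0)
qed

definition content :: "nat list \<Rightarrow> nat multiset" where
  "content ns = (\<Sum>i<length ns. replicate_mset (ns ! i) i)"

lemma count_content: "count (content ns) i = (if i < length ns then ns ! i else 0)"
  by (simp add: content_def count_sum)

lemma size_content: "size (content ns) = sum_list ns"
proof -
  have "size (\<Sum>i\<in>I. replicate_mset (ns ! i) i) = (\<Sum>i\<in>I. ns ! i)" for I
    by (induction I rule: infinite_finite_induct) simp_all
  then show ?thesis by (simp add: content_def sum_list_sum_nth atLeast0LessThan)
qed

lemma multihomogeneous_iff: "multihomogeneous ns f \<longleftrightarrow> homogeneous (content ns) f"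
  by (simp add: multihomogeneous_def homogeneous_def multiset_eq_iff count_content count_mset)

lemma fa_val_in_value_space:
  assumes "f \<in> proper_comp ns"
  shows "fa_val f \<in> value_space (content ns)"
proof -
  have "f \<in> fa.span {p \<in> commutator_products. homogeneous (content ns) p}"
    using assms proper_polys_span by (intro homogeneous_proper_span) (auto simp: proper_comp_def multihomogeneous_iff)
  then show ?thesis
  proof (induction f rule: fa.span_induct_alt)
    case base
    then show ?case using value_space_zero by (simp add: fa_val_0 zero_fun_def)
  next
    case (step c p g)
    then obtain iss where iss: "p = commutator_product iss" "\<forall>is\<in>set iss. length is \<ge> 2"
      and hom: "homogeneous (content ns) p"
      by (auto simp: commutator_products_def)
    have "fa_val p \<in> value_space (content ns)"
    proof (cases "p = 0 \<or> \<not> (\<forall>is\<in>set iss. length is = 2)")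
      case True
      then have "fa_val p = 0"
      proof
        assume "\<not> (\<forall>is\<in>set iss. length is = 2)"
        then show ?thesis unfolding iss(1) fa_val_commutator_product[OF iss(2)] by auto
      qed (simp add: fa_val_0)
      then show ?thesis by (simp add: value_space_def gf.span_zero)
    next
      case False
      then obtain u where "u \<in> Poly_Mapping.keys p" by (metis all_not_in_conv keys_eq_empty)
      moreover have "homogeneous (mset (concat iss)) p"
        unfolding iss(1) by (rule homogeneous_commutator_product[OF iss(2)])
      ultimately have "content ns = mset (concat iss)"
        using hom unfolding homogeneous_def by metis
      also have "\<dots> = array_content (map (\<lambda>is. (is ! 0, is ! 1)) iss)"
      proof -
        have "mset (concat iss) = array_content (map (\<lambda>is. (is ! 0, is ! 1)) iss)" if "\<forall>is\<in>set iss. length is = 2"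
          using that
        proof (induction iss)
          case (Cons is' iss)
          then obtain a b where "is' = [a, b]" by (auto simp: length_Suc_conv numeral_2_eq_2)
          then show ?case using Cons by (simp add: array_content_def)
        qed (simp add: array_content_def)
        then show ?thesis using False by blast
      qed
      finally have "array_content (map (\<lambda>is. (is ! 0, is ! 1)) iss) = content ns" ..
      moreover have "fa_val p = array_val (map (\<lambda>is. (is ! 0, is ! 1)) iss)"
        using False unfolding iss(1) fa_val_commutator_product[OF iss(2)] by simp
      ultimately show ?thesis by (simp only: array_val_in)
    qed
    then show ?case using step.IH
      unfolding fa_val_add fa_val_scale value_space_def by (intro gf.span_add gf.span_scale)
  qed
qed

lemma array_poly_product: "array_poly S = commutator_product (map (\<lambda>(a, b). [a, b]) S)"
  by (simp add: array_poly_def commutator_product_def o_def case_prod_beta')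

lemma fa_val_array_poly: "fa_val (array_poly S) = array_val S"
  unfolding array_poly_product by (subst fa_val_commutator_product) (auto simp: o_def case_prod_beta)

lemma array_poly_proper_comp:
  assumes "array_content S = content ns"
  shows "array_poly S \<in> proper_comp ns"
proof -
  have alg: "is_subalgebra (proper_polys :: 'a free_alg set)"
    unfolding proper_polys_def by (rule hull_in) (simp add: is_subalgebra_def)
  have "commutator (var a) (var b) \<in> (proper_polys :: 'a free_alg set)" for a b
    unfolding proper_polys_def by (rule hull_inc) (rule CollectI, rule exI[of _ "[a, b]"], simp)
  then have proper: "array_poly S \<in> (proper_polys :: 'a free_alg set)"
    using alg by (induction S) (auto simp: array_poly_def is_subalgebra_def)
  have "mset (concat (map (\<lambda>(a, b). [a, b]) S)) = array_content S"
    by (induction S) (auto simp: array_content_def)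
  moreover have "\<forall>is\<in>set (map (\<lambda>(a, b). [a, b]) S). length is \<ge> 2" by auto
  ultimately have "homogeneous (content ns) (array_poly S :: 'a free_alg)"
    using homogeneous_commutator_product[of "map (\<lambda>(a, b). [a, b]) S"] assms
    unfolding array_poly_product by metis
  with proper show ?thesis by (simp add: proper_comp_def multihomogeneous_iff)
qed

lemma has_content_iff: "has_content S ns \<longleftrightarrow> array_content S = content ns"
proof
  assume h: "has_content S ns"
  then have "content ns \<subseteq># array_content S"
    by (intro mset_subset_eqI) (auto simp: has_content_def count_content array_content_def)
  moreover have "size (content ns) = size (array_content S)"
    using h by (simp add: size_content has_content_def array_content_def)
  ultimately show "array_content S = content ns"
    by (metis subset_mset.le_imp_less_or_eq mset_subset_size less_irrefl)
next
  assume h: "array_content S = content ns"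
  then have "sum_list ns = size (array_content S)" by (simp add: size_content)
  also have "\<dots> = 2 * length S" by (simp add: array_content_def)
  finally show "has_content S ns"
    unfolding has_content_def array_content_def[symmetric] h by (simp add: count_content)
qed

lemma normal_c_arrays_eq:
  assumes "\<forall>i<length ns. ns ! i \<le> 2"
  shows "normal_c_arrays ns = {S. normal_array S \<and> array_content S = content ns}"
  using assms by (auto simp: normal_c_arrays_def normal_array_def has_content_iff)

lemma finite_arrays: "finite {S. array_content S = m}"
proof (rule finite_subset)
  show "{S. array_content S = m} \<subseteq> {S. set S \<subseteq> set_mset m \<times> set_mset m \<and> length S \<le> size m}"
    by (auto simp: array_content_def) (force simp: image_iff)+
  show "finite {S. set S \<subseteq> set_mset m \<times> set_mset m \<and> length S \<le> size m}"
    by (intro finite_lists_length_le) simp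
qed

section \<open>Bases of the quotients\<close>

lemma fa_coset_eq_zero_iff:
  assumes "fa_subspace U"
  shows "fa_coset U f = U \<longleftrightarrow> f \<in> U"
proof
  assume "fa_coset U f = U"
  moreover have "f \<in> fa_coset U f" using assms by (simp add: fa_coset_iff fa_subspace_def)
  ultimately show "f \<in> U" by simp
next
  assume f: "f \<in> U"
  have iff: "x - f \<in> U \<longleftrightarrow> x \<in> U" for x
  proof
    assume "x - f \<in> U"
    then have "(x - f) + f \<in> U" using f assms by (simp only: fa_subspace_def)
    then show "x \<in> U" by simp
  qed (rule fa_subspace_minus[OF assms _ f])
  show "fa_coset U f = U"
    by (rule Set.set_eqI) (simp only: fa_coset_iff iff)
qed

text \<open>
  Cosets of a family form a basis of the quotient if the family is independent and generates
  modulo the subspace; linear combinations of cosets are cosets of linear combinations.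
\<close>

lemma fa_quotient_basis:
  fixes U V :: "'a::field free_alg set"
  assumes U: "fa_subspace U" and V: "fa_subspace V" and I: "finite I" "g ` I \<subseteq> V"
    and indep: "\<And>c. (\<Sum>i\<in>I. fa_scale (c i) (g i)) \<in> U \<Longrightarrow> \<forall>i\<in>I. c i = 0"
    and gen: "\<And>f. f \<in> V \<Longrightarrow> \<exists>c. f - (\<Sum>i\<in>I. fa_scale (c i) (g i)) \<in> U"
  shows "inj_on (\<lambda>i. fa_coset U (g i)) I"
    "vectorspace.basis field_ring (fa_quotient V U) ((\<lambda>i. fa_coset U (g i)) ` I)"
    "vectorspace.dim field_ring (fa_quotient V U) = card I"
proof -
  let ?Q = "fa_quotient V U" and ?cls = "\<lambda>i. fa_coset U (g i)"
  interpret Q: vectorspace field_ring ?Q by (rule vectorspace_fa_quotient[OF U V])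
  have V': "0 \<in> V" "\<And>f g. f \<in> V \<Longrightarrow> g \<in> V \<Longrightarrow> f + g \<in> V"
    "\<And>c f. f \<in> V \<Longrightarrow> fa_scale c f \<in> V"
    using V by (simp_all add: fa_subspace_def)
  have carr: "fa_coset U f \<in> carrier ?Q" if "f \<in> V" for f
    using that by (simp add: fa_quotient_def)
  have gV: "g i \<in> V" if "i \<in> I" for i
    using that I(2) by blast
  note ops = fa_quotient_ops[OF U, of V]
  show inj: "inj_on ?cls I"
  proof (rule inj_onI, rule ccontr)
    fix i j assume ij: "i \<in> I" "j \<in> I" "?cls i = ?cls j" "i \<noteq> j"
    let ?c = "\<lambda>x. if x = i then 1 else if x = j then - 1 else 0"
    have "(\<Sum>x\<in>I. fa_scale (?c x) (g x)) = (\<Sum>x\<in>{i, j}. fa_scale (?c x) (g x))"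
      using I ij by (intro sum.mono_neutral_right) (auto simp: fa_scale_simps)
    also have "\<dots> = g i - g j" using ij by (simp add: fa_scale_simps)
    also have "\<dots> \<in> U"
      using ij(3) U by (metis fa_coset_iff diff_self fa_subspace_def)
    finally show False using indep[of ?c] ij by fastforce
  qed
  have lincomb: "Q.lincomb a (?cls ` J) = fa_coset U (\<Sum>i\<in>J. fa_scale (a (?cls i)) (g i))"
    if "finite J" "J \<subseteq> I" for a J
    using that
  proof (induction J rule: finite_induct)
    case empty
    then show ?case by (simp add: Q.lincomb_def ops)
  next
    case (insert i J)
    have smult: "a x \<odot>\<^bsub>?Q\<^esub> x \<in> carrier ?Q" if "x \<in> ?cls ` insert i J" for x
      using that insert.prems by (auto simp: ops intro!: carr V'(3) gV)
    have "?cls i \<notin> ?cls ` J"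
      using insert inj by (auto simp: inj_on_def)
    then have "Q.lincomb a (?cls ` insert i J) = a (?cls i) \<odot>\<^bsub>?Q\<^esub> ?cls i \<oplus>\<^bsub>?Q\<^esub> Q.lincomb a (?cls ` J)"
      unfolding Q.lincomb_def image_insert using insert.hyps smult
      by (subst Q.finsum_insert) auto
    then show ?case using insert by (simp add: ops)
  qed
  have ex: "\<exists>a. X = Q.lincomb a (?cls ` I)" if X: "X \<in> carrier ?Q" for X
  proof -
    obtain f where f: "X = fa_coset U f" "f \<in> V" using X by (auto simp: fa_quotient_def)
    obtain c where c: "f - (\<Sum>i\<in>I. fa_scale (c i) (g i)) \<in> U" using gen[OF f(2)] by blast
    let ?a = "\<lambda>Y. c (the_inv_into I ?cls Y)"
    have "Q.lincomb ?a (?cls ` I) = fa_coset U (\<Sum>i\<in>I. fa_scale (c i) (g i))"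
      using lincomb[OF I(1) subset_refl, of ?a] by (simp add: the_inv_into_f_f[OF inj])
    also have "\<dots> = X"
    proof -
      have "x - (\<Sum>i\<in>I. fa_scale (c i) (g i)) \<in> U \<longleftrightarrow> x - f \<in> U" for x
      proof
        assume "x - f \<in> U"
        then have "(x - f) + (f - (\<Sum>i\<in>I. fa_scale (c i) (g i))) \<in> U" using c U by (simp only: fa_subspace_def)
        then show "x - (\<Sum>i\<in>I. fa_scale (c i) (g i)) \<in> U" by simp
      next
        assume "x - (\<Sum>i\<in>I. fa_scale (c i) (g i)) \<in> U"
        from fa_subspace_minus[OF U this c] show "x - f \<in> U" by simp
      qed
      then show ?thesis unfolding f(1) by (intro Set.set_eqI) (simp only: fa_coset_iff)
    qed
    finally show ?thesis by metis
  qed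
  have sub: "?cls ` I \<subseteq> carrier ?Q" using I(2) carr by auto
  have closed: "Q.lincomb a (?cls ` I) \<in> carrier ?Q" for a
    by (rule Q.lincomb_closed[OF sub]) (simp add: field_ring_def)
  have "Q.span (?cls ` I) = {Q.lincomb a (?cls ` I) | a. a \<in> ?cls ` I \<rightarrow> carrier field_ring}"
    using I(1) sub by (intro Q.finite_span) auto
  also have "\<dots> = range (\<lambda>a. Q.lincomb a (?cls ` I))"
    by (auto simp: field_ring_def)
  also have "\<dots> = carrier ?Q"
    using ex closed by blast
  finally have "Q.gen_set (?cls ` I)" .
  moreover have "Q.lin_indpt (?cls ` I)"
  proof (rule Q.finite_lin_indpt2)
    fix a assume "Q.lincomb a (?cls ` I) = \<zero>\<^bsub>?Q\<^esub>"
    then have "fa_coset U (\<Sum>i\<in>I. fa_scale (a (?cls i)) (g i)) = U"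
      using lincomb[OF I(1) subset_refl, of a] by (simp add: fa_quotient_def)
    then have "\<forall>i\<in>I. a (?cls i) = 0"
      using fa_coset_eq_zero_iff[OF U] indep[of "\<lambda>i. a (?cls i)"] by blast
    then show "\<forall>v\<in>?cls ` I. a v = \<zero>\<^bsub>field_ring\<^esub>" by (simp add: field_ring_def)
  qed (use I sub in auto)
  ultimately show basis: "Q.basis (?cls ` I)" using sub by (simp add: Q.basis_def)
  show "Q.dim = card I"
    using Q.dim_basis[OF _ basis] I(1) card_image[OF inj] by simp
qed

lemma proper_quotient_trivial_iff:
  "carrier (proper_quotient ns :: ('a::field, 'a free_alg set) module) = {\<zero>\<^bsub>proper_quotient ns\<^esub>} \<longleftrightarrow>
    proper_comp ns \<subseteq> (I_w :: 'a free_alg set)"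
proof -
  let ?V = "proper_comp ns :: 'a free_alg set" and ?U = "proper_comp ns \<inter> (I_w :: 'a free_alg set)"
  have U: "fa_subspace ?U"
    using fa_subspace_proper_comp[of ns] fa_subspace_I_w by (auto simp: fa_subspace_def)
  have "fa_subspace ?V" by (rule fa_subspace_proper_comp)
  then have "0 \<in> ?V" by (simp add: fa_subspace_def)
  then have iff: "carrier (fa_quotient ?V ?U) = {\<zero>\<^bsub>fa_quotient ?V ?U\<^esub>} \<longleftrightarrow> (\<forall>f\<in>?V. fa_coset ?U f = ?U)"
    by (auto simp: fa_quotient_def)
  then show ?thesis
    unfolding proper_quotient_def iff fa_coset_eq_zero_iff[OF U] by auto
qed

lemma fa_val_lincomb:
  "finite I \<Longrightarrow> fa_val (\<Sum>i\<in>I. fa_scale (c i) (g i)) = (\<Sum>i\<in>I. gf_scale (c i) (fa_val (g i)))"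
  by (induction I rule: finite_induct) (simp_all add: fa_val_0 fa_val_add fa_val_scale)

lemma proper_comp_in_I_w_iff: "f \<in> proper_comp ns \<Longrightarrow> f \<in> I_w \<longleftrightarrow> fa_val f = 0"
  by (rule proper_in_I_w_iff) (simp add: proper_comp_def)

lemma content_card:
  assumes "\<forall>i<length ns. ns ! i \<le> 2"
  shows "singles (content ns) = {i. i < length ns \<and> ns ! i = 1}"
    "doubles (content ns) = {i. i < length ns \<and> ns ! i = 2}"
    "sum_list ns = card (singles (content ns)) + 2 * card (doubles (content ns))"
proof -
  show s: "singles (content ns) = {i. i < length ns \<and> ns ! i = 1}"
    and d: "doubles (content ns) = {i. i < length ns \<and> ns ! i = 2}"
    by (auto simp: singles_def doubles_def count_content)
  have "sum_list ns = (\<Sum>i<length ns. of_bool (ns ! i = 1) + 2 * of_bool (ns ! i = 2))"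
    unfolding sum_list_sum_nth atLeast0LessThan
  proof (rule sum.cong)
    fix i assume "i \<in> {..<length ns}"
    then have "ns ! i \<le> 2" using assms by simp
    then show "ns ! i = of_bool (ns ! i = 1) + 2 * of_bool (ns ! i = 2)"
      by (auto simp: le_Suc_eq numeral_2_eq_2)
  qed simp
  also have "\<dots> = card ({..<length ns} \<inter> {i. ns ! i = 1}) + 2 * card ({..<length ns} \<inter> {i. ns ! i = 2})"
    by (simp add: sum.distrib sum_of_bool_eq flip: sum_distrib_left)
  finally show "sum_list ns = card (singles (content ns)) + 2 * card (doubles (content ns))"
    unfolding s d by (simp add: Int_def)
qed

theorem theorem7p1:
  fixes ns :: "nat list" and n l q :: nat
    and quot :: "('a::field, 'a free_alg set) module"
    and cls :: "array \<Rightarrow> 'a free_alg set"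
  assumes "infinite (UNIV :: 'a set)"
    and "CHAR('a) \<noteq> 2"
    and "l = card {i. i < length ns \<and> ns ! i = 1}"
    and "q = card {i. i < length ns \<and> ns ! i = 2}"
    and "n = sum_list ns"
    and "quot = proper_quotient ns"
    and "cls = (\<lambda>S. fa_coset (proper_comp ns \<inter> I_w) (array_poly S))"
  shows "(carrier quot = {\<zero>\<^bsub>quot\<^esub>} \<longleftrightarrow>
            odd n
            \<or> even n \<and> (\<exists>i<length ns. ns ! i > 2)
            \<or> even n \<and> (\<forall>i<length ns. ns ! i \<le> 2) \<and> l = 0 \<and> odd q)
       \<and> (\<not> (odd n
            \<or> even n \<and> (\<exists>i<length ns. ns ! i > 2)
            \<or> even n \<and> (\<forall>i<length ns. ns ! i \<le> 2) \<and> l = 0 \<and> odd q) \<longrightarrow>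
            inj_on cls (normal_c_arrays ns)
            \<and> vectorspace.basis field_ring quot (cls ` normal_c_arrays ns)
            \<and> (\<exists>s. l = 2 * s \<and>
                 vectorspace.dim field_ring quot = (if s = 0 then 1 else (2 * s - 1) choose s)))"
    (is "(?zero \<longleftrightarrow> ?bad) \<and> (\<not> ?bad \<longrightarrow> ?basis)")
proof -
  let ?m = "content ns" and ?V = "proper_comp ns :: 'a free_alg set"
  have two: "(2 :: 'a) \<noteq> 0"
  proof
    assume "(2 :: 'a) = 0"
    then have "of_nat 2 = (0 :: 'a)" by simp
    then have dvd: "CHAR('a) dvd 2" by (simp only: of_nat_eq_0_iff_char_dvd)
    then have "CHAR('a) \<noteq> 0" by (metis dvd_0_left_iff zero_neq_numeral)
    moreover have "CHAR('a) \<le> 2" by (rule dvd_imp_le[OF dvd]) simp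
    ultimately have "CHAR('a) = 1" using assms(2) by linarith
    then show False using of_nat_CHAR[where 'a = 'a] by simp
  qed
  have U: "fa_subspace (?V \<inter> I_w)"
    using fa_subspace_proper_comp[of ns] fa_subspace_I_w by (auto simp: fa_subspace_def)
  have trivial: ?zero if bad: ?bad
  proof -
    have "value_space ?m \<subseteq> {0 :: (letter \<Rightarrow> 'a odd_elem) \<Rightarrow> _}"
    proof (cases "odd n")
      case True
      have "even (size (array_content T))" for T by (simp add: array_content_def)
      then have "{T. array_content T = ?m} = {}"
        using True by (auto simp: assms(5)) (metis size_content)
      then show ?thesis by (simp add: value_space_def)
    next
      case False
      then consider i where "i < length ns" "ns ! i > 2"
        | "\<forall>i<length ns. ns ! i \<le> 2" "l = 0" "odd q" using bad by blast
      then show ?thesis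
      proof cases
        case 1
        then have "count ?m i > 2" by (simp add: count_content)
        then show ?thesis by (intro value_space_trivial[OF two]) blast
      next
        case 2
        then have "card (singles ?m) = 0" "odd (card (doubles ?m))"
          using content_card[OF 2(1)] assms(3,4) by simp_all
        then show ?thesis by (intro value_space_trivial[OF two]) simp
      qed
    qed
    then have "f \<in> I_w" if "f \<in> ?V" for f
      using fa_val_in_value_space[OF that] proper_comp_in_I_w_iff[OF that] by blast
    then show ?zero unfolding assms(6) proper_quotient_trivial_iff by blast
  qed
  have good: "?basis \<and> \<not> ?zero" if "\<not> ?bad"
  proof -
    have le2: "\<forall>i<length ns. ns ! i \<le> 2" and "even n" and lq: "l \<noteq> 0 \<or> even q"
      using that by (meson not_less)+
    have m: "count ?m i \<le> 2" for i using le2 by (simp add: count_content)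
    have cl: "card (singles ?m) = l" "card (doubles ?m) = q"
      using content_card[OF le2] assms(3,4) by simp_all
    then have ok: "singles ?m \<noteq> {} \<or> even (card (doubles ?m))" using lq by auto
    obtain s where s: "l = 2 * s"
      using \<open>even n\<close> content_card(3)[OF le2] cl assms(5) by (metis even_add dvd_triv_left evenE)
    let ?N = "normal_c_arrays ns"
    have N: "?N = {S. normal_array S \<and> array_content S = ?m}" by (rule normal_c_arrays_eq[OF le2])
    have fin: "finite ?N" unfolding N by (rule finite_subset[OF _ finite_arrays[of ?m]]) auto
    note indep = normal_array_vals_independent[OF two fin, of ?m]
    have inj: "inj_on (array_val :: array \<Rightarrow> (letter \<Rightarrow> 'a odd_elem) \<Rightarrow> _) ?N"
      and ind: "\<not> gf.dependent (array_val ` ?N :: ((letter \<Rightarrow> 'a odd_elem) \<Rightarrow> _) set)"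
      using indep by (auto simp: N)
    have span: "value_space ?m \<subseteq> gf.span (array_val ` ?N :: ((letter \<Rightarrow> 'a odd_elem) \<Rightarrow> _) set)"
      unfolding value_space_def N using straightening[OF two m] by (intro gf.span_minimal) auto
    have sub: "array_val ` ?N \<subseteq> (value_space ?m :: ((letter \<Rightarrow> 'a odd_elem) \<Rightarrow> _) set)"
      by (auto simp: N intro: array_val_in)
    \<comment> \<open>The normal arrays and the words indexed by halves are two bases of the same space.\<close>
    have "card ?N = gf.dim (value_space ?m :: ((letter \<Rightarrow> 'a odd_elem) \<Rightarrow> _) set)"
      using gf.basis_card_eq_dim[OF sub span ind] card_image[OF inj] by simp
    also have "\<dots> = (if s = 0 then 1 else (2 * s - 1) choose s)"
      using dim_value_space[OF two m ok] card_halves[of ?m s] cl(1) s by simp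
    finally have card: "card ?N = (if s = 0 then 1 else (2 * s - 1) choose s)" .
    have inV: "array_poly S \<in> ?V" if "S \<in> ?N" for S
      using that by (intro array_poly_proper_comp) (simp add: N)
    have val: "fa_val (\<Sum>S\<in>?N. fa_scale (c S) (array_poly S)) = (\<Sum>S\<in>?N. gf_scale (c S) (array_val S :: (letter \<Rightarrow> 'a odd_elem) \<Rightarrow> _))" for c
      by (simp add: fa_val_lincomb[OF fin] fa_val_array_poly)
    have combV: "(\<Sum>S\<in>?N. fa_scale (c S) (array_poly S)) \<in> ?V" for c
    proof -
      have "(\<Sum>S\<in>J. fa_scale (c S) (array_poly S)) \<in> ?V" if "finite J" "J \<subseteq> ?N" for J
        using that fa_subspace_proper_comp[of ns] inV
        by (induction J rule: finite_induct) (auto simp: fa_subspace_def)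
      then show ?thesis using fin by blast
    qed
    have lin: "\<forall>S\<in>?N. c S = 0" if "(\<Sum>S\<in>?N. fa_scale (c S) (array_poly S)) \<in> ?V \<inter> I_w" for c
    proof
      fix S assume S: "S \<in> ?N"
      have "(\<Sum>S\<in>?N. gf_scale (c S) (array_val S :: (letter \<Rightarrow> 'a odd_elem) \<Rightarrow> _)) = 0"
        using that proper_comp_in_I_w_iff[OF combV] val by simp
      then have "(\<Sum>F\<in>array_val ` ?N. gf_scale (c (the_inv_into ?N array_val F)) (F :: (letter \<Rightarrow> 'a odd_elem) \<Rightarrow> _)) = 0"
        by (simp add: sum.reindex[OF inj] the_inv_into_f_f[OF inj])
      from gf.independentD[OF ind finite_imageI[OF fin] subset_refl this imageI[OF S]]
      show "c S = 0" by (simp add: the_inv_into_f_f[OF inj S])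
    qed
    have gen: "\<exists>c. f - (\<Sum>S\<in>?N. fa_scale (c S) (array_poly S)) \<in> ?V \<inter> I_w" if f: "f \<in> ?V" for f
    proof -
      have "fa_val f \<in> gf.span (array_val ` ?N)" using fa_val_in_value_space[OF f] span by blast
      then obtain r where "fa_val f = (\<Sum>F\<in>array_val ` ?N. gf_scale (r F) F)"
        using gf.span_finite[OF finite_imageI[OF fin]] by auto
      then have f_val: "fa_val f = (\<Sum>S\<in>?N. gf_scale (r (array_val S)) (array_val S))"
        by (simp add: sum.reindex[OF inj])
      let ?g = "\<Sum>S\<in>?N. fa_scale (r (array_val S)) (array_poly S)"
      have diff: "f - ?g \<in> ?V" by (rule fa_subspace_minus[OF fa_subspace_proper_comp f combV])
      have "fa_val f = fa_val (f - ?g) + fa_val ?g" by (simp flip: fa_val_add)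
      then have "fa_val (f - ?g) = 0" using f_val val by simp
      then have "f - ?g \<in> I_w" by (simp only: proper_comp_in_I_w_iff[OF diff])
      with diff show ?thesis by (intro exI[of _ "\<lambda>S. r (array_val S)"] IntI)
    qed
    have "array_poly ` ?N \<subseteq> ?V" using inV by blast
    note b = fa_quotient_basis[OF U fa_subspace_proper_comp fin this lin gen]
    have ?basis
      using b s card unfolding assms(6,7) proper_quotient_def by auto
    moreover have "\<not> ?zero"
    proof
      assume ?zero
      then have VI: "?V \<subseteq> I_w" unfolding assms(6) proper_quotient_trivial_iff .
      have "(\<Sum>S\<in>?N. fa_scale 1 (array_poly S)) \<in> ?V" by (rule combV)
      from IntI[OF this subsetD[OF VI this]]
      have "(\<Sum>S\<in>?N. fa_scale 1 (array_poly S)) \<in> ?V \<inter> I_w" .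
      from lin[of "\<lambda>_. 1", OF this] have "?N = {}" by auto
      then have "card ?N = 0" by simp
      then show False using card by (auto simp: binomial_eq_0_iff split: if_splits)
    qed
    ultimately show ?thesis by blast
  qed
  show ?thesis using trivial good by blast
qed

end
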